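(* Let $V\in C^\infty(\mathbb{R}^n)$ be a real-valued potential with a unique global minimum, located at $x=0$, which is non-degenerate and at which $V(0)=0$, and suppose that $V^{-1}([0,\epsilon])$ is compact for $\epsilon>0$ sufficiently small. Assume that $V(x_1,\dots,x_n)=V(\pm x_1,\dots,\pm x_n)$ for any choice of signs, and that $$V(x)=\sum_{i=1}^n u_i\,x_i^2+O(|x|^4),$$ where $u_1,\dots,u_n$ are linearly independent over the rational numbers. Then the Birkhoff canonical form of the classical Hamiltonian $$H(x,\xi)=\sum_{i=1}^n\xi_i^2+V(x)$$ at $x=0$, $\xi=0$ determines the Taylor series of $V$ at $x=0$.
   Context: The (classical) Birkhoff canonical form of $H$ at $(0,0)$ is the formal series $\sum_{i=1}^\infty H_i(x_1^2+\xi_1^2,\dots,x_n^2+\xi_n^2)$, where $H_i(s_1,\dots,s_n)$ is a homogeneous polynomial of degree $i$ in $s$, such that for every $N\ge1$ there are a neighborhood $\mathcal{O}$ of $(0,0)$ in $\mathbb{R}^{2n}$ and a canonical transformation $\kappa:\mathcal{O}\hookrightarrow\mathbb{R}^{2n}$ with $\kappa(0,0)=(0,0)$ for which $$\kappa^*H=\sum_{i=1}^N H_i(x_1^2+\xi_1^2,\dots,x_n^2+\xi_n^2)+\rho_N,$$ where $\rho_N$ vanishes to order $2N+2$ at $(0,0)$. Here $\kappa$ is obtained by composing a linear symplectic rescaling of the form $x_i\mapsto c_ix_i$, $\xi_i\mapsto c_i^{-1}\xi_i$ ($i=1,\dots,n$), which brings the quadratic part of $H$ to a linear combination of the $x_i^2+\xi_i^2$,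 with canonical transformations tangent to the identity at $(0,0)$. *)

theory Defs
  imports "HOL-Analysis.Analysis" "HOL-Library.Landau_Symbols"
begin

section \<open>Smooth maps and partial derivatives\<close>

text \<open>Intended for open sets only: on an open set these are the usual classes $C^k$
  and $C^\infty$.\<close>

fun Ck_on :: "nat \<Rightarrow> ('a::euclidean_space \<Rightarrow> 'b::euclidean_space) \<Rightarrow> 'a set \<Rightarrow> bool" where
  "Ck_on 0 f S \<longleftrightarrow> continuous_on S f"
| "Ck_on (Suc k) f S \<longleftrightarrow>
     f differentiable_on S \<and> (\<forall>v. Ck_on k (\<lambda>x. frechet_derivative f (at x) v) S)"

definition smooth_on :: "('a::euclidean_space \<Rightarrow> 'b::euclidean_space) \<Rightarrow> 'a set \<Rightarrow> bool" where
  "smooth_on f S \<longleftrightarrow> (\<forall>k. Ck_on k f S)"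

definition partial_deriv :: "'n::finite \<Rightarrow> (real^'n \<Rightarrow> real) \<Rightarrow> real^'n \<Rightarrow> real" where
  "partial_deriv i f = (\<lambda>x. frechet_derivative f (at x) (axis i 1))"

text \<open>The list \<open>[i\<^sub>1, \<dots>, i\<^sub>k]\<close> stands for the operator
  $\partial_{i_1} \cdots \partial_{i_k}$.\<close>

definition partial_derivs :: "'n::finite list \<Rightarrow> (real^'n \<Rightarrow> real) \<Rightarrow> real^'n \<Rightarrow> real" where
  "partial_derivs is f = foldr partial_deriv is f"

text \<open>Lists replace multi-indices because the index type carries no order; for a smooth
  function the derivatives commute, so the values of all iterated partial derivatives at \<open>x\<close>
  are exactly the data of the Taylor series at \<open>x\<close>.\<close>

definition same_Taylor_series_at ::
    "(real^'n::finite \<Rightarrow> real) \<Rightarrow> (real^'n \<Rightarrow> real) \<Rightarrow> real^'n \<Rightarrow> bool" where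
  "same_Taylor_series_at f g x \<longleftrightarrow> (\<forall>is. partial_derivs is f x = partial_derivs is g x)"

definition hessian :: "(real^'n::finite \<Rightarrow> real) \<Rightarrow> real^'n \<Rightarrow> real^'n^'n" where
  "hessian f x = (\<chi> i j. partial_derivs [i, j] f x)"


section \<open>Potentials\<close>

definition is_potential :: "(real^'n::finite \<Rightarrow> real) \<Rightarrow> bool" where
  "is_potential V \<longleftrightarrow>
     smooth_on V UNIV \<and>
     V 0 = 0 \<and> (\<forall>x. x \<noteq> 0 \<longrightarrow> V 0 < V x) \<and>
     invertible (hessian V 0) \<and>
     (\<exists>\<epsilon>\<^sub>0>0. \<forall>\<epsilon>. 0 < \<epsilon> \<and> \<epsilon> \<le> \<epsilon>\<^sub>0 \<longrightarrow> compact (V -` {0..\<epsilon>}))"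

definition sign_symmetric :: "(real^'n::finite \<Rightarrow> real) \<Rightarrow> bool" where
  "sign_symmetric V \<longleftrightarrow>
     (\<forall>\<sigma> x. (\<forall>i. \<sigma> i \<in> {-1, 1}) \<longrightarrow> V (\<chi> i. \<sigma> i * x $ i) = V x)"

definition quadratic_expansion :: "(real^'n::finite \<Rightarrow> real) \<Rightarrow> ('n \<Rightarrow> real) \<Rightarrow> bool" where
  "quadratic_expansion V u \<longleftrightarrow>
     (\<lambda>x. V x - (\<Sum>i\<in>UNIV. u i * (x $ i)^2)) \<in> O[at 0](\<lambda>x. norm x ^ 4)"

definition rationally_independent :: "('n::finite \<Rightarrow> real) \<Rightarrow> bool" where
  "rationally_independent u \<longleftrightarrow>
     inj u \<and> module.independent (\<lambda>(q::rat) (x::real). of_rat q * x) (range u)"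


section \<open>Classical mechanics on phase space\<close>

type_synonym 'n phase = "(real^'n) \<times> (real^'n)"

definition hamiltonian :: "(real^'n::finite \<Rightarrow> real) \<Rightarrow> 'n phase \<Rightarrow> real" where
  "hamiltonian V = (\<lambda>(x, \<xi>). (\<Sum>i\<in>UNIV. (\<xi> $ i)^2) + V x)"

definition symplectic_form :: "'n::finite phase \<Rightarrow> 'n phase \<Rightarrow> real" where
  "symplectic_form = (\<lambda>(x, \<xi>) (y, \<eta>). \<xi> \<bullet> y - x \<bullet> \<eta>)"

text \<open>A canonical transformation of an open set onto its image. The derivative preserves the
  symplectic form and hence is invertible, so together with injectivity this makes \<open>\<kappa>\<close> an
  open embedding.\<close>

definition canonical_on :: "'n::finite phase set \<Rightarrow> ('n phase \<Rightarrow> 'n phase) \<Rightarrow> bool" where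
  "canonical_on U \<kappa> \<longleftrightarrow>
     smooth_on \<kappa> U \<and> inj_on \<kappa> U \<and>
     (\<forall>z\<in>U. \<forall>v w. symplectic_form (frechet_derivative \<kappa> (at z) v) (frechet_derivative \<kappa> (at z) w)
                    = symplectic_form v w)"

definition rescaling :: "('n::finite \<Rightarrow> real) \<Rightarrow> 'n phase \<Rightarrow> 'n phase" where
  "rescaling c = (\<lambda>(x, \<xi>). (\<chi> i. c i * x $ i, \<chi> i. inverse (c i) * \<xi> $ i))"

definition actions :: "'n::finite phase \<Rightarrow> real^'n" where
  "actions = (\<lambda>(x, \<xi>). \<chi> i. (x $ i)^2 + (\<xi> $ i)^2)"


section \<open>Birkhoff canonical form\<close>

text \<open>Polynomials over the reals are identified with polynomial functions; the exponents
  \<open>\<alpha> :: 'n \<Rightarrow> nat\<close> are multi-indices. The lemma shows that the sum is not vacuous.\<close>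

definition homogeneous_polynomial :: "nat \<Rightarrow> (real^'n::finite \<Rightarrow> real) \<Rightarrow> bool" where
  "homogeneous_polynomial d p \<longleftrightarrow>
     (\<exists>a. \<forall>s. p s = (\<Sum>\<alpha> | (\<Sum>j\<in>UNIV. \<alpha> j) = d. a \<alpha> * (\<Prod>j\<in>UNIV. (s $ j) ^ \<alpha> j)))"

lemma finite_multi_indices: "finite {\<alpha> :: 'n::finite \<Rightarrow> nat. (\<Sum>j\<in>UNIV. \<alpha> j) = d}"
proof (rule finite_subset)
  show "{\<alpha> :: 'n \<Rightarrow> nat. (\<Sum>j\<in>UNIV. \<alpha> j) = d} \<subseteq> PiE UNIV (\<lambda>_. {..d})"
    by (auto simp: PiE_def intro: member_le_sum)
  show "finite (PiE (UNIV :: 'n set) (\<lambda>_. {..d}))"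
    by (intro finite_PiE) auto
qed

text \<open>\<open>birkhoff_form H F\<close> says that the formal series $\sum_{i \ge 1} F_i$ is a Birkhoff canonical
  form of \<open>H\<close> at the origin; \<open>F 0\<close> plays no role. The transformation \<open>\<kappa>\<close> and its neighbourhood
  \<open>U\<close> may depend on \<open>N\<close>. Canonical transformations tangent to the identity at the
  origin are closed under composition (on a smaller neighbourhood) and under conjugation by a
  rescaling, so a single one, \<open>\<phi>\<close>, composed with one rescaling is the general case. That the
  rescaling brings the quadratic part of \<open>H\<close> to a linear combination of the
  $x_i^2 + \xi_i^2$ is forced by the last clause, as \<open>N \<ge> 1\<close> and \<open>\<phi>\<close> is tangent to the
  identity. For the smooth remainder, vanishing to order $2N+2$ is the bound
  $O(|(x,\xi)|^{2N+2})$.\<close>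

definition birkhoff_form ::
    "('n::finite phase \<Rightarrow> real) \<Rightarrow> (nat \<Rightarrow> real^'n \<Rightarrow> real) \<Rightarrow> bool" where
  "birkhoff_form H F \<longleftrightarrow>
     (\<forall>i\<ge>1. homogeneous_polynomial i (F i)) \<and>
     (\<forall>N\<ge>1. \<exists>U \<kappa> c \<phi>.
        open U \<and> (0, 0) \<in> U \<and>
        canonical_on U \<kappa> \<and> \<kappa> (0, 0) = (0, 0) \<and>
        (\<forall>i. c i \<noteq> 0) \<and>
        canonical_on U \<phi> \<and> \<phi> (0, 0) = (0, 0) \<and> (\<phi> has_derivative id) (at (0, 0)) \<and>
        (\<forall>z\<in>U. \<kappa> z = rescaling c (\<phi> z)) \<and>
        (\<lambda>z. H (\<kappa> z) - (\<Sum>i=1..N. F i (actions z))) \<in> O[at (0, 0)](\<lambda>z. norm z ^ (2 * N + 2)))"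

end

(* Let V and W have the same Birkhoff form f and agree to order d - 1 at the origin, and let P be
   the homogeneous part of degree d of V - W. Composing the normalizing transformation of one
   Hamiltonian with the inverse of the other gives a symplectic germ psi tangent to the identity
   with f o psi = f - P(c x) up to order d + 1, where c is the common rescaling. If X = log psi is
   the formal generator of psi, then X f has the same leading term as f o psi - f, because
   psi* - 1 raises the order. Since X is infinitesimally symplectic and f depends on the actions
   only, X f is a combination of angular derivatives with coefficients constant on each torus,
   so it averages to zero over tori. Hence the torus average of P(c x) vanishes. But P is even in
   each variable, and averaging multiplies each even monomial by a positive constant, so P = 0.

   The powers psi^j are polynomials in j up to high order, which yields the properties of X from
   those of the genuine maps psi^j by differentiating an interpolation polynomial at j = 0. *)
theory Submission
  imports Defs "HOL-Computational_Algebra.Polynomial"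
begin

section \<open>Calculus of smooth maps\<close>

text \<open>Only tangency to the identity is prescribed for the normalizing maps, so psi - id may be
  of order 2 even when V - W vanishes to high order. Hence f(psi z) - f(z) cannot be expanded to
  first order in psi - id: the second-order terms already have order 4, and psi - id is not
  infinitesimally symplectic. In log psi, the sum of (-1)^(k-1) (psi* - 1)^k / k, the term k = 1
  gives f(psi z) - f(z), of order d, and all others have higher order.

  The one-form z -> \<open>symplectic_form (X z)\<close> is closed when X is infinitesimally
  symplectic, so its loop integrals vanish; this disposes of the angular derivatives without a
  generating function. All statements are bounds on orders of vanishing of smooth germs. Truncating
  the logarithm at d leaves a closedness defect of order d + 1, hence loop integrals of order d + 3,
  beyond the order d that matters.

  The linear term of the form controls the start: F_1(e_i) = c_i^(-2), so both Hamiltonians have the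
  same rescaling up to signs, which evenness absorbs, and u_i = F_1(e_i)^2, so V - W begins at order
  4.\<close>

lemma Ck_on_continuous: "Ck_on k f S \<Longrightarrow> continuous_on S f"
  by (cases k) (auto simp: differentiable_imp_continuous_on)

lemma Ck_on_subset: "Ck_on k f S \<Longrightarrow> T \<subseteq> S \<Longrightarrow> Ck_on k f T"
proof (induction k arbitrary: f)
  case 0
  then show ?case by (auto intro: continuous_on_subset)
next
  case (Suc k)
  then show ?case by (auto intro: differentiable_on_subset)
qed

lemma Ck_on_cong:
  assumes "open S" "\<And>x. x \<in> S \<Longrightarrow> f x = g x" "Ck_on k f S"
  shows "Ck_on k g S"
  using assms(2,3)
proof (induction k arbitrary: f g)
  case 0
  then show ?case unfolding Ck_on.simps using continuous_on_eq by blast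
next
  case (Suc k)
  have D: "(g has_derivative frechet_derivative f (at x)) (at x)" if "x \<in> S" for x
  proof -
    have "f differentiable_on S" using Suc.prems(2) by simp
    then have "f differentiable (at x)"
      using that assms(1) by (metis differentiable_on_def at_within_open)
    then have "(f has_derivative frechet_derivative f (at x)) (at x)"
      by (simp only: frechet_derivative_works)
    then show ?thesis
      by (rule has_derivative_transform_within_open[OF _ assms(1) that Suc.prems(1)])
  qed
  have eq: "frechet_derivative g (at x) = frechet_derivative f (at x)" if "x \<in> S" for x
    using frechet_derivative_at[OF D[OF that]] by simp
  show ?case
    unfolding Ck_on.simps
  proof (intro conjI allI)
    show "g differentiable_on S"
      unfolding differentiable_on_def
      by (meson D differentiableI has_derivative_at_withinI)
    have "Ck_on k (\<lambda>x. frechet_derivative f (at x) v) S" for v using Suc.prems(2) by simp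
    then show "Ck_on k (\<lambda>x. frechet_derivative g (at x) v) S" for v
      by (rule Suc.IH[rotated]) (simp add: eq)
  qed
qed

text \<open>Trades the chosen \<open>frechet_derivative\<close> for any explicit family of
  derivatives, so that later inductions on \<open>k\<close> can apply the usual differentiation
  rules.\<close>

lemma Ck_on_Suc_iff:
  assumes "open S" "\<And>x. x \<in> S \<Longrightarrow> (f has_derivative f' x) (at x)"
  shows "Ck_on (Suc k) f S \<longleftrightarrow> (\<forall>v. Ck_on k (\<lambda>x. f' x v) S)"
proof -
  have eq: "frechet_derivative f (at x) = f' x" if "x \<in> S" for x
    using frechet_derivative_at[OF assms(2)[OF that]] by simp
  have "f differentiable_on S"
    unfolding differentiable_on_def
    by (meson assms(2) differentiableI has_derivative_at_withinI)
  moreover have "Ck_on k (\<lambda>x. frechet_derivative f (at x) v) S = Ck_on k (\<lambda>x. f' x v) S" for v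
  proof
    show "Ck_on k (\<lambda>x. f' x v) S" if "Ck_on k (\<lambda>x. frechet_derivative f (at x) v) S"
      using that by (rule Ck_on_cong[OF assms(1), rotated]) (simp add: eq)
    show "Ck_on k (\<lambda>x. frechet_derivative f (at x) v) S" if "Ck_on k (\<lambda>x. f' x v) S"
      using that by (rule Ck_on_cong[OF assms(1), rotated]) (simp add: eq)
  qed
  ultimately show ?thesis by simp
qed

lemma Ck_on_Suc_derivative:
  assumes "open S" "Ck_on (Suc k) f S" "x \<in> S"
  shows "(f has_derivative frechet_derivative f (at x)) (at x)"
proof -
  have "f differentiable_on S" using assms(2) by simp
  then have "f differentiable (at x)"
    using assms by (metis differentiable_on_def at_within_open)
  then show ?thesis by (simp only: frechet_derivative_works)
qed

lemma Ck_on_fderiv: "Ck_on (Suc k) f S \<Longrightarrow> Ck_on k (\<lambda>x. frechet_derivative f (at x) v) S"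
  by simp

declare Ck_on.simps(2) [simp del]

lemma Ck_on_SucD: "open S \<Longrightarrow> Ck_on (Suc k) f S \<Longrightarrow> Ck_on k f S"
proof (induction k arbitrary: f)
  case 0
  then show ?case by (simp add: Ck_on_continuous)
next
  case (Suc k)
  show ?case
    unfolding Ck_on.simps(2)
  proof (intro conjI allI)
    show "f differentiable_on S" using Suc.prems(2) by (simp add: Ck_on.simps(2))
    show "Ck_on k (\<lambda>x. frechet_derivative f (at x) v) S" for v
      using Suc.IH[OF Suc.prems(1)] Ck_on_fderiv[OF Suc.prems(2)] by blast
  qed
qed

lemma Ck_on_const: "open S \<Longrightarrow> Ck_on k (\<lambda>x. c) S"
proof (induction k arbitrary: c)
  case (Suc k)
  then show ?case using Ck_on_Suc_iff[OF Suc.prems, of "\<lambda>x. c" "\<lambda>x h. 0"] by auto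
qed simp

lemma Ck_on_bounded_linear:
  assumes "open S" "bounded_linear f"
  shows "Ck_on k f S"
proof (cases k)
  case 0
  then show ?thesis using assms by (simp add: linear_continuous_on)
next
  case (Suc m)
  then show ?thesis
    using Ck_on_Suc_iff[OF assms(1), of f "\<lambda>x. f" m] assms
    by (auto simp: bounded_linear_imp_has_derivative Ck_on_const)
qed

lemma Ck_on_SucI:
  assumes "open S" "\<And>x. x \<in> S \<Longrightarrow> (f has_derivative f' x) (at x)"
    and "\<And>v. Ck_on k (\<lambda>x. f' x v) S"
  shows "Ck_on (Suc k) f S"
  using Ck_on_Suc_iff[OF assms(1,2)] assms(3) by blast

lemma Ck_on_add:
  assumes "open S"
  shows "Ck_on k f S \<Longrightarrow> Ck_on k g S \<Longrightarrow> Ck_on k (\<lambda>x. f x + g x) S"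
proof (induction k arbitrary: f g)
  case 0
  then show ?case unfolding Ck_on.simps by (rule continuous_on_add)
next
  case (Suc k)
  note f = Suc.prems(1) and g = Suc.prems(2)
  show ?case
  proof (rule Ck_on_SucI[OF assms])
    show "((\<lambda>x. f x + g x) has_derivative
        (\<lambda>h. frechet_derivative f (at x) h + frechet_derivative g (at x) h)) (at x)" if "x \<in> S" for x
      using Ck_on_Suc_derivative[OF assms f that] Ck_on_Suc_derivative[OF assms g that]
      by (rule has_derivative_add)
    show "Ck_on k (\<lambda>x. frechet_derivative f (at x) v + frechet_derivative g (at x) v) S" for v
      by (rule Suc.IH[OF Ck_on_fderiv[OF f] Ck_on_fderiv[OF g]])
  qed
qed

lemma Ck_on_sum:
  assumes "open S" "\<And>i. i \<in> I \<Longrightarrow> Ck_on k (f i) S"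
  shows "Ck_on k (\<lambda>x. \<Sum>i\<in>I. f i x) S"
  using assms(2)
proof (induction I rule: infinite_finite_induct)
  case (insert i I)
  have "Ck_on k (\<lambda>x. f i x + (\<Sum>i\<in>I. f i x)) S"
    by (intro Ck_on_add[OF assms(1)] insert.IH insert.prems) auto
  then show ?case unfolding sum.insert[OF insert.hyps] .
next
  case (infinite I)
  show ?case unfolding sum.infinite[OF infinite.hyps] by (rule Ck_on_const[OF assms(1)])
next
  case empty
  show ?case unfolding sum.empty by (rule Ck_on_const[OF assms(1)])
qed

lemma Ck_on_bilinear:
  assumes "open S" "bounded_bilinear pr"
  shows "Ck_on k f S \<Longrightarrow> Ck_on k g S \<Longrightarrow> Ck_on k (\<lambda>x. pr (f x) (g x)) S"
proof (induction k arbitrary: f g)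
  case 0
  then show ?case unfolding Ck_on.simps by (rule bounded_bilinear.continuous_on[OF assms(2)])
next
  case (Suc k)
  note f = Suc.prems(1) and g = Suc.prems(2)
  show ?case
  proof (rule Ck_on_SucI[OF assms(1)])
    show "((\<lambda>x. pr (f x) (g x)) has_derivative
        (\<lambda>h. pr (f x) (frechet_derivative g (at x) h) + pr (frechet_derivative f (at x) h) (g x))) (at x)"
      if "x \<in> S" for x
      using Ck_on_Suc_derivative[OF assms(1) f that] Ck_on_Suc_derivative[OF assms(1) g that]
      by (rule bounded_bilinear.FDERIV[OF assms(2)])
    show "Ck_on k (\<lambda>x. pr (f x) (frechet_derivative g (at x) v) + pr (frechet_derivative f (at x) v) (g x)) S" for v
      using Suc.IH[OF Ck_on_SucD[OF assms(1) f] Ck_on_fderiv[OF g]]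
        Suc.IH[OF Ck_on_fderiv[OF f] Ck_on_SucD[OF assms(1) g]]
      by (rule Ck_on_add[OF assms(1)])
  qed
qed

lemma linear_sum_Basis:
  assumes "linear f"
  shows "f h = (\<Sum>b\<in>Basis. (h \<bullet> b) *\<^sub>R f b)"
  by (metis (no_types, lifting) assms euclidean_representation linear_scale linear_sum sum.cong)

text \<open>In the chain rule the direction fed to the derivative of \<open>f\<close> varies with
  the point, while \<open>Ck_on\<close> controls derivatives in fixed directions only. Expanding
  that direction in \<open>Basis\<close> separates the two dependences and leaves products covered
  by \<open>Ck_on_bilinear\<close>.\<close>

lemma Ck_on_compose:
  fixes f :: "'b::euclidean_space \<Rightarrow> 'c::euclidean_space" and g :: "'a::euclidean_space \<Rightarrow> 'b"
  assumes S: "open S" and T: "open T"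
  shows "Ck_on k f T \<Longrightarrow> Ck_on k g S \<Longrightarrow> g ` S \<subseteq> T \<Longrightarrow> Ck_on k (\<lambda>x. f (g x)) S"
proof (induction k arbitrary: f g)
  case 0
  then show ?case unfolding Ck_on.simps by (rule continuous_on_compose2)
next
  case (Suc k)
  let ?D = "\<lambda>f x. frechet_derivative f (at x)"
  note f = Suc.prems(1) and g = Suc.prems(2)
  show ?case
  proof (rule Ck_on_SucI[OF S])
    show "((\<lambda>x. f (g x)) has_derivative
        (\<lambda>h. \<Sum>b\<in>Basis. (?D g x h \<bullet> b) *\<^sub>R ?D f (g x) b)) (at x)"
      if "x \<in> S" for x
    proof -
      have f': "(f has_derivative ?D f (g x)) (at (g x))"
        using Ck_on_Suc_derivative[OF T f] that Suc.prems(3) by blast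
      have g': "(g has_derivative ?D g x) (at x)"
        by (rule Ck_on_Suc_derivative[OF S g that])
      have "((\<lambda>x. f (g x)) has_derivative (\<lambda>h. ?D f (g x) (?D g x h))) (at x)"
        using has_derivative_compose[OF g' f'] .
      moreover have "(\<lambda>h. ?D f (g x) (?D g x h)) = (\<lambda>h. \<Sum>b\<in>Basis. (?D g x h \<bullet> b) *\<^sub>R ?D f (g x) b)"
        by (rule ext, rule linear_sum_Basis[OF has_derivative_linear[OF f']])
      ultimately show ?thesis by (rule back_subst)
    qed
    show "Ck_on k (\<lambda>x. \<Sum>b\<in>Basis. (?D g x v \<bullet> b) *\<^sub>R ?D f (g x) b) S" for v
    proof (rule Ck_on_sum[OF S])
      fix b :: 'b
      have 1: "Ck_on k (\<lambda>x. ?D f (g x) b) S"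
        by (rule Suc.IH[OF Ck_on_fderiv[OF f] Ck_on_SucD[OF S g] Suc.prems(3)])
      have 2: "Ck_on k (\<lambda>x. ?D g x v \<bullet> b) S"
        by (rule Ck_on_bilinear[OF S bounded_bilinear_inner Ck_on_fderiv[OF g] Ck_on_const[OF S]])
      show "Ck_on k (\<lambda>x. (?D g x v \<bullet> b) *\<^sub>R ?D f (g x) b) S"
        by (rule Ck_on_bilinear[OF S bounded_bilinear_scaleR 2 1])
    qed
  qed
qed

section \<open>Germs of smooth maps at the origin\<close>

definition smooth_germ :: "('a::euclidean_space \<Rightarrow> 'b::euclidean_space) \<Rightarrow> bool" where
  "smooth_germ f \<longleftrightarrow> (\<exists>U. open U \<and> 0 \<in> U \<and> smooth_on f U)"

abbreviation fderiv :: "('a::euclidean_space \<Rightarrow> 'b::euclidean_space) \<Rightarrow> 'a \<Rightarrow> 'a \<Rightarrow> 'b" where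
  "fderiv f x \<equiv> frechet_derivative f (at x)"

lemma smooth_on_subset: "smooth_on f S \<Longrightarrow> T \<subseteq> S \<Longrightarrow> smooth_on f T"
  unfolding smooth_on_def using Ck_on_subset by blast

lemma smooth_on_derivative:
  assumes "open S" "smooth_on f S" "x \<in> S"
  shows "(f has_derivative fderiv f x) (at x)"
  using assms Ck_on_Suc_derivative unfolding smooth_on_def by blast

lemma smooth_on_fderiv: "smooth_on f S \<Longrightarrow> smooth_on (\<lambda>x. fderiv f x v) S"
  unfolding smooth_on_def by (metis Ck_on.simps(2))

lemma smooth_on_continuous: "smooth_on f S \<Longrightarrow> continuous_on S f"
  unfolding smooth_on_def using Ck_on_continuous by blast

lemma smooth_germE:
  assumes "smooth_germ f"
  obtains e where "e > 0" "smooth_on f (ball 0 e)"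
  using assms unfolding smooth_germ_def by (meson open_contains_ball smooth_on_subset)

lemma smooth_germI: "e > 0 \<Longrightarrow> smooth_on f (ball 0 e) \<Longrightarrow> smooth_germ f"
  unfolding smooth_germ_def by (metis centre_in_ball open_ball)

lemma smooth_germE2:
  assumes "smooth_germ f" "smooth_germ g"
  obtains e where "e > 0" "smooth_on f (ball 0 e)" "smooth_on g (ball 0 e)"
proof -
  obtain d where d: "d > 0" "smooth_on f (ball 0 d)" using smooth_germE assms by blast
  obtain e where e: "e > 0" "smooth_on g (ball 0 e)" using smooth_germE assms by blast
  show thesis by (rule that[of "min d e"]) (use d e in \<open>auto intro: smooth_on_subset\<close>)
qed

lemma smooth_germ_const [intro]: "smooth_germ (\<lambda>x. c)"
  by (rule smooth_germI[of 1]) (auto simp: smooth_on_def Ck_on_const)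

lemma smooth_germ_bounded_linear: "bounded_linear f \<Longrightarrow> smooth_germ f"
  by (rule smooth_germI[of 1]) (auto simp: smooth_on_def Ck_on_bounded_linear)

lemma smooth_germ_id [intro]: "smooth_germ (\<lambda>x. x)"
  by (intro smooth_germ_bounded_linear bounded_linear_ident)

lemma smooth_germ_bilinear:
  assumes "bounded_bilinear pr" "smooth_germ f" "smooth_germ g"
  shows "smooth_germ (\<lambda>x. pr (f x) (g x))"
proof -
  obtain e where "e > 0" "smooth_on f (ball 0 e)" "smooth_on g (ball 0 e)"
    using smooth_germE2 assms by blast
  then show ?thesis
    by (intro smooth_germI[of e]) (auto simp: smooth_on_def intro: Ck_on_bilinear[OF _ assms(1)])
qed

lemmas smooth_germ_scaleR [intro] = smooth_germ_bilinear[OF bounded_bilinear_scaleR]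
lemmas smooth_germ_mult [intro] = smooth_germ_bilinear[OF bounded_bilinear_mult[where 'a=real]]
lemmas smooth_germ_inner [intro] = smooth_germ_bilinear[OF bounded_bilinear_inner]

lemma smooth_germ_add [intro]:
  assumes "smooth_germ f" "smooth_germ g"
  shows "smooth_germ (\<lambda>x. f x + g x)"
proof -
  obtain e where "e > 0" "smooth_on f (ball 0 e)" "smooth_on g (ball 0 e)"
    using smooth_germE2 assms by blast
  then show ?thesis
    by (intro smooth_germI[of e]) (auto simp: smooth_on_def intro: Ck_on_add)
qed

lemma smooth_germ_diff [intro]:
  assumes "smooth_germ f" "smooth_germ g"
  shows "smooth_germ (\<lambda>x. f x - g x)"
  using smooth_germ_add[OF assms(1) smooth_germ_scaleR[OF smooth_germ_const[of "- 1"] assms(2)]]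
  by simp

lemma smooth_germ_sum [intro]: "(\<And>i. i \<in> I \<Longrightarrow> smooth_germ (f i)) \<Longrightarrow> smooth_germ (\<lambda>x. \<Sum>i\<in>I. f i x)"
  by (induction I rule: infinite_finite_induct) auto

lemma smooth_germ_prod [intro]:
  fixes f :: "'i \<Rightarrow> 'a::euclidean_space \<Rightarrow> real"
  shows "(\<And>i. i \<in> I \<Longrightarrow> smooth_germ (f i)) \<Longrightarrow> smooth_germ (\<lambda>x. \<Prod>i\<in>I. f i x)"
  by (induction I rule: infinite_finite_induct) auto

lemma smooth_germ_power [intro]:
  fixes f :: "'a::euclidean_space \<Rightarrow> real"
  shows "smooth_germ f \<Longrightarrow> smooth_germ (\<lambda>x. f x ^ k)"
  by (induction k) auto

lemma smooth_germ_compose: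
  assumes "smooth_germ f" "smooth_germ g" "g 0 = 0"
  shows "smooth_germ (\<lambda>x. f (g x))"
proof -
  obtain d where d: "d > 0" "smooth_on f (ball 0 d)" using smooth_germE assms by blast
  obtain e where e: "e > 0" "smooth_on g (ball 0 e)" using smooth_germE assms by blast
  have o: "open (ball 0 e \<inter> g -` ball 0 d)"
    using smooth_on_continuous[OF e(2)] by (metis continuous_open_preimage open_ball)
  have "smooth_on (\<lambda>x. f (g x)) (ball 0 e \<inter> g -` ball 0 d)"
    unfolding smooth_on_def
  proof
    fix k
    have "Ck_on k f (ball 0 d)" "Ck_on k g (ball 0 e \<inter> g -` ball 0 d)"
      using d e by (simp_all add: smooth_on_def Ck_on_subset[OF _ Int_lower1])
    then show "Ck_on k (\<lambda>x. f (g x)) (ball 0 e \<inter> g -` ball 0 d)"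
      by (rule Ck_on_compose[OF o open_ball]) auto
  qed
  then show ?thesis using o d e assms(3) unfolding smooth_germ_def
    by (intro exI[of _ "ball 0 e \<inter> g -` ball 0 d"]) auto
qed

lemma smooth_germ_fderiv: "smooth_germ f \<Longrightarrow> smooth_germ (\<lambda>x. fderiv f x v)"
  unfolding smooth_germ_def by (elim exE conjE, rule exI, intro conjI smooth_on_fderiv)

lemma smooth_germ_derivative:
  assumes "smooth_germ f"
  shows "\<forall>\<^sub>F x in nhds 0. (f has_derivative fderiv f x) (at x)"
proof -
  obtain U where "open U" "0 \<in> U" "smooth_on f U" using assms unfolding smooth_germ_def by blast
  then show ?thesis
    unfolding eventually_nhds by (intro exI[of _ U]) (simp add: smooth_on_derivative)
qed

lemma smooth_germ_derivative_0: "smooth_germ f \<Longrightarrow> (f has_derivative fderiv f 0) (at 0)"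
  by (rule eventually_nhds_x_imp_x[OF smooth_germ_derivative])

lemma smooth_germ_continuous:
  assumes "smooth_germ f"
  shows "continuous (at 0) f"
  by (rule has_derivative_continuous[OF smooth_germ_derivative_0[OF assms]])

lemma smooth_germ_tendsto_0:
  assumes "smooth_germ f" "f 0 = 0"
  shows "filterlim f (nhds 0) (nhds 0)"
  using smooth_germ_continuous[OF assms(1)] assms(2)
  by (metis continuous_at tendsto_at_iff_tendsto_nhds)

section \<open>Order of vanishing at the origin\<close>

text \<open>The filter is \<open>nhds 0\<close>, not the punctured \<open>at 0\<close>: for
  \<open>a > 0\<close> the bound forces the value 0 at the origin, and for \<open>a = 0\<close> it
  means local boundedness. Composition then works without excluding points that are mapped to
  0.\<close>

definition vanishes :: "nat \<Rightarrow> ('a::real_normed_vector \<Rightarrow> 'b::real_normed_vector) \<Rightarrow> bool" where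
  "vanishes a f \<longleftrightarrow> (\<exists>C. \<forall>\<^sub>F x in nhds 0. norm (f x) \<le> C * norm x ^ a)"

lemma vanishesI: "e > 0 \<Longrightarrow> (\<And>x. norm x < e \<Longrightarrow> norm (f x) \<le> C * norm x ^ a) \<Longrightarrow> vanishes a f"
  unfolding vanishes_def eventually_nhds_metric by (intro exI[of _ C] exI[of _ e]) auto

lemma vanishesE:
  assumes "vanishes a f"
  obtains C e where "C \<ge> 0" "e > 0" "e \<le> 1" "\<And>x. norm x < e \<Longrightarrow> norm (f x) \<le> C * norm x ^ a"
proof -
  obtain C e where Ce: "e > 0" "\<And>x. norm x < e \<Longrightarrow> norm (f x) \<le> C * norm x ^ a"
    using assms unfolding vanishes_def eventually_nhds_metric by auto
  have "norm (f x) \<le> \<bar>C\<bar> * norm x ^ a" if "norm x < min e 1" for x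
    using Ce(2)[of x] that mult_right_mono[OF abs_ge_self[of C], of "norm x ^ a"] by force
  then show thesis using that[of "\<bar>C\<bar>" "min e 1"] Ce(1) by auto
qed

lemma vanishes_cong:
  assumes "\<forall>\<^sub>F x in nhds 0. f x = g x" "vanishes a f"
  shows "vanishes a g"
proof -
  obtain C where "\<forall>\<^sub>F x in nhds 0. norm (f x) \<le> C * norm x ^ a" using assms(2) vanishes_def by blast
  with assms(1) have "\<forall>\<^sub>F x in nhds 0. norm (g x) \<le> C * norm x ^ a" by eventually_elim simp
  then show ?thesis using vanishes_def by blast
qed

lemma vanishes_mono:
  assumes "vanishes b f" "a \<le> b"
  shows "vanishes a f"
proof -
  obtain C e where Ce: "C \<ge> 0" "e > 0" "e \<le> 1" "\<And>x. norm x < e \<Longrightarrow> norm (f x) \<le> C * norm x ^ b"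
    using vanishesE[OF assms(1)] by blast
  show ?thesis
  proof (rule vanishesI[OF Ce(2)])
    fix x :: 'a assume x: "norm x < e"
    then have "norm x ^ b \<le> norm x ^ a" using Ce(3) assms(2) by (intro power_decreasing) auto
    then show "norm (f x) \<le> C * norm x ^ a" using Ce(4)[OF x] mult_left_mono[OF _ Ce(1)] by fastforce
  qed
qed

lemma vanishes_zero [simp]: "vanishes a (\<lambda>x. 0)"
  by (rule vanishesI[of 1 _ 0]) auto

lemma vanishes_add:
  assumes "vanishes a f" "vanishes a g"
  shows "vanishes a (\<lambda>x. f x + g x)"
proof -
  obtain C e where 1: "C \<ge> 0" "e > 0" "e \<le> 1" "\<And>x. norm x < e \<Longrightarrow> norm (f x) \<le> C * norm x ^ a"
    using vanishesE[OF assms(1)] by blast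
  obtain D d where 2: "D \<ge> 0" "d > 0" "d \<le> 1" "\<And>x. norm x < d \<Longrightarrow> norm (g x) \<le> D * norm x ^ a"
    using vanishesE[OF assms(2)] by blast
  show ?thesis
  proof (rule vanishesI[of "min e d" _ "C + D"])
    fix x :: 'a assume "norm x < min e d"
    then have "norm (f x) \<le> C * norm x ^ a" "norm (g x) \<le> D * norm x ^ a" using 1 2 by auto
    then show "norm (f x + g x) \<le> (C + D) * norm x ^ a"
      by (intro norm_triangle_le) (simp add: distrib_right)
  qed (use 1 2 in auto)
qed

lemma vanishes_minus: "vanishes a f \<Longrightarrow> vanishes a (\<lambda>x. - f x)"
  unfolding vanishes_def by simp

lemma vanishes_diff: "vanishes a f \<Longrightarrow> vanishes a g \<Longrightarrow> vanishes a (\<lambda>x. f x - g x)"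
  using vanishes_add[of a f "\<lambda>x. - g x"] vanishes_minus[of a g] by simp

lemma vanishes_sum: "(\<And>i. i \<in> I \<Longrightarrow> vanishes a (f i)) \<Longrightarrow> vanishes a (\<lambda>x. \<Sum>i\<in>I. f i x)"
proof (induction I rule: infinite_finite_induct)
  case (insert i I)
  have "vanishes a (\<lambda>x. f i x + (\<Sum>i\<in>I. f i x))"
    by (intro vanishes_add insert.IH insert.prems) auto
  then show ?case unfolding sum.insert[OF insert.hyps] .
qed simp_all

lemma vanishes_norm: "vanishes a f \<Longrightarrow> vanishes a (\<lambda>x. norm (f x))"
  unfolding vanishes_def by simp

lemma vanishes_bilinear:
  fixes f :: "'x::real_normed_vector \<Rightarrow> 'a::real_normed_vector"
    and g :: "'x \<Rightarrow> 'b::real_normed_vector" and pr :: "'a \<Rightarrow> 'b \<Rightarrow> 'c::real_normed_vector"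
  assumes "bounded_bilinear pr" "vanishes a f" "vanishes b g"
  shows "vanishes (a + b) (\<lambda>x. pr (f x) (g x))"
proof -
  obtain C e where 1: "C \<ge> 0" "e > 0" "e \<le> 1" "\<And>x. norm x < e \<Longrightarrow> norm (f x) \<le> C * norm x ^ a"
    using vanishesE[OF assms(2)] by blast
  obtain D d where 2: "D \<ge> 0" "d > 0" "d \<le> 1" "\<And>x. norm x < d \<Longrightarrow> norm (g x) \<le> D * norm x ^ b"
    using vanishesE[OF assms(3)] by blast
  obtain K where K: "K \<ge> 0" "\<And>a b. norm (pr a b) \<le> norm a * norm b * K"
    using bounded_bilinear.nonneg_bounded[OF assms(1)] by blast
  show ?thesis
  proof (rule vanishesI[of "min e d" _ "C * D * K"])
    fix x :: 'x assume "norm x < min e d"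
    then have "norm (f x) \<le> C * norm x ^ a" "norm (g x) \<le> D * norm x ^ b" using 1 2 by auto
    then have "norm (f x) * norm (g x) * K \<le> (C * norm x ^ a) * (D * norm x ^ b) * K"
      using 1(1) 2(1) K(1) by (intro mult_right_mono mult_mono) auto
    then show "norm (pr (f x) (g x)) \<le> C * D * K * norm x ^ (a + b)"
      using K(2)[of "f x" "g x"] by (simp add: power_add mult_ac)
  qed (use 1 2 in auto)
qed

lemma vanishes_const: "vanishes 0 (\<lambda>x. c)"
  by (rule vanishesI[of 1 _ "norm c"]) auto

lemma vanishes_ident: "vanishes 1 (\<lambda>x. x)"
  by (rule vanishesI[of 1 _ 1]) auto

lemma vanishes_scaleR:
  assumes "vanishes a f"
  shows "vanishes a (\<lambda>x. c *\<^sub>R f x)"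
  using vanishes_bilinear[OF bounded_bilinear_scaleR vanishes_const[of c] assms] by simp

lemma vanishes_cmult:
  fixes f :: "'a::real_normed_vector \<Rightarrow> real"
  assumes "vanishes a f"
  shows "vanishes a (\<lambda>x. c * f x)"
  using vanishes_scaleR[OF assms, of c] by simp

lemma vanishes_compose:
  fixes g :: "'x::real_normed_vector \<Rightarrow> 'a::real_normed_vector" and f :: "'a \<Rightarrow> 'b::real_normed_vector"
  assumes "vanishes a f" "vanishes 1 g"
  shows "vanishes a (\<lambda>x. f (g x))"
proof -
  obtain C e where 1: "C \<ge> 0" "e > 0" "e \<le> 1" "\<And>x. norm x < e \<Longrightarrow> norm (f x) \<le> C * norm x ^ a"
    using vanishesE[OF assms(1)] by blast
  obtain D d where 2: "D \<ge> 0" "d > 0" "d \<le> 1" "\<And>x. norm x < d \<Longrightarrow> norm (g x) \<le> D * norm x ^ 1"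
    using vanishesE[OF assms(2)] by blast
  show ?thesis
  \<comment> \<open>The radius is chosen so that \<open>g\<close> stays in the ball of radius
    \<open>e\<close>; adding 1 to \<open>D\<close> avoids division by zero.\<close>
  proof (rule vanishesI[of "min d (e / (D + 1))" _ "C * D ^ a"])
    fix x :: 'x assume x: "norm x < min d (e / (D + 1))"
    then have g: "norm (g x) \<le> D * norm x" using 2 by auto
    have "norm x * (D + 1) < e" using x 2(1) by (simp add: pos_less_divide_eq)
    moreover have "norm x * (D + 1) = D * norm x + norm x" by (simp add: distrib_left mult.commute)
    ultimately have "norm (g x) < e" using g norm_ge_zero[of x] by linarith
    then have "norm (f (g x)) \<le> C * norm (g x) ^ a" by (rule 1)
    also have "\<dots> \<le> C * (D * norm x) ^ a" using g 1(1) by (intro mult_left_mono power_mono) auto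
    finally show "norm (f (g x)) \<le> C * D ^ a * norm x ^ a" by (simp add: power_mult_distrib)
  qed (use 1 2 in auto)
qed

text \<open>Continuity carries the bound to the origin itself. This serves finite differences with
  step \<open>norm x\<close>, which degenerate at \<open>x = 0\<close>.\<close>

lemma vanishes_punctured:
  fixes f :: "'a::euclidean_space \<Rightarrow> 'b::real_normed_vector"
  assumes "continuous (at 0) f" "e > 0"
    and le: "\<And>x. x \<noteq> 0 \<Longrightarrow> norm x < e \<Longrightarrow> norm (f x) \<le> C * norm x ^ a"
  shows "vanishes a f"
proof (rule vanishesI[OF assms(2)])
  have "((\<lambda>x. norm (f x)) \<longlongrightarrow> norm (f 0)) (at 0)"
    using assms(1) by (intro tendsto_norm) (simp add: continuous_at)
  moreover have "((\<lambda>x::'a. C * norm x ^ a) \<longlongrightarrow> C * norm (0::'a) ^ a) (at 0)"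
    by (intro tendsto_intros)
  moreover have "\<forall>\<^sub>F x in at 0. norm (f x) \<le> C * norm x ^ a"
    unfolding eventually_at using assms(2) le by (intro exI[of _ e]) auto
  ultimately have "norm (f 0) \<le> C * norm (0::'a) ^ a"
    by (intro tendsto_le[of "at (0::'a)"]) auto
  with le show "norm (f x) \<le> C * norm x ^ a" if "norm x < e" for x
    using that by (cases "x = 0") auto
qed

text \<open>Evaluate at \<open>t *\<^sub>R x\<close> and divide by \<open>t ^ d\<close>: what
  remains is a bound proportional to \<open>t\<close>, which tends to 0. This is how order estimates
  become exact identities between leading terms.\<close>

lemma vanishes_homogeneous_imp_zero:
  fixes p :: "'a::real_normed_vector \<Rightarrow> 'b::real_normed_vector"
  assumes "vanishes (Suc d) p" "\<And>t x. t > 0 \<Longrightarrow> p (t *\<^sub>R x) = t ^ d *\<^sub>R p x"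
  shows "p x = 0"
proof -
  obtain C e where C: "C \<ge> 0" "e > 0" "e \<le> 1" "\<And>x. norm x < e \<Longrightarrow> norm (p x) \<le> C * norm x ^ Suc d"
    using vanishesE[OF assms(1)] by blast
  have "norm (p x) \<le> t * (C * norm x ^ Suc d)" if t: "0 < t" "t < e / (norm x + 1)" for t
  proof -
    have "t * (norm x + 1) < e"
      using t(2) by (simp add: pos_less_divide_eq add_nonneg_pos)
    then have "norm (t *\<^sub>R x) < e" using t(1) by (simp add: distrib_left)
    from C(4)[OF this] have "t ^ d * norm (p x) \<le> t ^ d * (t * (C * norm x ^ Suc d))"
      using t(1) by (simp add: assms(2) power_mult_distrib mult_ac)
    then show ?thesis using t(1) by simp
  qed
  moreover have "e / (norm x + 1) > 0" using C(2) by (simp add: add_nonneg_pos)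
  ultimately have "\<forall>\<^sub>F t in at_right 0. norm (p x) \<le> t * (C * norm x ^ Suc d)"
    unfolding eventually_at_right_field by blast
  moreover have "((\<lambda>t. t * (C * norm x ^ Suc d)) \<longlongrightarrow> 0 * (C * norm x ^ Suc d)) (at_right 0)"
    by (intro tendsto_intros)
  ultimately have "norm (p x) \<le> 0 * (C * norm x ^ Suc d)"
    by (intro tendsto_lowerbound[of _ _ "at_right (0::real)"]) auto
  then show ?thesis by simp
qed

lemma vanishes_0_smooth:
  assumes "smooth_germ f"
  shows "vanishes 0 f"
proof -
  have "((\<lambda>x. norm (f x)) \<longlongrightarrow> norm (f 0)) (nhds 0)"
    using smooth_germ_continuous[OF assms] by (intro tendsto_norm) (simp add: continuous_at tendsto_at_iff_tendsto_nhds)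
  then have "\<forall>\<^sub>F x in nhds 0. norm (f x) < norm (f 0) + 1"
    by (rule order_tendstoD) simp
  then have "\<forall>\<^sub>F x in nhds 0. norm (f x) \<le> (norm (f 0) + 1) * norm x ^ 0"
    by eventually_elim simp
  then show ?thesis unfolding vanishes_def by blast
qed

text \<open>Mean value inequality on the closed ball of radius \<open>max (norm x) (norm y)\<close>,
  which is convex and contains both points. Summing over \<open>Basis\<close> turns the bounds in
  fixed directions into a bound on the operator norm.\<close>

lemma lipschitz_of_vanishes_fderiv:
  fixes g :: "'a::euclidean_space \<Rightarrow> 'b::euclidean_space"
  assumes "smooth_germ g" "\<And>v. vanishes a (\<lambda>x. fderiv g x v)"
  obtains C e where "C \<ge> 0" "e > 0"
    "\<And>x y. norm x < e \<Longrightarrow> norm y < e \<Longrightarrow> norm (g x - g y) \<le> C * max (norm x) (norm y) ^ a * norm (x - y)"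
proof -
  have "vanishes a (\<lambda>x. \<Sum>b\<in>Basis. norm (fderiv g x b))"
    by (intro vanishes_sum vanishes_norm assms(2))
  then obtain C e where C0: "C \<ge> 0" "e > 0" "e \<le> 1"
    "\<And>x. norm x < e \<Longrightarrow> norm (\<Sum>b\<in>Basis. norm (fderiv g x b)) \<le> C * norm x ^ a"
    using vanishesE by blast
  have C: "C \<ge> 0" "e > 0" "\<And>x. norm x < e \<Longrightarrow> (\<Sum>b\<in>Basis. norm (fderiv g x b)) \<le> C * norm x ^ a"
    using C0 by (auto simp: sum_nonneg)
  obtain d where d: "d > 0" "smooth_on g (ball 0 d)" using smooth_germE[OF assms(1)] by blast
  show thesis
  proof (rule that[of C "min d e"])
    fix x y :: 'a assume xy: "norm x < min d e" "norm y < min d e"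
    define r where "r = max (norm x) (norm y)"
    have r: "r < d" "r < e" "r \<ge> 0" using xy by (auto simp: r_def le_max_iff_disj)
    have der: "(g has_derivative fderiv g z) (at z)" if "z \<in> cball 0 r" for z
      by (rule smooth_on_derivative[OF open_ball d(2)]) (use that r in auto)
    show "norm (g x - g y) \<le> C * max (norm x) (norm y) ^ a * norm (x - y)"
      unfolding r_def[symmetric]
    proof (rule differentiable_bound[of "cball 0 r"])
      fix z :: 'a assume z: "z \<in> cball 0 r"
      show "(g has_derivative fderiv g z) (at z within cball 0 r)"
        by (rule has_derivative_at_withinI[OF der[OF z]])
      show "onorm (fderiv g z) \<le> C * r ^ a"
      proof (rule onorm_le)
        fix h
        have "norm (fderiv g z h) = norm (\<Sum>b\<in>Basis. (h \<bullet> b) *\<^sub>R fderiv g z b)"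
          using linear_sum_Basis[OF has_derivative_linear[OF der[OF z]], of h] by (rule arg_cong)
        also have "\<dots> \<le> (\<Sum>b\<in>Basis. norm ((h \<bullet> b) *\<^sub>R fderiv g z b))" by (rule norm_sum)
        also have "\<dots> \<le> (\<Sum>b\<in>Basis. norm h * norm (fderiv g z b))"
          by (intro sum_mono) (simp add: Basis_le_norm mult_right_mono)
        also have "\<dots> = norm h * (\<Sum>b\<in>Basis. norm (fderiv g z b))" by (simp add: sum_distrib_left)
        also have "\<dots> \<le> norm h * (C * norm z ^ a)"
          using C(3)[of z] z r by (intro mult_left_mono) auto
        also have "\<dots> \<le> norm h * (C * r ^ a)"
          using z C(1) by (intro mult_left_mono power_mono) auto
        finally show "norm (fderiv g z h) \<le> C * r ^ a * norm h" by (simp add: mult_ac)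
      qed
    qed (auto simp: r_def)
  qed (use C d in auto)
qed

lemma vanishes_Suc_of_fderiv:
  fixes g :: "'a::euclidean_space \<Rightarrow> 'b::euclidean_space"
  assumes "smooth_germ g" "\<And>v. vanishes a (\<lambda>x. fderiv g x v)" "g 0 = 0"
  shows "vanishes (Suc a) g"
proof -
  obtain C e where C: "C \<ge> 0" "e > 0"
    "\<And>x y. norm x < e \<Longrightarrow> norm y < e \<Longrightarrow> norm (g x - g y) \<le> C * max (norm x) (norm y) ^ a * norm (x - y)"
    using lipschitz_of_vanishes_fderiv[OF assms(1,2)] by blast
  show ?thesis
    by (rule vanishesI[OF C(2), of _ C]) (use C(2) C(3)[of _ 0] assms(3) in \<open>auto simp: mult_ac\<close>)
qed

lemma vanishes_1_smooth: "smooth_germ g \<Longrightarrow> g 0 = 0 \<Longrightarrow> vanishes 1 g"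
  using vanishes_Suc_of_fderiv[of g 0] vanishes_0_smooth smooth_germ_fderiv by fastforce


section \<open>Numerical differentiation\<close>

text \<open>The explicit degree bound lets one fixed set of interpolation nodes serve a whole family
  of polynomials, in particular one indexed by the points near the origin.\<close>

definition poly_fun :: "nat \<Rightarrow> (real \<Rightarrow> real) \<Rightarrow> bool" where
  "poly_fun M f \<longleftrightarrow> (\<exists>p. degree p \<le> M \<and> f = poly p)"

lemma poly_fun_mono: "poly_fun M f \<Longrightarrow> M \<le> N \<Longrightarrow> poly_fun N f"
  unfolding poly_fun_def using le_trans by blast

lemma poly_fun_const: "poly_fun M (\<lambda>t. c)"
  unfolding poly_fun_def by (intro exI[of _ "[:c:]"]) auto

lemma poly_fun_ident: "poly_fun 1 (\<lambda>t. t)"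
  unfolding poly_fun_def by (intro exI[of _ "[:0, 1:]"]) auto

lemma poly_fun_add: "poly_fun M f \<Longrightarrow> poly_fun M g \<Longrightarrow> poly_fun M (\<lambda>t. f t + g t)"
  unfolding poly_fun_def
  by (elim exE conjE) (rule_tac x="p + pa" in exI, auto intro: degree_add_le)

lemma poly_fun_mult: "poly_fun M f \<Longrightarrow> poly_fun N g \<Longrightarrow> poly_fun (M + N) (\<lambda>t. f t * g t)"
  unfolding poly_fun_def
  by (elim exE conjE, rule_tac x="p * pa" in exI) (auto intro: order.trans[OF degree_mult_le])

lemma poly_fun_cmult: "poly_fun M f \<Longrightarrow> poly_fun M (\<lambda>t. c * f t)"
  using poly_fun_mult[OF poly_fun_const[of 0 c]] by simp

lemma poly_fun_diff: "poly_fun M f \<Longrightarrow> poly_fun M g \<Longrightarrow> poly_fun M (\<lambda>t. f t - g t)"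
  using poly_fun_add[of M f "\<lambda>t. (- 1) * g t"] poly_fun_cmult[of M g "- 1"] by simp

lemma poly_fun_sum: "(\<And>i. i \<in> I \<Longrightarrow> poly_fun M (f i)) \<Longrightarrow> poly_fun M (\<lambda>t. \<Sum>i\<in>I. f i t)"
  by (induction I rule: infinite_finite_induct) (simp_all add: poly_fun_const poly_fun_add)

lemma poly_fun_prod: "(\<And>i. i \<in> I \<Longrightarrow> poly_fun (M i) (f i)) \<Longrightarrow> poly_fun (\<Sum>i\<in>I. M i) (\<lambda>t. \<Prod>i\<in>I. f i t)"
  by (induction I rule: infinite_finite_induct) (simp_all add: poly_fun_const poly_fun_mult)

lemma poly_fun_power: "poly_fun M f \<Longrightarrow> poly_fun (k * M) (\<lambda>t. f t ^ k)"
  by (induction k) (simp_all add: poly_fun_const poly_fun_mult)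

lemma poly_fun_gchoose: "poly_fun k (\<lambda>t. t gchoose k)"
proof -
  have "poly_fun (\<Sum>i\<in>{0..<k}. 1) (\<lambda>t::real. \<Prod>i\<in>{0..<k}. t - of_nat i)"
    by (intro poly_fun_prod poly_fun_diff poly_fun_ident poly_fun_const)
  from poly_fun_cmult[OF this, of "1 / fact k"] show ?thesis
    by (simp add: gbinomial_prod_rev)
qed

lemma poly_fun_real_derivative:
  assumes "poly_fun M f"
  obtains D where "(f has_real_derivative D) (at x)"
  using assms poly_DERIV unfolding poly_fun_def by blast

lemma pderiv_sum: "pderiv (\<Sum>i\<in>I. p i) = (\<Sum>i\<in>I. pderiv (p i))"
  by (induction I rule: infinite_finite_induct) (simp_all add: pderiv_add)

text \<open>Lagrange interpolation at the nodes 0, ..., \<open>M\<close> is exact in degree at most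
  \<open>M\<close>, so the weights are the derivatives at 0 of the Lagrange basis polynomials
  \<open>L j\<close>. What matters is that they do not depend on \<open>f\<close>.\<close>

lemma numerical_differentiation:
  obtains c :: "nat \<Rightarrow> real" where
    "\<And>f D. poly_fun M f \<Longrightarrow> (f has_real_derivative D) (at 0) \<Longrightarrow> D = (\<Sum>j\<le>M. c j * f (real j))"
proof -
  define L where "L j = (\<Prod>i\<in>{..M} - {j}. smult (1 / (real j - real i)) [:- real i, 1:])" for j
  have deg: "degree (L j) \<le> M" if "j \<le> M" for j
  proof -
    have "degree (L j) \<le> (\<Sum>i\<in>{..M} - {j}. degree (smult (1 / (real j - real i)) [:- real i, 1:]))"
      unfolding L_def by (rule order.trans[OF degree_prod_sum_le]) auto
    also have "\<dots> \<le> (\<Sum>i\<in>{..M} - {j}. 1)"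
      by (intro sum_mono) (simp add: order.trans[OF degree_smult_le])
    finally show ?thesis using that by simp
  qed
  have val: "poly (L j) (real k) = (if k = j then 1 else 0)" if "j \<le> M" "k \<le> M" for j k
  proof (cases "k = j")
    case True
    then show ?thesis unfolding L_def poly_prod by (auto intro!: prod.neutral simp: divide_simps)
  next
    case False
    then have "k \<in> {..M} - {j}" using that by auto
    then have "(\<Prod>i\<in>{..M} - {j}. poly (smult (1 / (real j - real i)) [:- real i, 1:]) (real k)) = 0"
      by (intro prod_zero) auto
    then show ?thesis unfolding L_def poly_prod using False by simp
  qed
  have interp: "p = (\<Sum>j\<le>M. smult (poly p (real j)) (L j))" if p: "degree p \<le> M" for p
  proof (rule ccontr)
    define q where "q = p - (\<Sum>j\<le>M. smult (poly p (real j)) (L j))"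
    assume "p \<noteq> (\<Sum>j\<le>M. smult (poly p (real j)) (L j))"
    then have q: "q \<noteq> 0" by (simp add: q_def)
    have "degree q \<le> M"
      unfolding q_def using p deg
      by (intro degree_diff_le degree_sum_le) (auto intro: order.trans[OF degree_smult_le])
    moreover have "poly q (real k) = 0" if "k \<le> M" for k
    proof -
      have "(\<Sum>j\<le>M. poly p (real j) * poly (L j) (real k)) = (\<Sum>j\<le>M. if k = j then poly p (real j) else 0)"
        using that by (intro sum.cong) (auto simp: val)
      then show ?thesis using that by (simp add: q_def poly_sum)
    qed
    then have "real ` {..M} \<subseteq> {x. poly q x = 0}" by auto
    then have "card (real ` {..M}) \<le> card {x. poly q x = 0}"
      by (intro card_mono poly_roots_finite q)
    moreover have "card (real ` {..M}) = Suc M" by (simp add: card_image)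
    ultimately show False using card_poly_roots_bound[OF q] by linarith
  qed
  show thesis
  proof (rule that[of "\<lambda>j. poly (pderiv (L j)) 0"])
    fix f D assume "poly_fun M f" and D: "(f has_real_derivative D) (at 0)"
    then obtain p where p: "degree p \<le> M" "f = poly p" unfolding poly_fun_def by blast
    have "D = poly (pderiv p) 0" using DERIV_unique[OF D] poly_DERIV[of p 0] p(2) by simp
    also have "pderiv p = (\<Sum>j\<le>M. smult (poly p (real j)) (pderiv (L j)))"
      using arg_cong[OF interp[OF p(1)], of pderiv]
      by (simp add: pderiv_sum pderiv_smult)
    finally show "D = (\<Sum>j\<le>M. poly (pderiv (L j)) 0 * f (real j))"
      by (simp add: poly_sum p(2) mult.commute)
  qed
qed

text \<open>The derivative at 0 is a combination of the values at integers with weights independent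
  of \<open>z\<close>, so the order of vanishing is inherited. This is the bridge from the iterates
  of a map, which exist only at integer times, to its logarithm.\<close>

lemma vanishes_derivative_of_poly_fun:
  fixes f :: "'a::real_normed_vector \<Rightarrow> real \<Rightarrow> real"
  assumes "\<forall>\<^sub>F z in nhds 0. poly_fun M (f z) \<and> (f z has_real_derivative D z) (at 0)"
    and "\<And>j::nat. vanishes a (\<lambda>z. f z (real j))"
  shows "vanishes a D"
proof -
  obtain c :: "nat \<Rightarrow> real" where
    c: "\<And>f D. poly_fun M f \<Longrightarrow> (f has_real_derivative D) (at 0) \<Longrightarrow> D = (\<Sum>j\<le>M. c j * f (real j))"
    using numerical_differentiation by blast
  have "vanishes a (\<lambda>z. \<Sum>j\<le>M. c j * f z (real j))"
    by (intro vanishes_sum vanishes_cmult assms(2))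
  moreover have "\<forall>\<^sub>F z in nhds 0. (\<Sum>j\<le>M. c j * f z (real j)) = D z"
    using assms(1) by eventually_elim (use c in auto)
  ultimately show ?thesis by (rule vanishes_cong[rotated])
qed


section \<open>Derivatives lower the order of vanishing by one\<close>

text \<open>The step \<open>norm x\<close> in the finite difference balances the size of the function,
  $O(|x|^a)$, against the Taylor remainder, $O(|x|^{a+1})$.\<close>

lemma vanishes_fderiv_real:
  fixes g :: "'a::euclidean_space \<Rightarrow> real"
  assumes "smooth_germ g" "vanishes (Suc a) g"
  shows "vanishes a (\<lambda>x. fderiv g x v)"
proof -
  define K where "K = Suc a"
  define D where "D m = ((\<lambda>h x. fderiv h x v) ^^ m) g" for m
  have D0: "D 0 = g" and DS: "D (Suc m) = (\<lambda>x. fderiv (D m) x v)" for m by (simp_all add: D_def)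
  obtain d where d: "d > 0" "smooth_on g (ball 0 d)" using smooth_germE[OF assms(1)] by blast
  have smD: "smooth_on (D m) (ball 0 d)" for m
    by (induction m) (simp_all add: D0 DS d(2) smooth_on_fderiv)
  obtain C e where C: "C \<ge> 0" "e > 0" "e \<le> 1" "\<And>x. norm x < e \<Longrightarrow> norm (g x) \<le> C * norm x ^ Suc a"
    using vanishesE[OF assms(2)] by blast
  have "vanishes 0 (D (Suc K))" using smD d(1) by (intro vanishes_0_smooth smooth_germI)
  then obtain B b where B: "B \<ge> 0" "b > 0" "b \<le> 1" "\<And>x. norm x < b \<Longrightarrow> norm (D (Suc K) x) \<le> B * norm x ^ 0"
    using vanishesE by blast
  obtain c :: "nat \<Rightarrow> real" where
    c: "\<And>f D. poly_fun K f \<Longrightarrow> (f has_real_derivative D) (at 0) \<Longrightarrow> D = (\<Sum>j\<le>K. c j * f (real j))"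
    using numerical_differentiation by blast
  \<comment> \<open>The segment from \<open>x\<close> to \<open>x + (K * norm x) *\<^sub>R v\<close>
    contains all interpolation points and lies in the ball of radius
    \<open>R * norm x\<close>.\<close>
  define R where "R = 1 + real K * norm v"
  have R: "R \<ge> 1" by (simp add: R_def)
  define E where "E = (\<Sum>j\<le>K. \<bar>c j\<bar> * (C * R ^ Suc a + B * real K ^ Suc K))"
  show ?thesis
  proof (rule vanishes_punctured)
    show "continuous (at 0) (\<lambda>x. fderiv g x v)"
      by (intro smooth_germ_continuous smooth_germ_fderiv assms(1))
    show "min d (min e b) / R > 0" using d C B R by simp
    fix x :: 'a assume x0: "x \<noteq> 0" and x: "norm x < min d (min e b) / R"
    define r where "r = norm x"
    have r: "r > 0" "r * R < min d (min e b)"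
      using x0 x R by (auto simp: r_def pos_less_divide_eq)
    have "r * 1 \<le> r * R" using r(1) R by (intro mult_left_mono) auto
    with r(2) C(3) have r1: "r \<le> 1" by simp
    define q where "q t = x + (t * r) *\<^sub>R v" for t
    have q: "norm (q t) \<le> r * R" if "0 \<le> t" "t \<le> real K" for t
    proof -
      have "norm (q t) \<le> r + t * r * norm v"
        unfolding q_def r_def using that by (intro norm_triangle_le) simp
      also have "\<dots> \<le> r + real K * r * norm v" using that r by (intro add_left_mono mult_right_mono) auto
      finally show ?thesis by (simp add: R_def algebra_simps)
    qed
    \<comment> \<open>The m-th derivative of \<open>g\<close> along the segment; each
      differentiation brings out one factor \<open>r\<close> from the step length.\<close>
    define f where "f m t = r ^ m * D m (q t)" for m t
    have der: "(f m has_real_derivative f (Suc m) t) (at t)" if t: "0 \<le> t" "t \<le> real K" for m t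
    proof -
      have "q t \<in> ball 0 d" using q[OF t] r by simp
      from smooth_on_derivative[OF open_ball smD this]
      have D: "(D m has_derivative fderiv (D m) (q t)) (at (q t))" .
      have "(q has_derivative (\<lambda>s. (s * r) *\<^sub>R v)) (at t)"
        unfolding q_def by (auto intro!: derivative_eq_intros)
      from has_derivative_compose[OF this D]
      have "((\<lambda>t. D m (q t)) has_derivative (\<lambda>s. fderiv (D m) (q t) ((s * r) *\<^sub>R v))) (at t)" .
      moreover have "fderiv (D m) (q t) ((s * r) *\<^sub>R v) = (r * D (Suc m) (q t)) * s" for s
        using linear_scale[OF has_derivative_linear[OF D], of "s * r" v] by (simp add: DS mult_ac)
      ultimately have "((\<lambda>t. D m (q t)) has_real_derivative r * D (Suc m) (q t)) (at t)"
        unfolding has_field_derivative_def by simp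
      from DERIV_cmult[OF this, of "r ^ m"] show ?thesis by (simp add: f_def [abs_def] mult_ac)
    qed
    \<comment> \<open>The differentiation formula is exact for polynomials only, so it is applied to
      the Taylor polynomial \<open>T\<close> of \<open>g\<close> along the segment. \<open>T\<close>
      has the right derivative at 0, and its values at the nodes differ from those of
      \<open>g\<close> by the Taylor remainder.\<close>
    define T where "T t = (\<Sum>m\<le>K. f m 0 / fact m * t ^ m)" for t
    have near: "\<bar>T (real j)\<bar> \<le> r ^ Suc a * (C * R ^ Suc a + B * real K ^ Suc K)" if j: "j \<le> K" for j
    proof -
      have gj: "\<bar>g (q (real j))\<bar> \<le> C * (r * R) ^ Suc a"
      proof -
        have qj: "norm (q (real j)) \<le> r * R" using q j by simp
        then have "norm (q (real j)) < e" using r by simp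
        from C(4)[OF this] have "\<bar>g (q (real j))\<bar> \<le> C * norm (q (real j)) ^ Suc a" by simp
        also have "\<dots> \<le> C * (r * R) ^ Suc a" using qj C(1) by (intro mult_left_mono power_mono) auto
        finally show ?thesis .
      qed
      have diff: "\<bar>f 0 (real j) - T (real j)\<bar> \<le> B * real K ^ Suc K * r ^ Suc K"
      proof (cases "j = 0")
        case True
        have "T 0 = f 0 0" unfolding T_def by (simp add: power_0_left sum.atMost_shift)
        with True show ?thesis using B r by simp
      next
        case False
        have "\<exists>t. (if real j < 0 then real j < t \<and> t < 0 else 0 < t \<and> t < real j) \<and>
          f 0 (real j) = (\<Sum>m<Suc K. f m 0 / fact m * (real j - 0) ^ m) + f (Suc K) t / fact (Suc K) * (real j - 0) ^ Suc K"
          by (rule Taylor[where diff = f and a = 0 and b = "real K"]) (use False j der in auto)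
        then obtain t where t: "0 < t" "t < real j"
          "f 0 (real j) = T (real j) + f (Suc K) t / fact (Suc K) * real j ^ Suc K"
          unfolding T_def lessThan_Suc_atMost by auto
        have "\<bar>D (Suc K) (q t)\<bar> \<le> B"
          using B(4)[of "q t"] q[of t] t j r by simp
        then have "\<bar>f (Suc K) t\<bar> \<le> r ^ Suc K * B" unfolding f_def abs_mult using r by (intro mult_mono) auto
        moreover have "fact (Suc K) \<ge> (1::real)" by (rule fact_ge_1)
        ultimately have "\<bar>f (Suc K) t\<bar> / fact (Suc K) \<le> r ^ Suc K * B / 1"
          using B r by (intro frac_le) auto
        then have "\<bar>f (Suc K) t\<bar> / fact (Suc K) \<le> r ^ Suc K * B" by simp
        moreover have "real j ^ Suc K \<le> real K ^ Suc K" using j by (intro power_mono) auto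
        ultimately have "\<bar>f (Suc K) t\<bar> / fact (Suc K) * real j ^ Suc K \<le> r ^ Suc K * B * real K ^ Suc K"
          using B r by (intro mult_mono) auto
        then show ?thesis using t(3) by (simp add: abs_mult mult_ac)
      qed
      have "\<bar>T (real j)\<bar> \<le> C * (r * R) ^ Suc a + B * real K ^ Suc K * r ^ Suc K"
        using gj diff by (simp add: f_def D0)
      also have "\<dots> \<le> C * (r * R) ^ Suc a + B * real K ^ Suc K * r ^ Suc a"
        using B r r1 by (intro add_left_mono mult_left_mono power_decreasing) (auto simp: K_def)
      finally show ?thesis by (simp add: power_mult_distrib algebra_simps)
    qed
    have "poly_fun K T" unfolding T_def
      by (intro poly_fun_sum poly_fun_cmult)
        (use poly_fun_mono[OF poly_fun_power[OF poly_fun_ident]] in auto)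
    moreover have "(T has_real_derivative f 1 0) (at 0)"
    proof -
      have "(T has_real_derivative (\<Sum>m\<le>K. f m 0 / fact m * (real m * 0 ^ (m - 1)))) (at 0)"
        unfolding T_def by (auto intro!: derivative_eq_intros simp: mult_ac)
      moreover have "(\<Sum>m\<le>K. f m 0 / fact m * (real m * 0 ^ (m - 1))) = (\<Sum>m\<le>K. if m = 1 then f 1 0 else 0)"
        by (intro sum.cong) (auto simp: power_0_left)
      moreover have "(\<Sum>m\<le>K. if m = 1 then f 1 0 else 0) = f 1 0"
        by (simp add: K_def del: sum.atMost_Suc)
      ultimately show ?thesis by simp
    qed
    ultimately have "f 1 0 = (\<Sum>j\<le>K. c j * T (real j))" by (rule c)
    then have "\<bar>f 1 0\<bar> \<le> (\<Sum>j\<le>K. \<bar>c j\<bar> * \<bar>T (real j)\<bar>)" using sum_abs[of "\<lambda>j. c j * T (real j)"] by (simp add: abs_mult)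
    also have "\<dots> \<le> (\<Sum>j\<le>K. \<bar>c j\<bar> * (r ^ Suc a * (C * R ^ Suc a + B * real K ^ Suc K)))"
      by (intro sum_mono mult_left_mono near) auto
    \<comment> \<open>The derivative along the segment carries a factor \<open>r\<close>; cancelling
      it lowers the exponent from \<open>Suc a\<close> to \<open>a\<close>.\<close>
    also have "\<dots> = r * (E * r ^ a)" by (simp add: E_def sum_distrib_right sum_distrib_left mult_ac)
    also have "f 1 0 = r * fderiv g x v" by (simp add: f_def DS D0 q_def)
    finally show "norm (fderiv g x v) \<le> E * norm x ^ a" using r by (simp add: abs_mult r_def)
  qed
qed

text \<open>Reduces to the scalar case by coordinates. With truncated subtraction the case
  \<open>a = 0\<close> just says that the derivative is locally bounded.\<close>

lemma vanishes_fderiv: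
  fixes g :: "'a::euclidean_space \<Rightarrow> 'b::euclidean_space"
  assumes "smooth_germ g" "vanishes a g"
  shows "vanishes (a - 1) (\<lambda>x. fderiv g x v)"
proof (cases a)
  case 0
  then show ?thesis using vanishes_0_smooth[OF smooth_germ_fderiv[OF assms(1)]] by simp
next
  case (Suc m)
  have 1: "vanishes m (\<lambda>x. fderiv g x v \<bullet> b)" for b
  proof -
    have "vanishes (Suc m) (\<lambda>x. g x \<bullet> b)"
      using vanishes_bilinear[OF bounded_bilinear_inner assms(2) vanishes_const[of b]] Suc by simp
    then have "vanishes m (\<lambda>x. fderiv (\<lambda>x. g x \<bullet> b) x v)"
      by (intro vanishes_fderiv_real smooth_germ_inner assms(1) smooth_germ_const)
    moreover have "\<forall>\<^sub>F x in nhds 0. fderiv (\<lambda>x. g x \<bullet> b) x v = fderiv g x v \<bullet> b"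
      using smooth_germ_derivative[OF assms(1)]
    proof eventually_elim
      case (elim x)
      have "((\<lambda>x. g x \<bullet> b) has_derivative (\<lambda>h. fderiv g x h \<bullet> b)) (at x)"
        using elim by (rule has_derivative_inner_left)
      then show ?case by (simp add: frechet_derivative_at[symmetric])
    qed
    ultimately show ?thesis by (rule vanishes_cong[rotated])
  qed
  have "vanishes m (\<lambda>x. \<Sum>b\<in>Basis. (fderiv g x v \<bullet> b) *\<^sub>R b)"
  proof (rule vanishes_sum)
    fix b :: 'b
    show "vanishes m (\<lambda>x. (fderiv g x v \<bullet> b) *\<^sub>R b)"
      using vanishes_bilinear[OF bounded_bilinear_scaleR 1 vanishes_const[of b]] by simp
  qed
  then show ?thesis using Suc by (simp add: euclidean_representation)
qed

text \<open>The derivative of \<open>f\<close> has order \<open>a - 1\<close> and the displacement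
  has order 2, so the mean value inequality gains one order. This makes the powers of psi* - 1
  increase the order of vanishing.\<close>

lemma vanishes_compose_diff:
  fixes f :: "'a::euclidean_space \<Rightarrow> 'b::euclidean_space"
  assumes "smooth_germ f" "vanishes a f" "vanishes 2 (\<lambda>x. \<psi> x - x)"
  shows "vanishes (Suc a) (\<lambda>x. f (\<psi> x) - f x)"
proof -
  obtain C e where C: "C \<ge> 0" "e > 0"
    "\<And>x y. norm x < e \<Longrightarrow> norm y < e \<Longrightarrow> norm (f x - f y) \<le> C * max (norm x) (norm y) ^ (a - 1) * norm (x - y)"
    using lipschitz_of_vanishes_fderiv[OF assms(1) vanishes_fderiv[OF assms(1,2)]] by blast
  obtain D d where D: "D \<ge> 0" "d > 0" "d \<le> 1" "\<And>x. norm x < d \<Longrightarrow> norm (\<psi> x - x) \<le> D * norm x ^ 2"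
    using vanishesE[OF assms(3)] by blast
  show ?thesis
  proof (rule vanishesI[of "min d (e / (D + 1))" _ "C * (D + 1) ^ (a - 1) * D"])
    fix x :: 'a assume x: "norm x < min d (e / (D + 1))"
    have xe: "norm x * (D + 1) < e" using x D(1) by (simp add: pos_less_divide_eq)
    have x1: "norm x \<le> 1" using x D(3) by simp
    have 1: "norm (\<psi> x - x) \<le> D * norm x ^ 2" using D(4) x by simp
    also have "\<dots> \<le> D * norm x" using x1 D(1) by (intro mult_left_mono) (auto simp: power2_eq_square mult_left_le)
    finally have 2: "norm (\<psi> x) \<le> norm x * (D + 1)"
      using norm_triangle_sub[of "\<psi> x" x] by (simp add: algebra_simps)
    have 3: "norm x \<le> norm x * (D + 1)" using D(1) by (simp add: algebra_simps)
    have "norm (f (\<psi> x) - f x) \<le> C * max (norm (\<psi> x)) (norm x) ^ (a - 1) * norm (\<psi> x - x)"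
      by (rule C(3)) (use 2 3 xe in linarith)+
    also have "\<dots> \<le> C * (norm x * (D + 1)) ^ (a - 1) * (D * norm x ^ 2)"
      using 1 2 3 C(1) D(1) by (intro mult_mono mult_left_mono power_mono) (auto simp: le_max_iff_disj)
    also have "\<dots> = C * (D + 1) ^ (a - 1) * D * norm x ^ (a - 1 + 2)"
      by (simp add: power_mult_distrib power_add mult_ac power2_eq_square)
    \<comment> \<open>The two exponents agree unless \<open>a = 0\<close>, where truncated
      subtraction yields 2 instead of 1; \<open>norm x \<le> 1\<close> covers that case.\<close>
    also have "\<dots> \<le> C * (D + 1) ^ (a - 1) * D * norm x ^ Suc a"
      using C(1) D(1) x1 by (intro mult_left_mono power_decreasing) auto
    finally show "norm (f (\<psi> x) - f x) \<le> C * (D + 1) ^ (a - 1) * D * norm x ^ Suc a" .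
  qed (use C D in auto)
qed

section \<open>Homogeneous polynomials and Taylor expansion\<close>

lemma homogeneous_polynomial_monomial:
  assumes "(\<Sum>j\<in>UNIV. \<alpha> j) = d"
  shows "homogeneous_polynomial d (\<lambda>s :: real^'n::finite. c * (\<Prod>j\<in>UNIV. (s $ j) ^ \<alpha> j))"
  unfolding homogeneous_polynomial_def
proof (intro exI allI)
  fix s :: "real^'n"
  have "(\<Sum>\<beta> | (\<Sum>j\<in>UNIV. \<beta> j) = d. (if \<beta> = \<alpha> then c else 0) * (\<Prod>j\<in>UNIV. (s $ j) ^ \<beta> j))
      = (\<Sum>\<beta> | (\<Sum>j\<in>UNIV. \<beta> j) = d. if \<beta> = \<alpha> then c * (\<Prod>j\<in>UNIV. (s $ j) ^ \<alpha> j) else 0)"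
    by (intro sum.cong) auto
  then show "c * (\<Prod>j\<in>UNIV. (s $ j) ^ \<alpha> j) =
      (\<Sum>\<beta> | (\<Sum>j\<in>UNIV. \<beta> j) = d. (if \<beta> = \<alpha> then c else 0) * (\<Prod>j\<in>UNIV. (s $ j) ^ \<beta> j))"
    using assms finite_multi_indices[where 'n = 'n, of d] by simp
qed

lemma homogeneous_polynomial_add:
  assumes "homogeneous_polynomial d p" "homogeneous_polynomial d q"
  shows "homogeneous_polynomial d (\<lambda>s. p s + q s)"
proof -
  obtain a where a: "\<And>s. p s = (\<Sum>\<alpha> | (\<Sum>j\<in>UNIV. \<alpha> j) = d. a \<alpha> * (\<Prod>j\<in>UNIV. (s $ j) ^ \<alpha> j))"
    using assms(1) unfolding homogeneous_polynomial_def by blast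
  obtain b where b: "\<And>s. q s = (\<Sum>\<alpha> | (\<Sum>j\<in>UNIV. \<alpha> j) = d. b \<alpha> * (\<Prod>j\<in>UNIV. (s $ j) ^ \<alpha> j))"
    using assms(2) unfolding homogeneous_polynomial_def by blast
  show ?thesis unfolding homogeneous_polynomial_def
    by (intro exI[of _ "\<lambda>\<alpha>. a \<alpha> + b \<alpha>"]) (simp add: a b sum.distrib distrib_right)
qed

lemma homogeneous_polynomial_zero: "homogeneous_polynomial d (\<lambda>s. 0)"
  unfolding homogeneous_polynomial_def by (intro exI[of _ "\<lambda>\<alpha>. 0"]) simp

lemma homogeneous_polynomial_sum:
  "(\<And>i. i \<in> I \<Longrightarrow> homogeneous_polynomial d (p i)) \<Longrightarrow> homogeneous_polynomial d (\<lambda>s. \<Sum>i\<in>I. p i s)"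
  by (induction I rule: infinite_finite_induct)
    (simp_all add: homogeneous_polynomial_zero homogeneous_polynomial_add)

lemma homogeneous_polynomial_const: "homogeneous_polynomial 0 (\<lambda>s. c)"
  using homogeneous_polynomial_monomial[of "\<lambda>_. 0" 0 c] by simp

lemma homogeneous_polynomial_cmult:
  assumes "homogeneous_polynomial d p"
  shows "homogeneous_polynomial d (\<lambda>s. c * p s)"
proof -
  obtain a where a: "\<And>s. p s = (\<Sum>\<alpha> | (\<Sum>j\<in>UNIV. \<alpha> j) = d. a \<alpha> * (\<Prod>j\<in>UNIV. (s $ j) ^ \<alpha> j))"
    using assms unfolding homogeneous_polynomial_def by blast
  show ?thesis unfolding homogeneous_polynomial_def
    by (intro exI[of _ "\<lambda>\<alpha>. c * a \<alpha>"]) (simp add: a sum_distrib_left mult.assoc)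
qed

lemma homogeneous_polynomial_coordinate_mult:
  fixes p :: "real^'n::finite \<Rightarrow> real"
  assumes "homogeneous_polynomial d p"
  shows "homogeneous_polynomial (Suc d) (\<lambda>s. s $ i * p s)"
proof -
  obtain a where a: "\<And>s. p s = (\<Sum>\<alpha> | (\<Sum>j\<in>UNIV. \<alpha> j) = d. a \<alpha> * (\<Prod>j\<in>UNIV. (s $ j) ^ \<alpha> j))"
    using assms unfolding homogeneous_polynomial_def by blast
  have 1: "(\<Prod>j\<in>UNIV. (s $ j) ^ (\<alpha>(i := Suc (\<alpha> i))) j) = s $ i * (\<Prod>j\<in>UNIV. (s $ j) ^ \<alpha> j)"
    for s :: "real^'n" and \<alpha>
    by (simp add: prod.remove[of UNIV i])
  have 2: "(\<Sum>j\<in>UNIV. (\<alpha>(i := Suc (\<alpha> i))) j) = Suc d" if "(\<Sum>j\<in>UNIV. \<alpha> j) = d" for \<alpha> :: "'n \<Rightarrow> nat"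
    using that by (simp add: sum.remove[of UNIV i])
  have "s $ i * p s = (\<Sum>\<alpha> | (\<Sum>j\<in>UNIV. \<alpha> j) = d. a \<alpha> * (\<Prod>j\<in>UNIV. (s $ j) ^ (\<alpha>(i := Suc (\<alpha> i))) j))" for s
    unfolding 1 a by (simp add: sum_distrib_left mult_ac)
  moreover have "homogeneous_polynomial (Suc d)
      (\<lambda>s. \<Sum>\<alpha> | (\<Sum>j\<in>UNIV. \<alpha> j) = d. a \<alpha> * (\<Prod>j\<in>UNIV. (s $ j) ^ (\<alpha>(i := Suc (\<alpha> i))) j))"
    by (intro homogeneous_polynomial_sum homogeneous_polynomial_monomial 2) auto
  ultimately show ?thesis by simp
qed

lemma homogeneous_polynomial_scale:
  assumes "homogeneous_polynomial d p"
  shows "p (t *\<^sub>R s) = t ^ d * p s"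
proof -
  obtain a where a: "\<And>s. p s = (\<Sum>\<alpha> | (\<Sum>j\<in>UNIV. \<alpha> j) = d. a \<alpha> * (\<Prod>j\<in>UNIV. (s $ j) ^ \<alpha> j))"
    using assms unfolding homogeneous_polynomial_def by blast
  show ?thesis unfolding a sum_distrib_left
    by (intro sum.cong) (auto simp: power_mult_distrib prod.distrib power_sum[symmetric])
qed

lemma smooth_germ_vec_nth [intro]:
  fixes f :: "'a::euclidean_space \<Rightarrow> real^'n::finite"
  assumes "smooth_germ f"
  shows "smooth_germ (\<lambda>x. f x $ i)"
proof -
  have "smooth_germ (\<lambda>x. f x \<bullet> axis i 1)" using assms by auto
  then show ?thesis by (simp add: inner_axis)
qed

lemma homogeneous_polynomial_smooth_germ:
  assumes "homogeneous_polynomial d p"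
  shows "smooth_germ p"
proof -
  obtain a where a: "\<And>s. p s = (\<Sum>\<alpha> | (\<Sum>j\<in>UNIV. \<alpha> j) = d. a \<alpha> * (\<Prod>j\<in>UNIV. (s $ j) ^ \<alpha> j))"
    using assms unfolding homogeneous_polynomial_def by blast
  have "smooth_germ (\<lambda>s. \<Sum>\<alpha> | (\<Sum>j\<in>UNIV. \<alpha> j) = d. a \<alpha> * (\<Prod>j\<in>UNIV. (s $ j) ^ \<alpha> j))"
    by (intro smooth_germ_sum smooth_germ_mult smooth_germ_prod smooth_germ_power smooth_germ_vec_nth
        smooth_germ_const smooth_germ_id)
  then show ?thesis by (simp add: a[abs_def])
qed

lemma homogeneous_polynomial_vanishes:
  assumes "homogeneous_polynomial d p"
  shows "vanishes d p"
proof -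
  obtain a where a: "\<And>s. p s = (\<Sum>\<alpha> | (\<Sum>j\<in>UNIV. \<alpha> j) = d. a \<alpha> * (\<Prod>j\<in>UNIV. (s $ j) ^ \<alpha> j))"
    using assms unfolding homogeneous_polynomial_def by blast
  have "vanishes d (\<lambda>s. \<Sum>\<alpha> | (\<Sum>j\<in>UNIV. \<alpha> j) = d. a \<alpha> * (\<Prod>j\<in>UNIV. (s $ j) ^ \<alpha> j))"
  proof (rule vanishes_sum)
    fix \<alpha> assume "\<alpha> \<in> {\<alpha> :: 'a \<Rightarrow> nat. (\<Sum>j\<in>UNIV. \<alpha> j) = d}"
    then have d: "d = (\<Sum>j\<in>UNIV. \<alpha> j)" by simp
    show "vanishes d (\<lambda>s. a \<alpha> * (\<Prod>j\<in>UNIV. (s $ j) ^ \<alpha> j))"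
    proof (rule vanishesI[of 1 _ "\<bar>a \<alpha>\<bar>"])
      fix s :: "real^'a"
      have "(\<Prod>j\<in>UNIV. \<bar>s $ j\<bar> ^ \<alpha> j) \<le> (\<Prod>j\<in>UNIV. norm s ^ \<alpha> j)"
        by (intro prod_mono conjI power_mono) (auto simp: component_le_norm_cart)
      then show "norm (a \<alpha> * (\<Prod>j\<in>UNIV. (s $ j) ^ \<alpha> j)) \<le> \<bar>a \<alpha>\<bar> * norm s ^ d"
        by (simp add: abs_mult abs_prod power_abs d power_sum mult_left_mono)
    qed simp
  qed
  then show ?thesis by (simp add: a[abs_def])
qed

lemma homogeneous_polynomial_continuous:
  assumes "homogeneous_polynomial d p"
  shows "continuous_on S p"
proof -
  obtain a where a: "\<And>s. p s = (\<Sum>\<alpha> | (\<Sum>j\<in>UNIV. \<alpha> j) = d. a \<alpha> * (\<Prod>j\<in>UNIV. (s $ j) ^ \<alpha> j))"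
    using assms unfolding homogeneous_polynomial_def by blast
  show ?thesis unfolding a[abs_def] by (intro continuous_intros)
qed

lemma homogeneous_polynomial_poly_fun:
  assumes "homogeneous_polynomial d p" "\<And>j. poly_fun K (\<lambda>t. s t $ j)"
  shows "poly_fun (d * K) (\<lambda>t. p (s t))"
proof -
  obtain a where a: "\<And>s. p s = (\<Sum>\<alpha> | (\<Sum>j\<in>UNIV. \<alpha> j) = d. a \<alpha> * (\<Prod>j\<in>UNIV. (s $ j) ^ \<alpha> j))"
    using assms unfolding homogeneous_polynomial_def by blast
  show ?thesis unfolding a
  proof (intro poly_fun_sum poly_fun_cmult)
    fix \<alpha> assume "\<alpha> \<in> {\<alpha> :: 'a \<Rightarrow> nat. (\<Sum>j\<in>UNIV. \<alpha> j) = d}"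
    then have d: "d * K = (\<Sum>j\<in>UNIV. \<alpha> j * K)" by (simp add: sum_distrib_right[symmetric])
    show "poly_fun (d * K) (\<lambda>t. \<Prod>j\<in>UNIV. (s t $ j) ^ \<alpha> j)"
      unfolding d by (intro poly_fun_prod poly_fun_power assms(2))
  qed
qed

lemma linear_sum_axis:
  fixes f :: "real^'n::finite \<Rightarrow> 'b::real_vector"
  assumes "linear f"
  shows "f x = (\<Sum>i\<in>UNIV. (x $ i) *\<^sub>R f (axis i 1))"
proof -
  have "f x = f (\<Sum>i\<in>UNIV. (x $ i) *\<^sub>R axis i 1)"
    using basis_expansion[of x] by (simp add: scalar_mult_eq_scaleR)
  also have "\<dots> = (\<Sum>i\<in>UNIV. (x $ i) *\<^sub>R f (axis i 1))"
    using assms by (simp add: linear_sum linear_scale)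
  finally show ?thesis .
qed

text \<open>Induction on the degree by Euler's identity: the leading part of \<open>g\<close> is
  recovered from the leading parts \<open>P i\<close> of its partial derivatives as a multiple of
  the sum of \<open>x $ i * P i x\<close>. The error is estimated by the mean value theorem on
  rays.\<close>

lemma taylor_leading_term:
  fixes g :: "real^'n::finite \<Rightarrow> real"
  assumes "smooth_germ g" "vanishes d g"
  shows "\<exists>P. homogeneous_polynomial d P \<and> vanishes (Suc d) (\<lambda>x. g x - P x)"
  using assms
proof (induction d arbitrary: g)
  case 0
  have "vanishes 1 (\<lambda>x. g x - g 0)"
    by (rule vanishes_1_smooth) (use 0 in auto)
  then show ?case using homogeneous_polynomial_const[of "g 0"] by fastforce
next
  case (Suc d)
  define G where "G i x = fderiv g x (axis i 1)" for i x
  have "\<exists>P. homogeneous_polynomial d P \<and> vanishes (Suc d) (\<lambda>x. G i x - P x)" for i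
    using vanishes_fderiv[OF Suc.prems] unfolding G_def
    by (intro Suc.IH smooth_germ_fderiv Suc.prems) simp
  then obtain P where P: "\<And>i. homogeneous_polynomial d (P i)" "\<And>i. vanishes (Suc d) (\<lambda>x. G i x - P i x)"
    by metis
  \<comment> \<open>Along the ray through \<open>x\<close>, the derivative of
    \<open>t ^ Suc d * Q x\<close> is exactly the sum of \<open>x $ i * P i (t *\<^sub>R x)\<close>,
    so the comparison concerns radial derivatives only.\<close>
  define Q where "Q x = 1 / real (Suc d) * (\<Sum>i\<in>UNIV. x $ i * P i x)" for x
  have Q: "homogeneous_polynomial (Suc d) Q"
    unfolding Q_def [abs_def]
    by (intro homogeneous_polynomial_cmult homogeneous_polynomial_sum homogeneous_polynomial_coordinate_mult P)
  have "vanishes (Suc d) (\<lambda>x. \<Sum>i\<in>UNIV. norm (G i x - P i x))"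
    by (intro vanishes_sum vanishes_norm P)
  then obtain C e where C: "C \<ge> 0" "e > 0" "e \<le> 1"
    "\<And>x. norm x < e \<Longrightarrow> norm (\<Sum>i\<in>UNIV. norm (G i x - P i x)) \<le> C * norm x ^ Suc d"
    using vanishesE by blast
  have C': "(\<Sum>i\<in>UNIV. \<bar>G i x - P i x\<bar>) \<le> C * norm x ^ Suc d" if "norm x < e" for x
    using C(4)[OF that] by (simp add: sum_nonneg)
  have g0: "g 0 = 0" using vanishesE[OF Suc.prems(2)] by (metis norm_le_zero_iff norm_zero mult_zero_right power_Suc0_right power_0_Suc)
  obtain b where b: "b > 0" "smooth_on g (ball 0 b)" using smooth_germE[OF Suc.prems(1)] by blast
  have "vanishes (Suc (Suc d)) (\<lambda>x. g x - Q x)"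
  proof (rule vanishesI[of "min e b" _ C])
    fix x :: "real^'n" assume x: "norm x < min e b"
    define h where "h t = g (t *\<^sub>R x) - t ^ Suc d * Q x" for t
    define h' where "h' t = (\<Sum>i\<in>UNIV. x $ i * (G i (t *\<^sub>R x) - P i (t *\<^sub>R x)))" for t
    have tx: "norm (t *\<^sub>R x) \<le> norm x" if "0 \<le> t" "t \<le> 1" for t
      using that by (simp add: mult_left_le_one_le)
    have der: "(h has_real_derivative h' t) (at t)" if t: "0 \<le> t" "t \<le> 1" for t
    proof -
      have "t *\<^sub>R x \<in> ball 0 b" using tx[OF t] x by simp
      from smooth_on_derivative[OF open_ball b(2) this]
      have D: "(g has_derivative fderiv g (t *\<^sub>R x)) (at (t *\<^sub>R x))" .
      have "((\<lambda>t. t *\<^sub>R x) has_derivative (\<lambda>s. s *\<^sub>R x)) (at t)"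
        by (auto intro!: derivative_eq_intros)
      from has_derivative_compose[OF this D]
      have "((\<lambda>t. g (t *\<^sub>R x)) has_derivative (\<lambda>s. fderiv g (t *\<^sub>R x) (s *\<^sub>R x))) (at t)" .
      moreover have "fderiv g (t *\<^sub>R x) (s *\<^sub>R x) = (\<Sum>i\<in>UNIV. x $ i * G i (t *\<^sub>R x)) * s" for s
        using linear_sum_axis[OF has_derivative_linear[OF D], of x]
          linear_scale[OF has_derivative_linear[OF D], of s x]
        by (simp add: G_def)
      ultimately have "((\<lambda>t. g (t *\<^sub>R x)) has_real_derivative (\<Sum>i\<in>UNIV. x $ i * G i (t *\<^sub>R x))) (at t)"
        unfolding has_field_derivative_def by simp
      moreover have "((\<lambda>t. t ^ Suc d * Q x) has_real_derivative (real (Suc d) * t ^ d * Q x)) (at t)"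
        by (rule derivative_eq_intros refl | simp)+
      ultimately have "(h has_real_derivative (\<Sum>i\<in>UNIV. x $ i * G i (t *\<^sub>R x)) - real (Suc d) * t ^ d * Q x) (at t)"
        unfolding h_def [abs_def] by (rule DERIV_diff)
      moreover have "real (Suc d) * t ^ d * Q x = (\<Sum>i\<in>UNIV. x $ i * P i (t *\<^sub>R x))"
        by (simp add: Q_def homogeneous_polynomial_scale[OF P(1)] sum_distrib_left mult_ac del: of_nat_Suc)
      ultimately show ?thesis by (simp add: h'_def right_diff_distrib sum_subtractf)
    qed
    obtain t where t: "0 < t" "t < 1" "h 1 - h 0 = (1 - 0) * h' t"
      using MVT2[of 0 1 h h'] der by auto
    have "\<bar>h' t\<bar> \<le> (\<Sum>i\<in>UNIV. \<bar>x $ i\<bar> * \<bar>G i (t *\<^sub>R x) - P i (t *\<^sub>R x)\<bar>)"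
      unfolding h'_def by (rule order.trans[OF sum_abs]) (simp add: abs_mult)
    also have "\<dots> \<le> (\<Sum>i\<in>UNIV. norm x * \<bar>G i (t *\<^sub>R x) - P i (t *\<^sub>R x)\<bar>)"
      by (intro sum_mono mult_right_mono) (auto simp: component_le_norm_cart)
    also have "\<dots> \<le> norm x * (C * norm (t *\<^sub>R x) ^ Suc d)"
      unfolding sum_distrib_left[symmetric]
      by (intro mult_left_mono C') (use tx[of t] t x in auto)
    also have "\<dots> \<le> norm x * (C * norm x ^ Suc d)"
      using tx[of t] t C(1) by (intro mult_left_mono power_mono) auto
    finally show "norm (g x - Q x) \<le> C * norm x ^ Suc (Suc d)"
      using t(3) by (simp add: h_def g0 mult_ac)
  qed (use C b in auto)
  with Q show ?case by blast
qed

section \<open>Coefficients of polynomials with even symmetry\<close>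

text \<open>Induction on the set of variables: with the others fixed, the sum is a polynomial in
  \<open>y i\<close>, and its coefficient of degree \<open>m i\<close> collects the monomials in
  \<open>T\<close>. The separation assumption ensures that a single monomial is left when no
  variables remain.\<close>

lemma monomials_independent:
  fixes b :: "('n \<Rightarrow> nat) \<Rightarrow> real"
  assumes "finite A" "finite S"
    and "\<And>m m'. m \<in> S \<Longrightarrow> m' \<in> S \<Longrightarrow> (\<forall>j\<in>A. m j = m' j) \<Longrightarrow> m = m'"
    and "\<And>y :: 'n \<Rightarrow> real. (\<Sum>m\<in>S. b m * (\<Prod>j\<in>A. y j ^ m j)) = 0"
    and "m \<in> S"
  shows "b m = 0"
  using assms
proof (induction A arbitrary: S m rule: finite_induct)
  case empty
  then have "S = {m}" by auto
  then show ?case using empty.prems(3) by simp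
next
  case (insert i A)
  define T where "T = {m' \<in> S. m' i = m i}"
  have "(\<Sum>m\<in>T. b m * (\<Prod>j\<in>A. y j ^ m j)) = 0" for y :: "'n \<Rightarrow> real"
  proof -
    define q where "q = (\<Sum>m'\<in>S. monom (b m' * (\<Prod>j\<in>A. y j ^ m' j)) (m' i))"
    have "poly q t = 0" for t
    proof -
      have "(\<Prod>j\<in>insert i A. (y(i := t)) j ^ m' j) = t ^ m' i * (\<Prod>j\<in>A. y j ^ m' j)" for m' :: "'n \<Rightarrow> nat"
      proof -
        have "(\<Prod>j\<in>A. (y(i := t)) j ^ m' j) = (\<Prod>j\<in>A. y j ^ m' j)"
          using insert.hyps by (intro prod.cong) auto
        then show ?thesis using insert.hyps by simp
      qed
      then show ?thesis
        using insert.prems(3)[of "y(i := t)"] unfolding q_def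
        by (simp add: poly_sum poly_monom mult_ac)
    qed
    then have "q = 0" using poly_all_0_iff_0 by blast
    then have "coeff q (m i) = 0" by simp
    then show ?thesis
      unfolding q_def T_def sum.inter_filter[OF insert.prems(1)] by (simp add: coeff_sum cong: if_cong)
  qed
  then show ?case
    by (intro insert.IH[of T m]) (use insert.prems in \<open>auto simp: T_def\<close>)
qed

text \<open>Flipping the sign of one coordinate multiplies each monomial by a sign, so invariance
  kills every coefficient with an odd exponent. The remaining coefficients are multiplied by nonzero
  weights in \<open>zero\<close>, and independence of monomials kills them as well. The weights
  stand for the moments that arise from torus averages.\<close>

lemma even_homogeneous_polynomial_eq_zero:
  fixes P :: "real^'n::finite \<Rightarrow> real"
  assumes P: "\<And>s. P s = (\<Sum>\<alpha> | (\<Sum>j\<in>UNIV. \<alpha> j) = d. a \<alpha> * (\<Prod>j\<in>UNIV. (s $ j) ^ \<alpha> j))"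
    and even: "\<And>\<sigma> x. (\<And>i. \<sigma> i \<in> {-1, 1}) \<Longrightarrow> P (\<chi> i. \<sigma> i * x $ i) = P x"
    and zero: "\<And>s :: real^'n. (\<Sum>\<alpha> | (\<Sum>j\<in>UNIV. \<alpha> j) = d. a \<alpha> * (\<Prod>j\<in>UNIV. \<gamma> (\<alpha> j) * (s $ j) ^ \<alpha> j)) = 0"
    and \<gamma>: "\<And>k. even k \<Longrightarrow> \<gamma> k \<noteq> (0::real)"
  shows "P x = 0"
proof -
  have ind: "b \<alpha> = 0"
    if "\<And>s :: real^'n. (\<Sum>\<alpha> | (\<Sum>j\<in>UNIV. \<alpha> j) = d. b \<alpha> * (\<Prod>j\<in>UNIV. (s $ j) ^ \<alpha> j)) = 0"
      "(\<Sum>j\<in>UNIV. \<alpha> j) = d" for b \<alpha>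
  proof (rule monomials_independent[of UNIV "{\<alpha>. (\<Sum>j\<in>UNIV. \<alpha> j) = d}" b])
    show "(\<Sum>\<alpha> | (\<Sum>j\<in>UNIV. \<alpha> j) = d. b \<alpha> * (\<Prod>j\<in>UNIV. y j ^ \<alpha> j)) = 0" for y :: "'n \<Rightarrow> real"
      using that(1)[of "\<chi> j. y j"] by simp
  qed (use that(2) finite_multi_indices in auto)
  have "a \<alpha> = 0" if \<alpha>: "(\<Sum>j\<in>UNIV. \<alpha> j) = d" for \<alpha>
  proof (rule ccontr)
    assume a: "a \<alpha> \<noteq> 0"
    have "even (\<alpha> i)" for i
    proof -
      define \<sigma> :: "'n \<Rightarrow> real" where "\<sigma> j = (if j = i then - 1 else 1)" for j
      have \<sigma>: "(\<Prod>j\<in>UNIV. \<sigma> j ^ \<beta> j) = (- 1) ^ \<beta> i" for \<beta> :: "'n \<Rightarrow> nat"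
        by (simp add: \<sigma>_def prod.remove[of UNIV i] prod.neutral)
      have "a \<alpha> * ((- 1) ^ \<alpha> i - 1) = 0"
      proof (rule ind[OF _ \<alpha>])
        fix s :: "real^'n"
        have "P (\<chi> j. \<sigma> j * s $ j) - P s = 0" by (simp add: even \<sigma>_def)
        moreover have "P (\<chi> j. \<sigma> j * s $ j) - P s
          = (\<Sum>\<beta> | (\<Sum>j\<in>UNIV. \<beta> j) = d. a \<beta> * ((- 1) ^ \<beta> i - 1) * (\<Prod>j\<in>UNIV. (s $ j) ^ \<beta> j))"
          unfolding P sum_subtractf[symmetric]
          by (intro sum.cong) (simp_all add: power_mult_distrib prod.distrib \<sigma> algebra_simps)
        ultimately show "(\<Sum>\<beta> | (\<Sum>j\<in>UNIV. \<beta> j) = d. a \<beta> * ((- 1) ^ \<beta> i - 1) * (\<Prod>j\<in>UNIV. (s $ j) ^ \<beta> j)) = 0"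
          by simp
      qed
      with a show ?thesis by (cases "even (\<alpha> i)") auto
    qed
    moreover have "a \<alpha> * (\<Prod>j\<in>UNIV. \<gamma> (\<alpha> j)) = 0"
      by (rule ind[OF _ \<alpha>]) (use zero in \<open>simp add: prod.distrib mult.assoc\<close>)
    ultimately show False using a \<gamma> by (auto simp: prod_zero_iff)
  qed
  then show ?thesis unfolding P by (intro sum.neutral) auto
qed

section \<open>The logarithm of a germ tangent to the identity\<close>

lemma vanishes_2_tangent_id:
  assumes "smooth_germ \<psi>" "\<psi> 0 = 0" "(\<psi> has_derivative id) (at 0)"
  shows "vanishes 2 (\<lambda>z. \<psi> z - z)"
proof -
  have sm: "smooth_germ (\<lambda>z. \<psi> z - z)" by (intro smooth_germ_diff assms smooth_germ_id)
  have "((\<lambda>z. \<psi> z - z) has_derivative (\<lambda>h. id h - h)) (at 0)"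
    by (intro has_derivative_diff assms has_derivative_ident)
  from frechet_derivative_at[OF this] have "fderiv (\<lambda>z. \<psi> z - z) 0 v = 0" for v by (metis id_apply diff_self)
  then have "vanishes 1 (\<lambda>x. fderiv (\<lambda>z. \<psi> z - z) x v)" for v
    by (intro vanishes_1_smooth smooth_germ_fderiv sm)
  from vanishes_Suc_of_fderiv[OF sm this] show ?thesis using assms(2) by (simp add: numeral_2_eq_2)
qed

text \<open>Local Lipschitz continuity of \<open>f\<close>; the bounds of order 1 keep both inner
  functions inside the ball where the Lipschitz estimate holds.\<close>

lemma vanishes_compose_cong:
  fixes f :: "'a::euclidean_space \<Rightarrow> 'b::euclidean_space" and g h :: "'x::real_normed_vector \<Rightarrow> 'a"
  assumes "smooth_germ f" "vanishes b (\<lambda>z. g z - h z)" "vanishes 1 g" "vanishes 1 h"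
  shows "vanishes b (\<lambda>z. f (g z) - f (h z))"
proof -
  obtain C e where C: "C \<ge> 0" "e > 0"
    "\<And>x y. norm x < e \<Longrightarrow> norm y < e \<Longrightarrow> norm (f x - f y) \<le> C * max (norm x) (norm y) ^ 0 * norm (x - y)"
    using lipschitz_of_vanishes_fderiv[OF assms(1) vanishes_0_smooth[OF smooth_germ_fderiv[OF assms(1)]]] by blast
  have ev: "\<forall>\<^sub>F z in nhds 0. norm (k z) < e" if k: "vanishes 1 k" for k :: "'x \<Rightarrow> 'a"
  proof -
    obtain D d where D: "D \<ge> 0" "d > 0" "d \<le> 1" "\<And>z. norm z < d \<Longrightarrow> norm (k z) \<le> D * norm z ^ 1"
      using vanishesE[OF k] by blast
    have "norm (k z) < e" if "norm z < min d (e / (D + 1))" for z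
    proof -
      have "norm z * (D + 1) < e" using that D(1) by (simp add: pos_less_divide_eq)
      moreover have "norm z * (D + 1) = D * norm z + norm z" by (simp add: algebra_simps)
      moreover have "norm (k z) \<le> D * norm z" using D(4)[of z] that by simp
      ultimately show ?thesis using norm_ge_zero[of z] by linarith
    qed
    then show ?thesis unfolding eventually_nhds_metric
      using D C(2) by (intro exI[of _ "min d (e / (D + 1))"]) auto
  qed
  obtain B where B: "\<forall>\<^sub>F z in nhds 0. norm (g z - h z) \<le> B * norm z ^ b"
    using assms(2) unfolding vanishes_def by blast
  have "\<forall>\<^sub>F z in nhds 0. norm (f (g z) - f (h z)) \<le> (C * B) * norm z ^ b"
    using ev[OF assms(3)] ev[OF assms(4)] B
  proof eventually_elim
    case (elim z)
    have "norm (f (g z) - f (h z)) \<le> C * norm (g z - h z)" using C(3)[OF elim(1,2)] by simp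
    also have "\<dots> \<le> C * (B * norm z ^ b)" using elim(3) C(1) by (rule mult_left_mono)
    finally show ?case by simp
  qed
  then show ?thesis unfolding vanishes_def by blast
qed

text \<open>With psi* the pullback by \<open>\<psi>\<close>, this is the k-th power of the operator
  psi* - 1 applied to \<open>g\<close>.\<close>

primrec fdiff :: "('a \<Rightarrow> 'a) \<Rightarrow> nat \<Rightarrow> ('a \<Rightarrow> 'b::real_vector) \<Rightarrow> 'a \<Rightarrow> 'b" where
  "fdiff \<psi> 0 g = g"
| "fdiff \<psi> (Suc k) g = (\<lambda>z. fdiff \<psi> k g (\<psi> z) - fdiff \<psi> k g z)"

text \<open>Newton's formula: the binomial expansion of the j-th power of psi* = 1 + (psi* - 1). The
  induction step is Pascal's rule.\<close>

lemma newton_forward: "g ((\<psi> ^^ j) z) = (\<Sum>k\<le>j. real (j choose k) *\<^sub>R fdiff \<psi> k g z)"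
proof (induction j arbitrary: z)
  case (Suc j)
  have "g ((\<psi> ^^ Suc j) z) = (\<Sum>k\<le>j. real (j choose k) *\<^sub>R fdiff \<psi> k g (\<psi> z))"
    using Suc[of "\<psi> z"] by (simp add: funpow_swap1)
  also have "\<dots> = (\<Sum>k\<le>j. real (j choose k) *\<^sub>R fdiff \<psi> (Suc k) g z)
      + (\<Sum>k\<le>j. real (j choose k) *\<^sub>R fdiff \<psi> k g z)"
    by (simp add: sum.distrib[symmetric] scaleR_add_right[symmetric])
  also have "(\<Sum>k\<le>j. real (j choose k) *\<^sub>R fdiff \<psi> k g z) = (\<Sum>k\<le>Suc j. real (j choose k) *\<^sub>R fdiff \<psi> k g z)"
    by simp
  also have "\<dots> = fdiff \<psi> 0 g z + (\<Sum>k\<le>j. real (j choose Suc k) *\<^sub>R fdiff \<psi> (Suc k) g z)"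
    by (subst sum.atMost_Suc_shift) simp
  also have "(\<Sum>k\<le>j. real (j choose k) *\<^sub>R fdiff \<psi> (Suc k) g z)
      + (fdiff \<psi> 0 g z + (\<Sum>k\<le>j. real (j choose Suc k) *\<^sub>R fdiff \<psi> (Suc k) g z))
      = fdiff \<psi> 0 g z + (\<Sum>k\<le>j. real (Suc j choose Suc k) *\<^sub>R fdiff \<psi> (Suc k) g z)"
    by (simp add: sum.distrib scaleR_add_left)
  also have "\<dots> = (\<Sum>k\<le>Suc j. real (Suc j choose k) *\<^sub>R fdiff \<psi> k g z)"
    by (subst sum.atMost_Suc_shift) simp
  finally show ?case .
qed simp

lemma smooth_germ_fdiff:
  assumes "smooth_germ \<psi>" "\<psi> 0 = 0" "smooth_germ g"
  shows "smooth_germ (fdiff \<psi> k g)"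
proof (induction k)
  case (Suc k)
  show ?case unfolding fdiff.simps
    by (intro smooth_germ_diff smooth_germ_compose[OF Suc assms(1,2)] Suc)
qed (simp add: assms)

lemma vanishes_fdiff:
  assumes "smooth_germ \<psi>" "\<psi> 0 = 0" "vanishes 2 (\<lambda>z. \<psi> z - z)" "smooth_germ g" "vanishes a g"
  shows "vanishes (a + k) (fdiff \<psi> k g)"
proof (induction k)
  case (Suc k)
  then show ?case
    using vanishes_compose_diff[OF smooth_germ_fdiff[OF assms(1,2,4)] Suc assms(3)] by simp
qed (simp add: assms)

text \<open>The coefficient of x^k in log(1 + x), that is 0 for \<open>k = 0\<close> and
  (-1)^(k-1)/k otherwise; it enters only as a derivative.\<close>

definition gchoose_deriv :: "nat \<Rightarrow> real" where
  "gchoose_deriv k = deriv (\<lambda>t. t gchoose k) 0"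

lemma gchoose_deriv: "((\<lambda>t. t gchoose k) has_real_derivative gchoose_deriv k) (at 0)"
  using poly_fun_real_derivative[OF poly_fun_gchoose] DERIV_imp_deriv unfolding gchoose_deriv_def by metis

lemma gchoose_0_left: "(0 :: real) gchoose k = (if k = 0 then 1 else 0)"
  by (cases k) auto

text \<open>\<open>flow \<psi> K t\<close> truncates the binomial series of $\psi^t = (1 + (\psi - 1))^t$,
  and \<open>generator \<psi> K\<close>, its derivative at $t = 0$, that of $\log \psi$.\<close>

definition flow :: "('a \<Rightarrow> 'a) \<Rightarrow> nat \<Rightarrow> real \<Rightarrow> 'a \<Rightarrow> 'a::real_vector" where
  "flow \<psi> K t z = (\<Sum>k\<le>K. (t gchoose k) *\<^sub>R fdiff \<psi> k (\<lambda>z. z) z)"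

definition generator :: "('a \<Rightarrow> 'a) \<Rightarrow> nat \<Rightarrow> 'a \<Rightarrow> 'a::real_vector" where
  "generator \<psi> K z = (\<Sum>k\<le>K. gchoose_deriv k *\<^sub>R fdiff \<psi> k (\<lambda>z. z) z)"

lemma sum_gchoose_has_vector_derivative:
  fixes y :: "nat \<Rightarrow> 'a::real_normed_vector"
  shows "((\<lambda>t. \<Sum>k\<le>K. (t gchoose k) *\<^sub>R y k) has_vector_derivative (\<Sum>k\<le>K. gchoose_deriv k *\<^sub>R y k)) (at 0)"
proof (rule has_vector_derivative_sum)
  fix k
  show "((\<lambda>t. (t gchoose k) *\<^sub>R y k) has_vector_derivative gchoose_deriv k *\<^sub>R y k) (at 0)"
    using has_vector_derivative_scaleR[OF gchoose_deriv has_vector_derivative_const, of k "y k"] by simp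
qed

lemma sum_gchoose_at_0:
  fixes y :: "nat \<Rightarrow> 'a::real_vector"
  shows "(\<Sum>k\<le>K. (0 gchoose k :: real) *\<^sub>R y k) = y 0"
proof -
  have "(\<Sum>k\<le>K. (0 gchoose k :: real) *\<^sub>R y k) = (\<Sum>k\<le>K. if k = 0 then y 0 else 0)"
    by (intro sum.cong) (auto simp: gchoose_0_left)
  then show ?thesis by simp
qed

context
  fixes \<psi> :: "'a::euclidean_space \<Rightarrow> 'a"
  assumes smooth: "smooth_germ \<psi>" and zero: "\<psi> 0 = 0" and tangent: "vanishes 2 (\<lambda>z. \<psi> z - z)"
begin

lemma smooth_germ_fdiff_id: "smooth_germ (fdiff \<psi> k (\<lambda>z. z))"
  by (rule smooth_germ_fdiff[OF smooth zero smooth_germ_id])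

lemma vanishes_fdiff_id: "vanishes (Suc k) (fdiff \<psi> k (\<lambda>z. z))"
  using vanishes_fdiff[OF smooth zero tangent smooth_germ_id vanishes_ident, of k] by simp

lemma smooth_germ_flow: "smooth_germ (flow \<psi> K t)"
  unfolding flow_def [abs_def] by (intro smooth_germ_sum smooth_germ_scaleR smooth_germ_const smooth_germ_fdiff_id)

lemma smooth_germ_generator: "smooth_germ (generator \<psi> K)"
  unfolding generator_def [abs_def]
  by (intro smooth_germ_sum smooth_germ_scaleR smooth_germ_const smooth_germ_fdiff_id)

lemma vanishes_1_flow: "vanishes 1 (flow \<psi> K t)"
  unfolding flow_def [abs_def]
  by (intro vanishes_sum vanishes_scaleR vanishes_mono[OF vanishes_fdiff_id]) simp

lemma funpow_zero: "(\<psi> ^^ j) 0 = 0"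
  by (induction j) (auto simp: zero)

lemma smooth_germ_funpow: "smooth_germ (\<psi> ^^ j)"
proof (induction j)
  case (Suc j)
  then show ?case using smooth_germ_compose[OF smooth Suc funpow_zero] by (simp add: comp_def)
qed (simp add: smooth_germ_id id_def)

lemma vanishes_1_funpow: "vanishes 1 (\<psi> ^^ j)"
  by (rule vanishes_1_smooth[OF smooth_germ_funpow funpow_zero])

lemma vanishes_2_funpow: "vanishes 2 (\<lambda>z. (\<psi> ^^ j) z - z)"
proof (induction j)
  case (Suc j)
  have "vanishes 2 (\<lambda>z. (\<psi> ((\<psi> ^^ j) z) - (\<psi> ^^ j) z) + ((\<psi> ^^ j) z - z))"
    by (intro vanishes_add Suc vanishes_compose[OF tangent] vanishes_1_funpow)
  then show ?case by simp
qed simp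

text \<open>At an integer time the binomial series terminates and equals the iterate by
  \<open>newton_forward\<close>. The truncation drops only terms with \<open>k > K\<close>, and the
  k-th difference of the identity has order \<open>k + 1\<close>.\<close>

lemma flow_nat: "vanishes (K + 2) (\<lambda>z. (\<psi> ^^ j) z - flow \<psi> K (real j) z)"
proof -
  \<comment> \<open>Both sums are compared inside one range: terms with \<open>k > j\<close> vanish
    because the binomial coefficient does.\<close>
  let ?M = "max j K" and ?F = "\<lambda>k z. real (j choose k) *\<^sub>R fdiff \<psi> k (\<lambda>z. z) z"
  have "(\<psi> ^^ j) z - flow \<psi> K (real j) z = (\<Sum>k\<in>{Suc K..?M}. ?F k z)" for z
  proof -
    have "(\<psi> ^^ j) z = (\<Sum>k\<le>j. ?F k z)" by (rule newton_forward)
    also have "\<dots> = (\<Sum>k\<le>?M. ?F k z)" by (intro sum.mono_neutral_left) (auto simp: binomial_eq_0)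
    also have "{..?M} = {..K} \<union> {Suc K..?M}" by auto
    also have "(\<Sum>k\<in>\<dots>. ?F k z) = (\<Sum>k\<le>K. ?F k z) + (\<Sum>k\<in>{Suc K..?M}. ?F k z)"
      by (intro sum.union_disjoint) auto
    also have "(\<Sum>k\<le>K. ?F k z) = flow \<psi> K (real j) z"
      by (simp add: flow_def binomial_gbinomial)
    finally show ?thesis by simp
  qed
  moreover have "vanishes (K + 2) (\<lambda>z. \<Sum>k\<in>{Suc K..?M}. ?F k z)"
    by (intro vanishes_sum vanishes_scaleR vanishes_mono[OF vanishes_fdiff_id]) auto
  ultimately show ?thesis by simp
qed

text \<open>Along the iterates \<open>f\<close> decreases by \<open>j * Q\<close> up to order
  \<open>Suc d\<close>. Replacing the iterates by \<open>flow\<close> makes this error polynomial in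
  the time, by \<open>poly\<close>, so its derivative at time 0 has the same order; that derivative
  is the generator applied to \<open>f\<close>, plus \<open>Q\<close>.\<close>

lemma generator_energy:
  fixes f :: "'a \<Rightarrow> real"
  assumes f: "smooth_germ f"
    and poly: "\<And>y. poly_fun M (\<lambda>t. f (\<Sum>k\<le>K. (t gchoose k) *\<^sub>R y k))"
    and Q: "smooth_germ Q" "vanishes d Q"
    and fQ: "vanishes (Suc d) (\<lambda>z. f (\<psi> z) - f z + Q z)"
    and d: "d \<le> K"
  shows "vanishes (Suc d) (\<lambda>z. fderiv f z (generator \<psi> K z) + Q z)"
proof -
  \<comment> \<open>One more application of \<open>\<psi>\<close> subtracts \<open>Q\<close> at the
    j-th iterate of \<open>z\<close>, which differs from \<open>Q z\<close> by order
    \<open>Suc d\<close>.\<close>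
  have iter: "vanishes (Suc d) (\<lambda>z. f ((\<psi> ^^ j) z) - f z + real j * Q z)" for j
  proof (induction j)
    case (Suc j)
    show ?case
      using vanishes_diff[OF vanishes_add[OF vanishes_compose[OF fQ vanishes_1_funpow[of j]] Suc]
          vanishes_compose_diff[OF Q vanishes_2_funpow[of j]]]
      by (simp add: algebra_simps)
  qed simp
  have nat: "vanishes (Suc d) (\<lambda>z. f (flow \<psi> K (real j) z) - f z + real j * Q z)" for j
  proof -
    have "vanishes (Suc d) (\<lambda>z. (\<psi> ^^ j) z - flow \<psi> K (real j) z)"
      by (rule vanishes_mono[OF flow_nat]) (use d in auto)
    from vanishes_diff[OF iter[of j] vanishes_compose_cong[OF f this vanishes_1_funpow vanishes_1_flow]]
    show ?thesis by (simp add: algebra_simps)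
  qed
  show ?thesis
  proof (rule vanishes_derivative_of_poly_fun[where f = "\<lambda>z t. f (flow \<psi> K t z) - f z + t * Q z" and M = "max M 1", OF _ nat])
    show "\<forall>\<^sub>F z in nhds 0. poly_fun (max M 1) (\<lambda>t. f (flow \<psi> K t z) - f z + t * Q z) \<and>
      ((\<lambda>t. f (flow \<psi> K t z) - f z + t * Q z) has_real_derivative fderiv f z (generator \<psi> K z) + Q z) (at 0)"
      using smooth_germ_derivative[OF f]
    proof eventually_elim
      case (elim z)
      have poly_fun_z: "poly_fun (max M 1) (\<lambda>t. f (flow \<psi> K t z) - f z + t * Q z)"
        unfolding flow_def
        by (intro poly_fun_add poly_fun_diff poly_fun_const poly_fun_mono[OF poly])
          (use poly_fun_mono[OF poly_fun_cmult[OF poly_fun_ident, of "Q z"], of "max M 1"] in \<open>simp_all add: mult.commute\<close>)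
      have f_flow: "((\<lambda>t. f (flow \<psi> K t z)) has_real_derivative fderiv f z (generator \<psi> K z)) (at 0)"
      proof -
        have fl: "((\<lambda>t. flow \<psi> K t z) has_derivative (\<lambda>s. s *\<^sub>R generator \<psi> K z)) (at 0)"
          using sum_gchoose_has_vector_derivative unfolding flow_def generator_def has_vector_derivative_def .
        have "flow \<psi> K 0 z = z" unfolding flow_def sum_gchoose_at_0 by simp
        then have "(f has_derivative fderiv f z) (at (flow \<psi> K 0 z))" using elim by simp
        from has_derivative_compose[OF fl this]
        have "((\<lambda>t. f (flow \<psi> K t z)) has_derivative (\<lambda>s. fderiv f z (s *\<^sub>R generator \<psi> K z))) (at 0)" .
        moreover have "(\<lambda>s. fderiv f z (s *\<^sub>R generator \<psi> K z)) = (*) (fderiv f z (generator \<psi> K z))"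
          by (rule ext) (simp only: linear_scale[OF has_derivative_linear[OF elim]] real_scaleR_def mult.commute)
        ultimately show ?thesis unfolding has_field_derivative_def by (rule back_subst)
      qed
      from DERIV_add[OF DERIV_diff[OF f_flow DERIV_const[of "f z"]] DERIV_cmult_right[OF DERIV_ident, of "Q z"]]
      have "((\<lambda>t. f (flow \<psi> K t z) - f z + t * Q z) has_real_derivative fderiv f z (generator \<psi> K z) + Q z) (at 0)"
        by simp
      with poly_fun_z show ?case by blast
    qed
  qed
qed

end

section \<open>Symplectic germs\<close>

lemma symplectic_form_alt: "symplectic_form a b = snd a \<bullet> fst b - fst a \<bullet> snd b"
  by (simp add: symplectic_form_def case_prod_beta)

lemma bounded_bilinear_symplectic_form: "bounded_bilinear (symplectic_form :: 'n::finite phase \<Rightarrow> _)"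
  unfolding bilinear_conv_bounded_bilinear[symmetric] bilinear_def
  by (auto intro!: linearI simp: symplectic_form_alt inner_simps algebra_simps)

lemma symplectic_form_skew: "symplectic_form a b = - symplectic_form b a"
  by (simp add: symplectic_form_alt inner_commute)

definition symplectic_map :: "('n::finite phase \<Rightarrow> 'n phase) \<Rightarrow> bool" where
  "symplectic_map L \<longleftrightarrow> (\<forall>v w. symplectic_form (L v) (L w) = symplectic_form v w)"

lemma symplectic_mapD: "symplectic_map L \<Longrightarrow> symplectic_form (L v) (L w) = symplectic_form v w"
  unfolding symplectic_map_def by blast

lemma symplectic_map_compose: "symplectic_map L \<Longrightarrow> symplectic_map M \<Longrightarrow> symplectic_map (\<lambda>v. L (M v))"
  unfolding symplectic_map_def by metis

lemma symplectic_map_funpow: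
  fixes \<psi> :: "'n::finite phase \<Rightarrow> 'n phase"
  assumes "smooth_germ \<psi>" "\<psi> 0 = 0" "\<forall>\<^sub>F z in nhds 0. symplectic_map (fderiv \<psi> z)"
  shows "\<forall>\<^sub>F z in nhds 0. symplectic_map (fderiv (\<psi> ^^ j) z)"
proof (induction j)
  case 0
  have "fderiv (\<psi> ^^ 0) z = (\<lambda>h. h)" for z
    using frechet_derivative_at[OF has_derivative_ident] by (simp add: id_def)
  then show ?case by (simp add: symplectic_map_def)
next
  case (Suc j)
  have z: "(\<psi> ^^ i) 0 = 0" for i by (induction i) (auto simp: assms)
  have sm: "smooth_germ (\<psi> ^^ j)" for j
  proof (induction j)
    case (Suc j)
    then show ?case using smooth_germ_compose[OF assms(1) Suc z] by (simp add: comp_def)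
  qed (simp add: smooth_germ_id id_def)
  have lim: "filterlim (\<psi> ^^ j) (nhds 0) (nhds 0)" by (rule smooth_germ_tendsto_0[OF sm z])
  have "\<forall>\<^sub>F z in nhds 0. (\<psi> has_derivative fderiv \<psi> ((\<psi> ^^ j) z)) (at ((\<psi> ^^ j) z))"
    using smooth_germ_derivative[OF assms(1)] lim by (rule eventually_compose_filterlim)
  moreover have "\<forall>\<^sub>F z in nhds 0. symplectic_map (fderiv \<psi> ((\<psi> ^^ j) z))"
    using assms(3) lim by (rule eventually_compose_filterlim)
  ultimately show ?case using Suc smooth_germ_derivative[OF sm, of j]
  proof eventually_elim
    case (elim z)
    from has_derivative_compose[OF elim(4) elim(1)]
    have "fderiv (\<lambda>z. \<psi> ((\<psi> ^^ j) z)) z = (\<lambda>v. fderiv \<psi> ((\<psi> ^^ j) z) (fderiv (\<psi> ^^ j) z v))"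
      by (rule frechet_derivative_at[symmetric])
    with symplectic_map_compose[OF elim(2,3)] show ?case by (simp add: comp_def)
  qed
qed

text \<open>The defect of symplecticity of the derivative of \<open>flow \<psi> K t\<close> is a
  polynomial in \<open>t\<close> of degree at most \<open>2 * K\<close>. At integer times it is
  small, since the iterates are symplectic; its derivative at 0 is the defect claimed here, because
  \<open>flow\<close> is the identity at time 0.\<close>

lemma generator_infinitesimally_symplectic:
  fixes \<psi> :: "'n::finite phase \<Rightarrow> 'n phase"
  assumes smooth: "smooth_germ \<psi>" and zero: "\<psi> 0 = 0" and tangent: "vanishes 2 (\<lambda>z. \<psi> z - z)"
    and symp: "\<forall>\<^sub>F z in nhds 0. symplectic_map (fderiv \<psi> z)"
  shows "vanishes (Suc K) (\<lambda>z. symplectic_form (fderiv (generator \<psi> K) z v) w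
    + symplectic_form v (fderiv (generator \<psi> K) z w))"
proof -
  note ctx = smooth zero tangent
  let ?D = "\<lambda>k z v. fderiv (fdiff \<psi> k (\<lambda>z. z)) z v"
  let ?S = "\<lambda>t z v. \<Sum>k\<le>K. (t gchoose k) *\<^sub>R ?D k z v"
  interpret bounded_bilinear "symplectic_form :: 'n phase \<Rightarrow> _" by (rule bounded_bilinear_symplectic_form)
  have ev: "\<forall>\<^sub>F z in nhds 0. \<forall>k\<in>{..K}. (fdiff \<psi> k (\<lambda>z. z) has_derivative ?D k z) (at z)"
    by (intro eventually_ball_finite ballI smooth_germ_derivative smooth_germ_fdiff_id[OF ctx]) auto
  have ev_flow: "\<forall>\<^sub>F z in nhds 0. fderiv (flow \<psi> K t) z = ?S t z" for t
    using ev
  proof eventually_elim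
    case (elim z)
    have "(flow \<psi> K t has_derivative ?S t z) (at z)"
      unfolding flow_def [abs_def] by (intro has_derivative_sum has_derivative_scaleR_right) (use elim in auto)
    then show ?case by (simp add: frechet_derivative_at[symmetric])
  qed
  show ?thesis
  proof (rule vanishes_derivative_of_poly_fun)
    show "\<forall>\<^sub>F z in nhds 0. poly_fun (K + K) (\<lambda>t. symplectic_form (?S t z v) (?S t z w) - symplectic_form v w) \<and>
      ((\<lambda>t. symplectic_form (?S t z v) (?S t z w) - symplectic_form v w) has_real_derivative
        symplectic_form (fderiv (generator \<psi> K) z v) w + symplectic_form v (fderiv (generator \<psi> K) z w)) (at 0)"
      using ev
    proof eventually_elim
      case (elim z)
      have gen: "fderiv (generator \<psi> K) z = (\<lambda>v. \<Sum>k\<le>K. gchoose_deriv k *\<^sub>R ?D k z v)"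
      proof -
        have "(generator \<psi> K has_derivative (\<lambda>v. \<Sum>k\<le>K. gchoose_deriv k *\<^sub>R ?D k z v)) (at z)"
          unfolding generator_def [abs_def] by (intro has_derivative_sum has_derivative_scaleR_right) (use elim in auto)
        then show ?thesis by (simp add: frechet_derivative_at[symmetric])
      qed
      have S0: "?S 0 z v = v" for v
        unfolding sum_gchoose_at_0 using frechet_derivative_at[OF has_derivative_ident, of z] by simp
      have "poly_fun (K + K) (\<lambda>t. \<Sum>k\<le>K. \<Sum>l\<le>K. symplectic_form (?D l z v) (?D k z w) * ((t gchoose l) * (t gchoose k)))"
        by (intro poly_fun_sum poly_fun_cmult poly_fun_mult poly_fun_mono[OF poly_fun_gchoose]) auto
      then have "poly_fun (K + K) (\<lambda>t. symplectic_form (?S t z v) (?S t z w))"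
        by (simp add: sum_left sum_right scaleR_left scaleR_right sum_distrib_left mult_ac)
      then have 1: "poly_fun (K + K) (\<lambda>t. symplectic_form (?S t z v) (?S t z w) - symplectic_form v w)"
        by (intro poly_fun_diff poly_fun_const)
      have "((\<lambda>t. symplectic_form (?S t z v) (?S t z w)) has_vector_derivative
          symplectic_form (?S 0 z v) (fderiv (generator \<psi> K) z w) + symplectic_form (fderiv (generator \<psi> K) z v) (?S 0 z w)) (at 0)"
        unfolding gen by (intro has_vector_derivative sum_gchoose_has_vector_derivative)
      then have "((\<lambda>t. symplectic_form (?S t z v) (?S t z w) - symplectic_form v w) has_real_derivative
        symplectic_form (fderiv (generator \<psi> K) z v) w + symplectic_form v (fderiv (generator \<psi> K) z w)) (at 0)"
        unfolding S0 has_real_derivative_iff_has_vector_derivative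
        by (auto intro!: derivative_eq_intros)
      with 1 show ?case by blast
    qed
    fix j :: nat
    let ?E = "\<lambda>z v. fderiv (\<lambda>z. (\<psi> ^^ j) z - flow \<psi> K (real j) z) z v"
    have smE: "smooth_germ (\<lambda>z. (\<psi> ^^ j) z - flow \<psi> K (real j) z)"
      by (intro smooth_germ_diff smooth_germ_funpow smooth_germ_flow ctx)
    \<comment> \<open>\<open>flow_nat\<close> gives order \<open>K + 2\<close>; differentiating
      costs one.\<close>
    have vE: "vanishes (Suc K) (\<lambda>z. ?E z v)" for v
      using vanishes_fderiv[OF smE flow_nat[OF ctx]] by simp
    have vP: "vanishes 0 (\<lambda>z. fderiv (\<psi> ^^ j) z v)" for v
      by (intro vanishes_0_smooth smooth_germ_fderiv smooth_germ_funpow ctx)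
    \<comment> \<open>With P the derivative of the iterate and E the error, this is the expansion of
      omega(P v - E v, P w - E w) - omega(P v, P w). The subtracted term equals omega(v, w), since P
      is symplectic.\<close>
    have "vanishes (Suc K) (\<lambda>z. - symplectic_form (?E z v) (fderiv (\<psi> ^^ j) z w)
        - symplectic_form (fderiv (\<psi> ^^ j) z v) (?E z w) + symplectic_form (?E z v) (?E z w))"
    proof (intro vanishes_add vanishes_diff vanishes_minus)
      show "vanishes (Suc K) (\<lambda>z. symplectic_form (?E z v) (fderiv (\<psi> ^^ j) z w))"
        using vanishes_bilinear[OF bounded_bilinear_symplectic_form vE vP, of v w] by simp
      show "vanishes (Suc K) (\<lambda>z. symplectic_form (fderiv (\<psi> ^^ j) z v) (?E z w))"
        using vanishes_bilinear[OF bounded_bilinear_symplectic_form vP vE, of v w] by simp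
      show "vanishes (Suc K) (\<lambda>z. symplectic_form (?E z v) (?E z w))"
        using vanishes_bilinear[OF bounded_bilinear_symplectic_form vE vE, of v w] by (rule vanishes_mono) simp
    qed
    moreover have "\<forall>\<^sub>F z in nhds 0. - symplectic_form (?E z v) (fderiv (\<psi> ^^ j) z w)
        - symplectic_form (fderiv (\<psi> ^^ j) z v) (?E z w) + symplectic_form (?E z v) (?E z w)
      = symplectic_form (?S (real j) z v) (?S (real j) z w) - symplectic_form v w"
      using ev_flow[of "real j"] symplectic_map_funpow[OF smooth zero symp, of j]
        smooth_germ_derivative[OF smooth_germ_funpow[OF ctx, of j]]
        smooth_germ_derivative[OF smooth_germ_flow[OF ctx, of K "real j"]]
    proof eventually_elim
      case (elim z)
      have E: "?E z v = fderiv (\<psi> ^^ j) z v - ?S (real j) z v" for v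
        using has_derivative_diff[OF elim(3,4)] elim(1) by (simp add: frechet_derivative_at[symmetric])
      have "symplectic_form (fderiv (\<psi> ^^ j) z v) (fderiv (\<psi> ^^ j) z w) = symplectic_form v w"
        by (rule symplectic_mapD[OF elim(2)])
      then show ?case unfolding E by (simp add: diff_left diff_right algebra_simps)
    qed
    ultimately show "vanishes (Suc K) (\<lambda>z. symplectic_form (?S (real j) z v) (?S (real j) z w) - symplectic_form v w)"
      by (rule vanishes_cong[rotated])
  qed
qed

section \<open>Inverses of canonical transformations\<close>

text \<open>The standard complex structure, which turns the symplectic form into the inner
  product.\<close>

definition sympl_rot :: "'n::finite phase \<Rightarrow> 'n phase" where
  "sympl_rot z = (snd z, - fst z)"

lemma symplectic_form_sympl_rot: "symplectic_form a (sympl_rot b) = a \<bullet> b"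
  by (simp add: symplectic_form_alt sympl_rot_def inner_prod_def)

text \<open>The inverse of a symplectic linear map is its adjoint with respect to the symplectic form,
  hence depends linearly on it.\<close>

definition sympl_adjoint :: "('n::finite phase \<Rightarrow> 'n phase) \<Rightarrow> 'n phase \<Rightarrow> 'n phase" where
  "sympl_adjoint M v = (\<Sum>b\<in>Basis. symplectic_form v (M (sympl_rot b)) *\<^sub>R b)"

lemma sympl_adjoint_inverse:
  fixes M :: "'n::finite phase \<Rightarrow> 'n phase"
  assumes "linear M" "symplectic_map M"
  shows "sympl_adjoint M (M w) = w" "M (sympl_adjoint M v) = v"
proof -
  show 1: "sympl_adjoint M (M w) = w" for w
    unfolding sympl_adjoint_def symplectic_mapD[OF assms(2)] symplectic_form_sympl_rot
    by (rule euclidean_representation)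
  \<comment> \<open>In finite dimension a linear map with a left inverse is surjective, so the left
    inverse is two-sided.\<close>
  have "inj M" by (rule inj_on_inverseI[of _ "sympl_adjoint M"]) (rule 1)
  then have "surj M" using assms(1) linear_injective_imp_surjective by blast
  then obtain w where "v = M w" by blast
  then show "M (sympl_adjoint M v) = v" by (simp add: 1)
qed

text \<open>Injectivity is part of \<open>canonical_on\<close>, so the inverse exists on the image,
  which is open by invariance of domain. Its derivative is the symplectic adjoint of the derivative
  of \<open>\<phi>\<close>; this gives smoothness and shows that the inverse is symplectic
  too.\<close>

lemma canonical_local_inverse:
  fixes \<phi> :: "'n::finite phase \<Rightarrow> 'n phase"
  assumes U: "open U" "0 \<in> U" and \<phi>: "canonical_on U \<phi>" "\<phi> 0 = 0" "(\<phi> has_derivative id) (at 0)"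
  obtains \<rho> where "smooth_germ \<rho>" "\<rho> 0 = 0" "(\<rho> has_derivative id) (at 0)"
    "\<forall>\<^sub>F y in nhds 0. symplectic_map (fderiv \<rho> y)" "\<forall>\<^sub>F y in nhds 0. \<phi> (\<rho> y) = y"
proof -
  have sm: "smooth_on \<phi> U" and inj: "inj_on \<phi> U" and symp: "\<And>z. z \<in> U \<Longrightarrow> symplectic_map (fderiv \<phi> z)"
    using \<phi>(1) unfolding canonical_on_def symplectic_map_def by blast+
  have D: "(\<phi> has_derivative fderiv \<phi> z) (at z)" if "z \<in> U" for z
    by (rule smooth_on_derivative[OF U(1) sm that])
  define \<rho> where "\<rho> = inv_into U \<phi>"
  define V where "V = \<phi> ` U"
  have V: "open V" "0 \<in> V"
    unfolding V_def using invariance_of_domain[OF smooth_on_continuous[OF sm] U(1) inj] U(2) \<phi>(2)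
    by (auto intro: rev_image_eqI)
  have \<rho>: "\<rho> (\<phi> z) = z" if "z \<in> U" for z
    unfolding \<rho>_def using inv_into_f_f[OF inj that] .
  have \<rho>': "\<phi> (\<rho> y) = y" "\<rho> y \<in> U" if "y \<in> V" for y
    using that \<rho> unfolding V_def by auto
  have lin: "linear (fderiv \<phi> z)" if "z \<in> U" for z
    using has_derivative_linear[OF D[OF that]] .
  have D\<rho>: "(\<rho> has_derivative sympl_adjoint (fderiv \<phi> (\<rho> y))) (at y)" if y: "y \<in> V" for y
  proof -
    have "(\<rho> has_derivative sympl_adjoint (fderiv \<phi> (\<rho> y))) (at (\<phi> (\<rho> y)))"
    proof (rule has_derivative_inverse_strong[OF U(1) \<rho>'(2)[OF y] smooth_on_continuous[OF sm]])
      show "fderiv \<phi> (\<rho> y) \<circ> sympl_adjoint (fderiv \<phi> (\<rho> y)) = id"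
        unfolding comp_def id_def
        by (rule ext, rule sympl_adjoint_inverse(2)[OF lin[OF \<rho>'(2)[OF y]] symp[OF \<rho>'(2)[OF y]]])
    qed (use \<rho> D \<rho>'(2)[OF y] in auto)
    then show ?thesis using \<rho>'(1)[OF y] by simp
  qed
  \<comment> \<open>Bootstrapping: the derivative of \<open>\<rho>\<close> at \<open>y\<close>
    depends linearly on that of \<open>\<phi>\<close> at \<open>\<rho> y\<close>, so it is as
    regular as \<open>\<rho>\<close>, and \<open>\<rho>\<close> is one degree better.\<close>
  have ck: "Ck_on k \<rho> V" for k
  proof (induction k)
    case 0
    have "continuous_on V \<rho>"
      unfolding continuous_on_eq_continuous_at[OF V(1)] using D\<rho> has_derivative_continuous by blast
    then show ?case by simp
  next
    case (Suc k)
    show ?case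
    proof (rule Ck_on_SucI[OF V(1) D\<rho>])
      fix v
      have "Ck_on k (\<lambda>y. symplectic_form v (fderiv \<phi> (\<rho> y) w)) V" for w
      proof (rule Ck_on_bilinear[OF V(1) bounded_bilinear_symplectic_form Ck_on_const[OF V(1)]])
        have "Ck_on k (\<lambda>x. fderiv \<phi> x w) U" using smooth_on_fderiv[OF sm] unfolding smooth_on_def by blast
        then show "Ck_on k (\<lambda>y. fderiv \<phi> (\<rho> y) w) V"
          by (rule Ck_on_compose[OF V(1) U(1) _ Suc]) (use \<rho>' in auto)
      qed
      then show "Ck_on k (\<lambda>y. sympl_adjoint (fderiv \<phi> (\<rho> y)) v) V"
        unfolding sympl_adjoint_def
        by (intro Ck_on_sum[OF V(1)] Ck_on_bilinear[OF V(1) bounded_bilinear_scaleR] Ck_on_const[OF V(1)])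
    qed
  qed
  show thesis
  proof (rule that)
    show "smooth_germ \<rho>" unfolding smooth_germ_def smooth_on_def using V ck by blast
    show 0: "\<rho> 0 = 0" using \<rho>[OF U(2)] \<phi>(2) by simp
    have id: "fderiv \<phi> 0 = id" using frechet_derivative_at[OF \<phi>(3)] by simp
    have "sympl_adjoint id = (id :: 'n phase \<Rightarrow> 'n phase)"
    proof (rule ext)
      show "sympl_adjoint id v = id v" for v :: "'n phase"
        using sympl_adjoint_inverse(1)[OF linear_id, of v] by (simp add: symplectic_map_def)
    qed
    then show "(\<rho> has_derivative id) (at 0)" using D\<rho>[OF V(2)] unfolding 0 id by simp
    have "symplectic_map (fderiv \<rho> y)" if y: "y \<in> V" for y
    proof -
      have "fderiv \<rho> y = sympl_adjoint (fderiv \<phi> (\<rho> y))"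
        using frechet_derivative_at[OF D\<rho>[OF y]] by simp
      moreover have "symplectic_form (sympl_adjoint (fderiv \<phi> (\<rho> y)) v) (sympl_adjoint (fderiv \<phi> (\<rho> y)) w) = symplectic_form v w" for v w
        using symplectic_mapD[OF symp[OF \<rho>'(2)[OF y]], of "sympl_adjoint (fderiv \<phi> (\<rho> y)) v" "sympl_adjoint (fderiv \<phi> (\<rho> y)) w"]
          sympl_adjoint_inverse(2)[OF lin symp] \<rho>'(2)[OF y] by simp
      ultimately show ?thesis unfolding symplectic_map_def by simp
    qed
    then show "\<forall>\<^sub>F y in nhds 0. symplectic_map (fderiv \<rho> y)"
      unfolding eventually_nhds using V by blast
    show "\<forall>\<^sub>F y in nhds 0. \<phi> (\<rho> y) = y"
      unfolding eventually_nhds using V \<rho>' by blast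
  qed
qed

section \<open>Loop integrals of nearly closed one-forms\<close>

text \<open>The assumption gives a separate constant for each pair of directions. Along a loop both
  directions vary, so bilinearity is used to obtain one constant from the finitely many pairs of
  basis vectors.\<close>

lemma symplectic_bound_uniform:
  fixes X :: "'n::finite phase \<Rightarrow> 'n phase"
  assumes sm: "smooth_germ X"
    and van: "\<And>v w. vanishes b (\<lambda>z. symplectic_form (fderiv X z v) w + symplectic_form v (fderiv X z w))"
  obtains C e where "C \<ge> 0" "e > 0" "smooth_on X (ball 0 e)"
    "\<And>z v w. norm z < e \<Longrightarrow>
      \<bar>symplectic_form (fderiv X z v) w + symplectic_form v (fderiv X z w)\<bar> \<le> C * norm z ^ b * (norm v * norm w)"
proof -
  interpret bounded_bilinear "symplectic_form :: 'n phase \<Rightarrow> _" by (rule bounded_bilinear_symplectic_form)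
  let ?B = "\<lambda>z v w. symplectic_form (fderiv X z v) w + symplectic_form v (fderiv X z w)"
  have "vanishes b (\<lambda>z. \<Sum>v\<in>Basis. \<Sum>w\<in>Basis. norm (?B z v w))"
    by (intro vanishes_sum vanishes_norm van)
  then obtain C e where C0: "C \<ge> 0" "e > 0" "e \<le> 1"
    "\<And>z. norm z < e \<Longrightarrow> norm (\<Sum>v\<in>Basis. \<Sum>w\<in>Basis. norm (?B z v w)) \<le> C * norm z ^ b"
    using vanishesE by blast
  have C: "(\<Sum>v\<in>Basis. \<Sum>w\<in>Basis. \<bar>?B z v w\<bar>) \<le> C * norm z ^ b" if "norm z < e" for z
    using C0(4)[OF that] by (simp add: sum_nonneg)
  obtain d where d: "d > 0" "smooth_on X (ball 0 d)" using smooth_germE[OF sm] by blast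
  show thesis
  proof (rule that[of C "min d e"])
    fix z v w :: "'n phase" assume z: "norm z < min d e"
    have "z \<in> ball 0 d" using z by simp
    note lin = has_derivative_linear[OF smooth_on_derivative[OF open_ball d(2) this]]
    have lin1: "linear (\<lambda>v. ?B z v w)" for w
      by (rule linearI) (simp_all add: linear_add[OF lin] linear_scale[OF lin] add_left scaleR_left algebra_simps)
    have lin2: "linear (\<lambda>w. ?B z v w)" for v
      by (rule linearI) (simp_all add: linear_add[OF lin] linear_scale[OF lin] add_right scaleR_right algebra_simps)
    have "?B z v w = (\<Sum>i\<in>Basis. (v \<bullet> i) *\<^sub>R ?B z i w)" by (rule linear_sum_Basis[OF lin1])
    also have "\<dots> = (\<Sum>i\<in>Basis. (v \<bullet> i) *\<^sub>R (\<Sum>j\<in>Basis. (w \<bullet> j) *\<^sub>R ?B z i j))"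
      by (intro sum.cong refl arg_cong2[where f = "(*\<^sub>R)"] linear_sum_Basis[OF lin2])
    finally have "\<bar>?B z v w\<bar> \<le> (\<Sum>i\<in>Basis. \<bar>(v \<bullet> i) *\<^sub>R (\<Sum>j\<in>Basis. (w \<bullet> j) *\<^sub>R ?B z i j)\<bar>)"
      by (simp only: sum_abs)
    also have "\<dots> \<le> (\<Sum>i\<in>Basis. \<Sum>j\<in>Basis. norm v * norm w * \<bar>?B z i j\<bar>)"
    proof (rule sum_mono)
      fix i :: "'n phase" assume i: "i \<in> Basis"
      have "\<bar>(v \<bullet> i) *\<^sub>R (\<Sum>j\<in>Basis. (w \<bullet> j) *\<^sub>R ?B z i j)\<bar> = \<bar>v \<bullet> i\<bar> * \<bar>\<Sum>j\<in>Basis. (w \<bullet> j) *\<^sub>R ?B z i j\<bar>"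
        by (simp add: abs_mult)
      also have "\<dots> \<le> norm v * (\<Sum>j\<in>Basis. \<bar>(w \<bullet> j) *\<^sub>R ?B z i j\<bar>)"
        by (intro mult_mono sum_abs Basis_le_norm i) auto
      also have "(\<Sum>j\<in>Basis. \<bar>(w \<bullet> j) *\<^sub>R ?B z i j\<bar>) \<le> (\<Sum>j\<in>Basis. norm w * \<bar>?B z i j\<bar>)"
        by (intro sum_mono) (simp add: abs_mult Basis_le_norm mult_right_mono)
      finally show "\<bar>(v \<bullet> i) *\<^sub>R (\<Sum>j\<in>Basis. (w \<bullet> j) *\<^sub>R ?B z i j)\<bar> \<le> (\<Sum>j\<in>Basis. norm v * norm w * \<bar>?B z i j\<bar>)"
        by (simp add: sum_distrib_left mult_left_mono mult.assoc)
    qed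
    also have "\<dots> = (\<Sum>i\<in>Basis. \<Sum>j\<in>Basis. \<bar>?B z i j\<bar>) * (norm v * norm w)"
      by (simp add: sum_distrib_left sum_distrib_right mult_ac)
    also have "\<dots> \<le> C * norm z ^ b * (norm v * norm w)"
      using z by (intro mult_right_mono C) auto
    finally show "\<bar>?B z v w\<bar> \<le> C * norm z ^ b * (norm v * norm w)" .
  qed (use C0 d in \<open>auto intro: smooth_on_subset\<close>)
qed

text \<open>Stokes' theorem on the cone over the loop: the form \<open>symplectic_form X\<close> is nearly closed.\<close>

lemma loop_integral_bound:
  fixes X :: "'n::finite phase \<Rightarrow> 'n phase"
  assumes sm: "smooth_germ X"
    and van: "\<And>v w. vanishes b (\<lambda>z. symplectic_form (fderiv X z v) w + symplectic_form v (fderiv X z w))"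
    and T: "T > 0"
  obtains C e where "C \<ge> 0" "e > 0" "smooth_on X (ball 0 e)"
    "\<And>\<gamma> \<gamma>' r. \<lbrakk>\<And>t. (\<gamma> has_vector_derivative \<gamma>' t) (at t); continuous_on UNIV \<gamma>'; \<gamma> T = \<gamma> 0;
       \<And>t. norm (\<gamma> t) \<le> r; \<And>t. norm (\<gamma>' t) \<le> r; r < e\<rbrakk>
       \<Longrightarrow> \<bar>integral {0..T} (\<lambda>t. symplectic_form (X (\<gamma> t)) (\<gamma>' t))\<bar> \<le> C * r ^ (b + 2)"
proof -
  interpret bounded_bilinear "symplectic_form :: 'n phase \<Rightarrow> _" by (rule bounded_bilinear_symplectic_form)
  obtain C e where C: "C \<ge> 0" "e > 0" and smX: "smooth_on X (ball 0 e)"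
    and bound: "\<And>z v w. norm z < e \<Longrightarrow>
      \<bar>symplectic_form (fderiv X z v) w + symplectic_form v (fderiv X z w)\<bar> \<le> C * norm z ^ b * (norm v * norm w)"
    using symplectic_bound_uniform[OF sm van] by blast
  show thesis
  proof (rule that[of "C * T" e])
    fix \<gamma> \<gamma>' :: "real \<Rightarrow> 'n phase" and r :: real
    assume d\<gamma>: "\<And>t. (\<gamma> has_vector_derivative \<gamma>' t) (at t)" and c\<gamma>': "continuous_on UNIV \<gamma>'" and per: "\<gamma> T = \<gamma> 0"
      and r: "\<And>t. norm (\<gamma> t) \<le> r" "\<And>t. norm (\<gamma>' t) \<le> r" "r < e"
    have r0: "r \<ge> 0" using r(1)[of 0] norm_ge_zero order.trans by blast
    have c\<gamma>: "continuous_on UNIV \<gamma>"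
      using d\<gamma> by (meson continuous_at_imp_continuous_on has_vector_derivative_continuous)
    have in_ball: "\<tau> *\<^sub>R \<gamma> t \<in> ball 0 e" "norm (\<tau> *\<^sub>R \<gamma> t) \<le> r" if "0 \<le> \<tau>" "\<tau> \<le> 1" for \<tau> t
    proof -
      have "norm (\<tau> *\<^sub>R \<gamma> t) \<le> norm (\<gamma> t)" using that by (simp add: mult_left_le_one_le)
      then show "\<tau> *\<^sub>R \<gamma> t \<in> ball 0 e" "norm (\<tau> *\<^sub>R \<gamma> t) \<le> r" using r(1)[of t] r(3) by auto
    qed
    have DX: "(X has_derivative fderiv X z) (at z)" if "z \<in> ball 0 e" for z
      by (rule smooth_on_derivative[OF open_ball smX that])
    note linX = has_derivative_linear[OF DX]
    \<comment> \<open>On the cone \<open>\<tau> *\<^sub>R \<gamma> t\<close> the one-form has the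
      components omega(X, \<gamma>) and \<tau> omega(X, \<gamma>') in the directions \<tau> and t.
      \<open>At\<close> is the t-derivative of the first and \<open>Bt\<close> the \<tau>-derivative
      of the second, so their difference is the exterior derivative pulled back to the cone.\<close>
    define At where "At \<tau> t = symplectic_form (fderiv X (\<tau> *\<^sub>R \<gamma> t) (\<tau> *\<^sub>R \<gamma>' t)) (\<gamma> t)
        + symplectic_form (X (\<tau> *\<^sub>R \<gamma> t)) (\<gamma>' t)" for \<tau> t
    define Bt where "Bt \<tau> t = symplectic_form (X (\<tau> *\<^sub>R \<gamma> t)) (\<gamma>' t)
        + \<tau> * symplectic_form (fderiv X (\<tau> *\<^sub>R \<gamma> t) (\<gamma> t)) (\<gamma>' t)" for \<tau> t
    have dA: "((\<lambda>t. symplectic_form (X (\<tau> *\<^sub>R \<gamma> t)) (\<gamma> t)) has_vector_derivative At \<tau> t) (at t)"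
      if \<tau>: "0 \<le> \<tau>" "\<tau> \<le> 1" for \<tau> t
    proof -
      have "((\<lambda>t. \<tau> *\<^sub>R \<gamma> t) has_vector_derivative \<tau> *\<^sub>R \<gamma>' t) (at t)"
        using bounded_linear.has_vector_derivative[OF bounded_linear_scaleR_right d\<gamma>] .
      then have "((\<lambda>t. \<tau> *\<^sub>R \<gamma> t) has_derivative (\<lambda>s. s *\<^sub>R \<tau> *\<^sub>R \<gamma>' t)) (at t)"
        unfolding has_vector_derivative_def .
      from has_derivative_compose[OF this DX[OF in_ball(1)[OF \<tau>]]]
      have "((\<lambda>t. X (\<tau> *\<^sub>R \<gamma> t)) has_vector_derivative fderiv X (\<tau> *\<^sub>R \<gamma> t) (\<tau> *\<^sub>R \<gamma>' t)) (at t)"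
        unfolding has_vector_derivative_def linear_scale[OF linX[OF in_ball(1)[OF \<tau>]]] .
      from has_vector_derivative[OF this d\<gamma>] show ?thesis unfolding At_def by (simp add: add.commute)
    qed
    have dB: "((\<lambda>\<tau>. \<tau> *\<^sub>R symplectic_form (X (\<tau> *\<^sub>R \<gamma> t)) (\<gamma>' t)) has_vector_derivative Bt \<tau> t) (at \<tau>)"
      if \<tau>: "0 \<le> \<tau>" "\<tau> \<le> 1" for \<tau> t
    proof -
      have "((\<lambda>\<tau>. \<tau> *\<^sub>R \<gamma> t) has_derivative (\<lambda>s. s *\<^sub>R \<gamma> t)) (at \<tau>)"
        by (auto intro!: derivative_eq_intros)
      from has_derivative_compose[OF this DX[OF in_ball(1)[OF \<tau>]]]
      have "((\<lambda>\<tau>. X (\<tau> *\<^sub>R \<gamma> t)) has_vector_derivative fderiv X (\<tau> *\<^sub>R \<gamma> t) (\<gamma> t)) (at \<tau>)"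
        unfolding has_vector_derivative_def linear_scale[OF linX[OF in_ball(1)[OF \<tau>]]] .
      from has_vector_derivative_scaleR[OF DERIV_ident has_vector_derivative[OF this has_vector_derivative_const[of "\<gamma>' t"]]]
      show ?thesis unfolding Bt_def by (simp add: add.commute zero_right)
    qed
    \<comment> \<open>The terms without a derivative of \<open>X\<close> cancel; by skew symmetry
      the rest is \<open>\<tau>\<close> times the closedness defect for the pair
      \<open>\<gamma>'\<close>, \<open>\<gamma>\<close>. Each of these vectors contributes one
      factor \<open>r\<close>, whence the exponent \<open>b + 2\<close>.\<close>
    have diff: "\<bar>At \<tau> t - Bt \<tau> t\<bar> \<le> C * r ^ (b + 2)" if \<tau>: "0 \<le> \<tau>" "\<tau> \<le> 1" for \<tau> t
    proof -
      let ?z = "\<tau> *\<^sub>R \<gamma> t"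
      have "At \<tau> t - Bt \<tau> t = \<tau> * (symplectic_form (fderiv X ?z (\<gamma>' t)) (\<gamma> t) + symplectic_form (\<gamma>' t) (fderiv X ?z (\<gamma> t)))"
        unfolding At_def Bt_def linear_scale[OF linX[OF in_ball(1)[OF \<tau>]]]
        using symplectic_form_skew[of "\<gamma>' t" "fderiv X ?z (\<gamma> t)"] by (simp add: scaleR_left algebra_simps)
      then have "\<bar>At \<tau> t - Bt \<tau> t\<bar> = \<tau> * \<bar>symplectic_form (fderiv X ?z (\<gamma>' t)) (\<gamma> t) + symplectic_form (\<gamma>' t) (fderiv X ?z (\<gamma> t))\<bar>"
        using \<tau> by (simp add: abs_mult)
      also have "\<dots> \<le> 1 * (C * norm ?z ^ b * (norm (\<gamma>' t) * norm (\<gamma> t)))"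
        using \<tau> in_ball(1)[OF \<tau>, of t] by (intro mult_mono bound) auto
      also have "\<dots> \<le> 1 * (C * r ^ b * (r * r))"
        using C r0 r in_ball(2)[OF \<tau>, of t] by (intro mult_mono mult_left_mono power_mono) auto
      finally show ?thesis by (simp add: power_add power2_eq_square mult_ac)
    qed
    have cont_DX: "continuous_on ({0..1} \<times> {0..T}) (\<lambda>(\<tau>, t). fderiv X (\<tau> *\<^sub>R \<gamma> t) v)" for v
    proof -
      have "continuous_on (ball 0 e) (\<lambda>z. fderiv X z v)" by (intro smooth_on_continuous smooth_on_fderiv smX)
      then show ?thesis unfolding case_prod_beta
        by (rule continuous_on_compose2[where f = "\<lambda>p. fst p *\<^sub>R \<gamma> (snd p)"])
          (use in_ball in \<open>auto intro!: continuous_intros continuous_on_compose2[OF c\<gamma>]\<close>)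
    qed
    have cont_X: "continuous_on ({0..1} \<times> {0..T}) (\<lambda>p. X (fst p *\<^sub>R \<gamma> (snd p)))"
      by (rule continuous_on_compose2[OF smooth_on_continuous[OF smX]])
        (use in_ball in \<open>auto intro!: continuous_intros continuous_on_compose2[OF c\<gamma>]\<close>)
    have cg: "continuous_on S (\<lambda>p. \<gamma> (snd p))" "continuous_on S (\<lambda>p. \<gamma>' (snd p))" for S :: "(real \<times> real) set"
      by (auto intro!: continuous_intros continuous_on_compose2[OF c\<gamma>] continuous_on_compose2[OF c\<gamma>'])
    have contB: "continuous_on ({0..1} \<times> {0..T}) (\<lambda>(\<tau>, t). Bt \<tau> t)"
    proof -
      have "fderiv X (fst p *\<^sub>R \<gamma> (snd p)) (\<gamma> (snd p)) = (\<Sum>v\<in>Basis. (\<gamma> (snd p) \<bullet> v) *\<^sub>R fderiv X (fst p *\<^sub>R \<gamma> (snd p)) v)"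
        if "p \<in> {0..1} \<times> {0..T}" for p
        by (rule linear_sum_Basis[OF linX[OF in_ball(1)]]) (use that in auto)
      moreover have "continuous_on ({0..1} \<times> {0..T}) (\<lambda>p. \<Sum>v\<in>Basis. (\<gamma> (snd p) \<bullet> v) *\<^sub>R fderiv X (fst p *\<^sub>R \<gamma> (snd p)) v)"
        using cont_DX unfolding case_prod_beta by (intro continuous_intros cg)
      ultimately have "continuous_on ({0..1} \<times> {0..T}) (\<lambda>p. fderiv X (fst p *\<^sub>R \<gamma> (snd p)) (\<gamma> (snd p)))"
        by (simp cong: continuous_on_cong)
      then show ?thesis unfolding Bt_def case_prod_beta
        by (intro continuous_on_add continuous_on_mult continuous_on cont_X cg continuous_on_fst continuous_on_id)
    qed
    have int1: "((\<lambda>\<tau>. Bt \<tau> t) has_integral symplectic_form (X (\<gamma> t)) (\<gamma>' t)) {0..1}" for t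
      using fundamental_theorem_of_calculus[OF zero_le_one,
          of "\<lambda>\<tau>. \<tau> *\<^sub>R symplectic_form (X (\<tau> *\<^sub>R \<gamma> t)) (\<gamma>' t)" "\<lambda>\<tau>. Bt \<tau> t"]
        has_vector_derivative_at_within[OF dB] by simp
    have intA: "(At \<tau> has_integral 0) {0..T}" if \<tau>: "0 \<le> \<tau>" "\<tau> \<le> 1" for \<tau>
      using fundamental_theorem_of_calculus[of 0 T "\<lambda>t. symplectic_form (X (\<tau> *\<^sub>R \<gamma> t)) (\<gamma> t)" "At \<tau>"]
        has_vector_derivative_at_within[OF dA[OF \<tau>]] T per by simp
    have intB: "\<bar>integral {0..T} (Bt \<tau>)\<bar> \<le> C * r ^ (b + 2) * T" if \<tau>: "0 \<le> \<tau>" "\<tau> \<le> 1" for \<tau>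
    proof -
      have "continuous_on {0..T} (\<lambda>t. (\<lambda>(\<tau>, t). Bt \<tau> t) (\<tau>, t))"
        by (rule continuous_on_compose2[OF contB]) (use \<tau> in \<open>auto intro!: continuous_intros\<close>)
      then have "continuous_on {0..T} (\<lambda>t. Bt \<tau> t)" by simp
      then have "(Bt \<tau> has_integral integral {0..T} (Bt \<tau>)) {0..T}"
        by (intro integrable_integral integrable_continuous_interval)
      from has_integral_diff[OF intA[OF \<tau>] this]
      have "((\<lambda>t. At \<tau> t - Bt \<tau> t) has_integral - integral {0..T} (Bt \<tau>)) (cbox 0 T)" by simp
      from has_integral_bound[OF _ this, of "C * r ^ (b + 2)"]
      show ?thesis using diff[OF \<tau>] C r0 T by simp
    qed
    \<comment> \<open>Integrating \<open>Bt\<close> over \<tau> returns the integrand on the loop.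
      After exchanging the integrals, \<open>Bt\<close> may be replaced by \<open>Bt - At\<close>,
      since \<open>At\<close> integrates to 0 over the closed loop.\<close>
    have "integral {0..T} (\<lambda>t. symplectic_form (X (\<gamma> t)) (\<gamma>' t)) = integral {0..T} (\<lambda>t. integral {0..1} (\<lambda>\<tau>. Bt \<tau> t))"
      using integral_unique[OF int1] by simp
    also have "\<dots> = integral {0..1} (\<lambda>\<tau>. integral {0..T} (Bt \<tau>))"
      using integral_swap_continuous[of 0 0 1 T Bt] contB by (simp add: cbox_Pair_eq)
    also have "\<bar>\<dots>\<bar> \<le> C * r ^ (b + 2) * T * (1 - 0)"
    proof -
      have "continuous_on {0..1} (\<lambda>\<tau>. integral (cbox 0 T) (Bt \<tau>))"
        using contB by (intro integral_continuous_on_param) simp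
      then show ?thesis
        using integral_bound[of 0 1 "\<lambda>\<tau>. integral {0..T} (Bt \<tau>)" "C * r ^ (b + 2) * T"] intB by simp
    qed
    finally show "\<bar>integral {0..T} (\<lambda>t. symplectic_form (X (\<gamma> t)) (\<gamma>' t))\<bar> \<le> C * T * r ^ (b + 2)"
      by (simp add: mult_ac)
  qed (use C T smX in auto)
qed

section \<open>Averages over tori\<close>

text \<open>An average without the factor 1/(2 pi), which is immaterial for showing that averages
  vanish. Iterating over a list of all indices integrates over the whole torus.\<close>

definition av :: "'n::finite \<Rightarrow> (real^'n \<Rightarrow> real) \<Rightarrow> real^'n \<Rightarrow> real" where
  "av i g \<theta> = integral {0..2 * pi} (\<lambda>t. g (\<theta> + t *\<^sub>R axis i 1))"

abbreviation avs :: "'n::finite list \<Rightarrow> (real^'n \<Rightarrow> real) \<Rightarrow> real^'n \<Rightarrow> real" where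
  "avs l g \<equiv> foldr av l g"

lemma continuous_shift:
  assumes "continuous_on UNIV (g :: real^'n::finite \<Rightarrow> real)"
  shows "continuous_on S (\<lambda>t::real. g (\<theta> + t *\<^sub>R v))"
  by (rule continuous_on_compose2[OF assms]) (auto intro!: continuous_intros)

lemma continuous_av:
  assumes "continuous_on UNIV g"
  shows "continuous_on UNIV (av i g)"
proof -
  have "continuous_on (UNIV \<times> cbox 0 (2 * pi)) (\<lambda>(\<theta>, t). g (\<theta> + t *\<^sub>R axis i 1))"
    unfolding case_prod_beta by (rule continuous_on_compose2[OF assms]) (auto intro!: continuous_intros)
  from integral_continuous_on_param[OF this] show ?thesis by (simp add: av_def [abs_def])
qed

lemma continuous_avs: "continuous_on UNIV g \<Longrightarrow> continuous_on UNIV (avs l g)"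
  by (induction l) (auto intro: continuous_av)

lemma av_commute:
  assumes "continuous_on UNIV g"
  shows "av i (av j g) = av j (av i g)"
proof
  fix \<theta>
  have "continuous_on (cbox (0, 0) (2 * pi, 2 * pi)) (\<lambda>(s, t). g (\<theta> + s *\<^sub>R axis i 1 + t *\<^sub>R axis j 1))"
    unfolding case_prod_beta by (rule continuous_on_compose2[OF assms]) (auto intro!: continuous_intros)
  from integral_swap_continuous[OF this]
  show "av i (av j g) \<theta> = av j (av i g) \<theta>"
    by (simp add: av_def add.assoc add.commute[of "_ *\<^sub>R axis i 1"])
qed

lemma avs_av_commute:
  assumes "continuous_on UNIV g"
  shows "avs l (av i g) = av i (avs l g)"
  by (induction l) (simp_all add: av_commute continuous_avs assms)

lemma avs_bound:
  assumes "continuous_on UNIV g" "\<And>\<theta>. \<bar>g \<theta>\<bar> \<le> B"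
  shows "\<bar>avs l g \<theta>\<bar> \<le> (2 * pi) ^ length l * B"
proof (induction l arbitrary: \<theta>)
  case (Cons i l)
  have "norm (integral {0..2 * pi} (\<lambda>t. avs l g (\<theta> + t *\<^sub>R axis i 1))) \<le> (2 * pi) ^ length l * B * (2 * pi - 0)"
    by (intro integral_bound continuous_shift continuous_avs assms(1)) (use Cons in auto)
  then show ?case by (simp add: av_def[of i "foldr av l g"] mult_ac)
qed (simp add: assms)

text \<open>Averages over different angles commute, so the small one can be taken first; every other
  angle only contributes a factor \<open>2 * pi\<close>.\<close>

lemma avs_bound_of_av:
  assumes g: "continuous_on UNIV g" and "i \<in> set l" "\<And>\<theta>. \<bar>av i g \<theta>\<bar> \<le> B"
  shows "\<bar>avs l g \<theta>\<bar> \<le> (2 * pi) ^ (length l - 1) * B"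
proof -
  obtain l1 l2 where l: "l = l1 @ i # l2" using split_list[OF assms(2)] by blast
  have "avs l g = avs (l1 @ l2) (av i g)" by (simp add: l avs_av_commute[OF g])
  then show ?thesis using avs_bound[OF continuous_av[OF g] assms(3), of "l1 @ l2" \<theta>] l by simp
qed

lemma av_add:
  assumes "continuous_on UNIV g" "continuous_on UNIV h"
  shows "av i (\<lambda>\<theta>. g \<theta> + h \<theta>) = (\<lambda>\<theta>. av i g \<theta> + av i h \<theta>)"
  unfolding av_def
  by (intro ext integral_add integrable_continuous_interval continuous_shift assms)

lemma avs_add:
  assumes "continuous_on UNIV g" "continuous_on UNIV h"
  shows "avs l (\<lambda>\<theta>. g \<theta> + h \<theta>) = (\<lambda>\<theta>. avs l g \<theta> + avs l h \<theta>)"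
  by (induction l) (simp_all add: av_add continuous_avs assms)

lemma avs_cmult: "avs l (\<lambda>\<theta>. c * g \<theta>) = (\<lambda>\<theta>. c * avs l g \<theta>)"
  by (induction l) (simp_all add: av_def [abs_def])

lemma avs_sum:
  assumes "\<And>k. k \<in> I \<Longrightarrow> continuous_on UNIV (g k)"
  shows "avs l (\<lambda>\<theta>. \<Sum>k\<in>I. g k \<theta>) = (\<lambda>\<theta>. \<Sum>k\<in>I. avs l (g k) \<theta>)"
  using assms
proof (induction I rule: infinite_finite_induct)
  case (insert k I)
  have "avs l (\<lambda>\<theta>. g k \<theta> + (\<Sum>k\<in>I. g k \<theta>)) = (\<lambda>\<theta>. avs l (g k) \<theta> + avs l (\<lambda>\<theta>. \<Sum>k\<in>I. g k \<theta>) \<theta>)"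
    by (intro avs_add continuous_on_sum) (use insert.prems in auto)
  then show ?case using insert by simp
qed (use avs_cmult[of l 0 "\<lambda>_. 0"] in simp_all)

text \<open>Fubini for a product, one angle at a time. Since the factors \<open>q j\<close> need not
  be periodic, the angles that are integrated start at 0, so that each integral runs exactly over
  the interval from 0 to \<open>2 * pi\<close>.\<close>

lemma avs_prod:
  fixes q :: "'n::finite \<Rightarrow> real \<Rightarrow> real"
  assumes "distinct l" "\<And>j. j \<in> set l \<Longrightarrow> \<theta> $ j = 0"
  shows "avs l (\<lambda>\<theta>. \<Prod>j\<in>UNIV. q j (\<theta> $ j)) \<theta>
    = (\<Prod>j\<in>set l. integral {0..2 * pi} (q j)) * (\<Prod>j\<in>UNIV - set l. q j (\<theta> $ j))"
  using assms
proof (induction l arbitrary: \<theta>)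
  case (Cons i l)
  let ?I = "\<lambda>j. integral {0..2 * pi} (q j)"
  have split: "UNIV - set l = insert i (UNIV - set (i # l))" using Cons.prems(1) by auto
  have "avs l (\<lambda>\<theta>. \<Prod>j\<in>UNIV. q j (\<theta> $ j)) (\<theta> + t *\<^sub>R axis i 1)
      = (\<Prod>j\<in>set l. ?I j) * (\<Prod>j\<in>UNIV - set (i # l). q j (\<theta> $ j)) * q i t" for t
  proof -
    have "avs l (\<lambda>\<theta>. \<Prod>j\<in>UNIV. q j (\<theta> $ j)) (\<theta> + t *\<^sub>R axis i 1)
        = (\<Prod>j\<in>set l. ?I j) * (\<Prod>j\<in>UNIV - set l. q j ((\<theta> + t *\<^sub>R axis i 1) $ j))"
      by (rule Cons.IH) (use Cons.prems in \<open>auto simp: axis_def\<close>)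
    also have "(\<Prod>j\<in>UNIV - set l. q j ((\<theta> + t *\<^sub>R axis i 1) $ j))
        = q i t * (\<Prod>j\<in>UNIV - set (i # l). q j ((\<theta> + t *\<^sub>R axis i 1) $ j))"
      unfolding split using Cons.prems(2)[of i] by (subst prod.insert) auto
    also have "(\<Prod>j\<in>UNIV - set (i # l). q j ((\<theta> + t *\<^sub>R axis i 1) $ j)) = (\<Prod>j\<in>UNIV - set (i # l). q j (\<theta> $ j))"
      by (intro prod.cong) (auto simp: axis_def)
    finally show ?thesis by (simp add: mult_ac)
  qed
  then show ?case using Cons.prems(1)
    by (simp add: av_def[of i "foldr av l (\<lambda>\<theta>. \<Prod>j\<in>UNIV. q j (\<theta> $ j))"] mult_ac)
qed simp

definition cos_moment :: "nat \<Rightarrow> real" where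
  "cos_moment k = integral {0..2 * pi} (\<lambda>t. cos t ^ k)"

text \<open>For even \<open>k\<close> the integrand is nonnegative and continuous, and it is 1 at
  0.\<close>

lemma cos_moment_nonzero:
  assumes "even k"
  shows "cos_moment k \<noteq> 0"
proof
  assume "cos_moment k = 0"
  moreover have "continuous_on {0..2 * pi} (\<lambda>t::real. cos t ^ k)" by (intro continuous_intros)
  ultimately have "\<forall>t\<in>{0..2 * pi}. cos t ^ k = 0"
    unfolding cos_moment_def using integral_eq_0_iff[of 0 "2 * pi" "\<lambda>t. cos t ^ k"] assms by (simp add: zero_le_even_power)
  then have "cos 0 ^ k = (0::real)" by (metis atLeastAtMost_iff order_refl pi_ge_zero mult_nonneg_nonneg zero_le_numeral)
  then show False by simp
qed

text \<open>The average of a monomial factors into one-variable integrals, which multiplies each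
  coefficient by a product of cosine moments. These are the weights in
  \<open>even_homogeneous_polynomial_eq_zero\<close>.\<close>

lemma even_polynomial_average_eq_zero:
  fixes P :: "real^'n::finite \<Rightarrow> real"
  assumes P: "homogeneous_polynomial d P"
    and even: "\<And>\<sigma> x. (\<And>i. \<sigma> i \<in> {-1, 1}) \<Longrightarrow> P (\<chi> i. \<sigma> i * x $ i) = P x"
    and l: "distinct l" "set l = UNIV"
    and zero: "\<And>x. avs l (\<lambda>\<theta>. P (\<chi> j. x $ j * cos (\<theta> $ j))) 0 = 0"
  shows "P x = 0"
proof -
  obtain a where a: "\<And>s. P s = (\<Sum>\<alpha> | (\<Sum>j\<in>UNIV. \<alpha> j) = d. a \<alpha> * (\<Prod>j\<in>UNIV. (s $ j) ^ \<alpha> j))"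
    using P unfolding homogeneous_polynomial_def by blast
  show ?thesis
  proof (rule even_homogeneous_polynomial_eq_zero[OF a even _ cos_moment_nonzero])
    fix s :: "real^'n"
    have "continuous_on UNIV (\<lambda>\<theta> :: real^'n. a \<alpha> * (\<Prod>j\<in>UNIV. (s $ j * cos (\<theta> $ j)) ^ \<alpha> j))" for \<alpha>
      by (intro continuous_intros)
    then have "avs l (\<lambda>\<theta>. P (\<chi> j. s $ j * cos (\<theta> $ j))) 0
        = (\<Sum>\<alpha> | (\<Sum>j\<in>UNIV. \<alpha> j) = d. a \<alpha> * avs l (\<lambda>\<theta>. \<Prod>j\<in>UNIV. (s $ j * cos (\<theta> $ j)) ^ \<alpha> j) 0)"
      unfolding a by (simp add: avs_sum avs_cmult)
    also have "\<dots> = (\<Sum>\<alpha> | (\<Sum>j\<in>UNIV. \<alpha> j) = d. a \<alpha> * (\<Prod>j\<in>UNIV. cos_moment (\<alpha> j) * (s $ j) ^ \<alpha> j))"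
    proof (intro sum.cong refl arg_cong2[where f = "(*)"])
      fix \<alpha> :: "'n \<Rightarrow> nat"
      show "avs l (\<lambda>\<theta>. \<Prod>j\<in>UNIV. (s $ j * cos (\<theta> $ j)) ^ \<alpha> j) 0 = (\<Prod>j\<in>UNIV. cos_moment (\<alpha> j) * (s $ j) ^ \<alpha> j)"
        using avs_prod[OF l(1), of 0 "\<lambda>j t. (s $ j * cos t) ^ \<alpha> j"]
        by (simp add: l(2) power_mult_distrib cos_moment_def mult.commute)
    qed
    finally show "(\<Sum>\<alpha> | (\<Sum>j\<in>UNIV. \<alpha> j) = d. a \<alpha> * (\<Prod>j\<in>UNIV. cos_moment (\<alpha> j) * (s $ j) ^ \<alpha> j)) = 0"
      using zero[of s] by simp
  qed
qed

section \<open>Invariant tori of functions of the actions\<close>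

text \<open>Parametrizes the torus through \<open>(x, 0)\<close> on which all actions are constant.
  Its base component \<open>x $ j * cos (\<theta> $ j)\<close> is what a potential sees.\<close>

definition orbit :: "real^'n::finite \<Rightarrow> real^'n \<Rightarrow> 'n phase" where
  "orbit x \<theta> = (\<chi> j. x $ j * cos (\<theta> $ j), \<chi> j. - (x $ j * sin (\<theta> $ j)))"

text \<open>The rotation field in the i-th coordinate plane, which is the Hamiltonian vector field
  of half the i-th action.\<close>

definition orbit_tangent :: "'n::finite \<Rightarrow> 'n phase \<Rightarrow> 'n phase" where
  "orbit_tangent i z = (snd z $ i *\<^sub>R axis i 1, - (fst z $ i) *\<^sub>R axis i 1)"

lemma norm_vec_sq: "norm (x :: real^'n::finite) ^ 2 = (\<Sum>i\<in>UNIV. (x $ i) ^ 2)"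
  unfolding power2_norm_eq_inner inner_vec_def by (simp add: power2_eq_square)

lemma norm_orbit: "norm (orbit x \<theta>) = norm x"
proof -
  have "norm (orbit x \<theta>) ^ 2 = (\<Sum>i\<in>UNIV. (x $ i * cos (\<theta> $ i)) ^ 2 + (x $ i * sin (\<theta> $ i)) ^ 2)"
    by (simp add: orbit_def norm_Pair norm_vec_sq sum.distrib sum_nonneg)
  also have "\<dots> = norm x ^ 2"
    by (simp add: norm_vec_sq power_mult_distrib distrib_left[symmetric] add.commute[of "cos _ ^ 2"])
  finally show ?thesis by simp
qed

lemma actions_orbit: "actions (orbit x \<theta>) = (\<chi> j. (x $ j) ^ 2)"
  by (simp add: orbit_def actions_def vec_eq_iff power_mult_distrib distrib_left[symmetric])

lemma continuous_orbit: "continuous_on S (orbit x)"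
  unfolding orbit_def [abs_def] by (intro continuous_intros)

lemma norm_orbit_tangent: "norm (orbit_tangent i (z :: 'n::finite phase)) \<le> norm z"
proof -
  have "(a $ i)\<^sup>2 \<le> (norm a)\<^sup>2" for a :: "real^'n"
    using power_mono[OF component_le_norm_cart abs_ge_zero, of a i 2] by simp
  from add_mono[OF this[of "snd z"] this[of "fst z"]] show ?thesis
    unfolding orbit_tangent_def norm_Pair norm_prod_def by (simp add: norm_axis_1 add.commute)
qed

lemma continuous_orbit_tangent: "continuous_on S (orbit_tangent i)"
  unfolding orbit_tangent_def [abs_def] by (intro continuous_intros)

lemma orbit_periodic: "orbit x (\<theta> + (2 * pi) *\<^sub>R axis i 1) = orbit x \<theta>"
proof -
  have "cos ((\<theta> + (2 * pi) *\<^sub>R axis i 1) $ j) = cos (\<theta> $ j)" "sin ((\<theta> + (2 * pi) *\<^sub>R axis i 1) $ j) = sin (\<theta> $ j)" for j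
    by (auto simp: axis_def)
  then show ?thesis by (simp only: orbit_def)
qed

lemma orbit_has_vector_derivative:
  "((\<lambda>t. orbit x (\<theta> + t *\<^sub>R axis i 1)) has_vector_derivative orbit_tangent i (orbit x (\<theta> + t *\<^sub>R axis i 1))) (at t)"
proof -
  define a where "a = (\<chi> j. if j = i then 0 else x $ j * cos (\<theta> $ j))"
  define b where "b = (\<chi> j. if j = i then 0 else - (x $ j * sin (\<theta> $ j)))"
  have eq: "orbit x (\<theta> + t *\<^sub>R axis i 1)
    = (a + (x $ i * cos (\<theta> $ i + t)) *\<^sub>R axis i 1, b + (- (x $ i * sin (\<theta> $ i + t))) *\<^sub>R axis i 1)" for t
    by (auto simp: orbit_def a_def b_def vec_eq_iff axis_def)
  have t: "orbit_tangent i (orbit x (\<theta> + t *\<^sub>R axis i 1))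
    = (0 + (x $ i * (- sin (\<theta> $ i + t))) *\<^sub>R axis i 1, 0 + (- (x $ i * cos (\<theta> $ i + t))) *\<^sub>R axis i 1)"
    by (simp add: orbit_def orbit_tangent_def axis_def)
  have c: "((\<lambda>t. x $ i * cos (\<theta> $ i + t)) has_real_derivative x $ i * (- sin (\<theta> $ i + t))) (at t)"
    by (auto intro!: derivative_eq_intros)
  have s: "((\<lambda>t. - (x $ i * sin (\<theta> $ i + t))) has_real_derivative - (x $ i * cos (\<theta> $ i + t))) (at t)"
    by (auto intro!: derivative_eq_intros)
  have "((\<lambda>t. f t *\<^sub>R axis i (1::real)) has_vector_derivative f' *\<^sub>R axis i 1) (at t)"
    if "(f has_real_derivative f') (at t)" for f f'
    using has_vector_derivative_scaleR[OF that has_vector_derivative_const] by simp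
  from this[OF c] this[OF s] show ?thesis unfolding t unfolding eq[abs_def]
    by (intro has_vector_derivative_Pair has_vector_derivative_add has_vector_derivative_const)
qed

text \<open>Written through the symplectic form so that differentiating a function of the actions
  along a field \<open>X\<close> yields a combination of the terms
  \<open>symplectic_form (X z) (orbit_tangent i z)\<close>, which are the integrands of loop
  integrals.\<close>

lemma actions_has_derivative:
  fixes z :: "'n::finite phase"
  shows "(actions has_derivative (\<lambda>v. \<Sum>i\<in>UNIV. (2 * symplectic_form v (orbit_tangent i z)) *\<^sub>R axis i 1)) (at z)"
proof -
  have eq: "actions = (\<lambda>z :: 'n phase. \<Sum>i\<in>UNIV. ((fst z $ i) ^ 2 + (snd z $ i) ^ 2) *\<^sub>R axis i 1)"
    unfolding actions_def by (auto simp: vec_eq_iff fun_eq_iff axis_def if_distrib cong: if_cong)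
  have "((\<lambda>z. ((fst z $ i) ^ 2 + (snd z $ i) ^ 2) *\<^sub>R axis i (1::real)) has_derivative
      (\<lambda>v. (2 * symplectic_form v (orbit_tangent i z)) *\<^sub>R axis i 1)) (at z)" for i
  proof -
    have l1: "bounded_linear (\<lambda>z :: 'n phase. fst z $ i)" "bounded_linear (\<lambda>z :: 'n phase. snd z $ i)" for i
      by (simp_all add: bounded_linear_compose[OF bounded_linear_vec_nth] bounded_linear_fst bounded_linear_snd)
    have "((\<lambda>z. (fst z $ i) ^ 2 + (snd z $ i) ^ 2) has_derivative
        (\<lambda>v. 2 * (fst v $ i) * (fst z $ i) + 2 * (snd v $ i) * (snd z $ i))) (at z)"
      by (rule derivative_eq_intros bounded_linear_imp_has_derivative[OF l1(1)] bounded_linear_imp_has_derivative[OF l1(2)] refl)+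
        (simp add: fun_eq_iff mult_ac)
    then show ?thesis
      by (intro has_derivative_scaleR_left)
        (simp add: symplectic_form_alt orbit_tangent_def inner_axis algebra_simps)
  qed
  then show ?thesis unfolding eq by (intro has_derivative_sum)
qed

lemma smooth_germ_actions: "smooth_germ (actions :: 'n::finite phase \<Rightarrow> _)"
proof -
  have eq: "actions = (\<lambda>z :: 'n phase. \<Sum>i\<in>UNIV. ((fst z $ i) ^ 2 + (snd z $ i) ^ 2) *\<^sub>R axis i 1)"
    unfolding actions_def by (auto simp: vec_eq_iff fun_eq_iff axis_def if_distrib cong: if_cong)
  show ?thesis unfolding eq
    by (intro smooth_germ_sum smooth_germ_scaleR smooth_germ_add smooth_germ_power smooth_germ_vec_nth smooth_germ_const
        smooth_germ_bounded_linear bounded_linear_fst bounded_linear_snd)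
qed


text \<open>On the torus of \<open>x\<close>, \<open>Q\<close> equals an error of order
  \<open>Suc d\<close> minus a sum of the products \<open>m i x * h i \<theta>\<close>. Each
  \<open>m i x\<close> is constant there, and \<open>h i\<close> integrated over the i-th angle is a
  loop integral, bounded by \<open>loop_integral_bound\<close>. So the average of \<open>Q\<close>
  has order \<open>Suc d\<close> in \<open>x\<close>; being homogeneous of degree \<open>d\<close>,
  it is zero.\<close>

lemma torus_average_eq_zero:
  fixes \<Phi> :: "real^'n::finite \<Rightarrow> real" and X :: "'n phase \<Rightarrow> 'n phase" and Q :: "'n phase \<Rightarrow> real"
  assumes \<Phi>: "smooth_germ \<Phi>" and X: "smooth_germ X"
    and closed: "\<And>v w. vanishes (Suc K) (\<lambda>z. symplectic_form (fderiv X z v) w + symplectic_form v (fderiv X z w))"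
    and energy: "vanishes (Suc d) (\<lambda>z. fderiv (\<lambda>z. \<Phi> (actions z)) z (X z) + Q z)" and d: "d \<le> K"
    and Q: "continuous_on UNIV Q" "\<And>t z. Q (t *\<^sub>R z) = t ^ d * Q z"
    and l: "set l = UNIV"
  shows "avs l (\<lambda>\<theta>. Q (orbit x \<theta>)) 0 = 0"
proof -
  interpret bounded_bilinear "symplectic_form :: 'n phase \<Rightarrow> _" by (rule bounded_bilinear_symplectic_form)
  let ?L = "length l"
  obtain C1 e1 where C1: "C1 \<ge> 0" "e1 > 0" "e1 \<le> 1"
    "\<And>z. norm z < e1 \<Longrightarrow> norm (fderiv (\<lambda>z. \<Phi> (actions z)) z (X z) + Q z) \<le> C1 * norm z ^ Suc d"
    using vanishesE[OF energy] by blast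
  obtain C2 e2 where C2: "C2 \<ge> 0" "e2 > 0" and smX: "smooth_on X (ball 0 e2)"
    and loop: "\<And>\<gamma> \<gamma>' r. \<lbrakk>\<And>t. (\<gamma> has_vector_derivative \<gamma>' t) (at t); continuous_on UNIV \<gamma>'; \<gamma> (2 * pi) = \<gamma> 0;
       \<And>t. norm (\<gamma> t) \<le> r; \<And>t. norm (\<gamma>' t) \<le> r; r < e2\<rbrakk>
       \<Longrightarrow> \<bar>integral {0..2 * pi} (\<lambda>t. symplectic_form (X (\<gamma> t)) (\<gamma>' t))\<bar> \<le> C2 * r ^ (Suc K + 2)"
    by (rule loop_integral_bound[OF X closed, of "2 * pi"]) (use pi_gt_zero in auto)
  \<comment> \<open>Twice the i-th partial derivative of \<open>\<Phi>\<close> at the actions of the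
    torus; the factor 2 comes from differentiating the squares.\<close>
  define m where "m i x = 2 * fderiv \<Phi> (\<chi> j. (x $ j) ^ 2) (axis i 1)" for i and x :: "real^'n"
  have sq: "smooth_germ (\<lambda>x :: real^'n. \<chi> j. (x $ j) ^ 2)"
  proof -
    have "(\<lambda>x :: real^'n. \<chi> j. (x $ j) ^ 2) = (\<lambda>x. \<Sum>i\<in>UNIV. (x $ i) ^ 2 *\<^sub>R axis i 1)"
      by (auto simp: vec_eq_iff fun_eq_iff axis_def if_distrib cong: if_cong)
    moreover have "smooth_germ \<dots>"
      by (intro smooth_germ_sum smooth_germ_scaleR smooth_germ_power smooth_germ_vec_nth smooth_germ_const smooth_germ_id)
    ultimately show ?thesis by simp
  qed
  have sq0: "(\<chi> j. ((0 :: real^'n) $ j) ^ 2) = 0" by (simp add: vec_eq_iff)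
  have "vanishes 0 (\<lambda>x. \<Sum>i\<in>UNIV. norm (m i x))"
    unfolding m_def
    by (intro vanishes_sum vanishes_norm vanishes_cmult vanishes_0_smooth
        smooth_germ_compose[OF smooth_germ_fderiv[OF \<Phi>] sq sq0])
  then obtain B e3 where B: "B \<ge> 0" "e3 > 0" "e3 \<le> 1"
    "\<And>x. norm x < e3 \<Longrightarrow> norm (\<Sum>i\<in>UNIV. norm (m i x)) \<le> B * norm x ^ 0"
    using vanishesE by blast
  have act0: "actions (0 :: 'n phase) = 0" by (simp add: actions_def zero_prod_def vec_eq_iff)
  have "\<forall>\<^sub>F z in nhds 0. (\<Phi> has_derivative fderiv \<Phi> (actions z)) (at (actions z))"
    using smooth_germ_derivative[OF \<Phi>] smooth_germ_tendsto_0[OF smooth_germ_actions act0]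
    by (rule eventually_compose_filterlim)
  then obtain e4 where e4: "e4 > 0"
    "\<And>z :: 'n phase. norm z < e4 \<Longrightarrow> (\<Phi> has_derivative fderiv \<Phi> (actions z)) (at (actions z))"
    unfolding eventually_nhds_metric by auto
  define e where "e = min (min e1 e2) (min e3 e4)"
  have e: "e > 0" "e \<le> 1" using C1 C2 B e4 by (auto simp: e_def)
  have "vanishes (Suc d) (\<lambda>x. avs l (\<lambda>\<theta>. Q (orbit x \<theta>)) 0)"
  proof (rule vanishesI[OF e(1)])
    fix x :: "real^'n" assume "norm x < e"
    then have x: "norm x < e1" "norm x < e2" "norm x < e3" "norm x < e4" "norm x \<le> 1"
      using e(2) by (auto simp: e_def)
    define h where "h i \<theta> = symplectic_form (X (orbit x \<theta>)) (orbit_tangent i (orbit x \<theta>))" for i \<theta>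
    define E where "E \<theta> = Q (orbit x \<theta>) + (\<Sum>i\<in>UNIV. m i x * h i \<theta>)" for \<theta>
    have cX: "continuous_on UNIV (\<lambda>\<theta>. X (orbit x \<theta>))"
      by (rule continuous_on_compose2[OF smooth_on_continuous[OF smX] continuous_orbit])
        (use x in \<open>simp add: image_subset_iff norm_orbit\<close>)
    have ch: "continuous_on UNIV (h i)" for i
      unfolding h_def [abs_def]
      by (intro continuous_on cX continuous_on_compose2[OF continuous_orbit_tangent continuous_orbit]) auto
    have cE: "continuous_on UNIV E"
      unfolding E_def [abs_def]
      by (intro continuous_intros continuous_on_compose2[OF Q(1) continuous_orbit] ch) auto
    have bE: "\<bar>E \<theta>\<bar> \<le> C1 * norm x ^ Suc d" for \<theta>
    proof -
      let ?z = "orbit x \<theta>"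
      have z: "norm ?z < e4" "norm ?z < e1" using x by (simp_all add: norm_orbit)
      note D = e4(2)[OF z(1)]
      have "((\<lambda>z. \<Phi> (actions z)) has_derivative (\<lambda>v. fderiv \<Phi> (actions ?z)
          (\<Sum>i\<in>UNIV. (2 * symplectic_form v (orbit_tangent i ?z)) *\<^sub>R axis i 1))) (at ?z)"
        by (rule has_derivative_compose[OF actions_has_derivative D])
      then have "fderiv (\<lambda>z. \<Phi> (actions z)) ?z = (\<lambda>v. fderiv \<Phi> (actions ?z)
          (\<Sum>i\<in>UNIV. (2 * symplectic_form v (orbit_tangent i ?z)) *\<^sub>R axis i 1))"
        by (rule frechet_derivative_at[symmetric])
      then have "fderiv (\<lambda>z. \<Phi> (actions z)) ?z (X ?z) = (\<Sum>i\<in>UNIV. m i x * h i \<theta>)"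
        using has_derivative_linear[OF D]
        by (simp add: linear_sum linear_scale m_def h_def actions_orbit mult_ac)
      then show ?thesis using C1(4)[OF z(2)] by (simp add: E_def norm_orbit add.commute)
    qed
    have bh: "\<bar>av i (h i) \<theta>\<bar> \<le> C2 * norm x ^ (Suc K + 2)" for i \<theta>
      unfolding av_def h_def
    proof (rule loop)
      show "continuous_on UNIV (\<lambda>t. orbit_tangent i (orbit x (\<theta> + t *\<^sub>R axis i 1)))"
        by (rule continuous_on_compose2[OF continuous_orbit_tangent continuous_on_compose2[OF continuous_orbit]])
          (auto intro!: continuous_intros)
      show "norm (orbit_tangent i (orbit x (\<theta> + t *\<^sub>R axis i 1))) \<le> norm x" for t
        using norm_orbit_tangent[of i "orbit x (\<theta> + t *\<^sub>R axis i 1)"] by (simp add: norm_orbit)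
    qed (use x in \<open>simp_all add: orbit_has_vector_derivative orbit_periodic norm_orbit\<close>)
    have "(\<lambda>\<theta>. Q (orbit x \<theta>)) = (\<lambda>\<theta>. E \<theta> + (\<Sum>i\<in>UNIV. (- m i x) * h i \<theta>))"
      by (simp add: E_def fun_eq_iff sum_negf)
    moreover have "avs l \<dots> 0 = avs l E 0 + (\<Sum>i\<in>UNIV. (- m i x) * avs l (h i) 0)"
    proof -
      have c: "continuous_on UNIV (\<lambda>\<theta>. (- m i x) * h i \<theta>)" for i
        by (intro continuous_on_mult continuous_on_const ch)
      then have "continuous_on UNIV (\<lambda>\<theta>. \<Sum>i\<in>UNIV. (- m i x) * h i \<theta>)"
        by (intro continuous_on_sum)
      from avs_add[OF cE this] show ?thesis unfolding avs_sum[OF c] avs_cmult by simp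
    qed
    ultimately have eq: "avs l (\<lambda>\<theta>. Q (orbit x \<theta>)) 0 = avs l E 0 + (\<Sum>i\<in>UNIV. (- m i x) * avs l (h i) 0)"
      by simp
    have 1: "\<bar>avs l E 0\<bar> \<le> (2 * pi) ^ ?L * (C1 * norm x ^ Suc d)"
      by (rule avs_bound[OF cE bE])
    have "\<bar>\<Sum>i\<in>UNIV. (- m i x) * avs l (h i) 0\<bar> \<le> (\<Sum>i\<in>UNIV. \<bar>m i x\<bar> * ((2 * pi) ^ (?L - 1) * (C2 * norm x ^ (Suc K + 2))))"
    proof (rule order.trans[OF sum_abs], rule sum_mono)
      fix i
      have "\<bar>avs l (h i) 0\<bar> \<le> (2 * pi) ^ (?L - 1) * (C2 * norm x ^ (Suc K + 2))"
        by (rule avs_bound_of_av[OF ch _ bh]) (simp add: l)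
      then show "\<bar>(- m i x) * avs l (h i) 0\<bar> \<le> \<bar>m i x\<bar> * ((2 * pi) ^ (?L - 1) * (C2 * norm x ^ (Suc K + 2)))"
        unfolding abs_mult abs_minus_cancel by (rule mult_left_mono) simp
    qed
    also have "\<dots> = (\<Sum>i\<in>UNIV. \<bar>m i x\<bar>) * ((2 * pi) ^ (?L - 1) * (C2 * norm x ^ (Suc K + 2)))"
      by (simp add: sum_distrib_right)
    \<comment> \<open>Closedness to order \<open>Suc K\<close> yields loop integrals of order
      \<open>K + 3\<close>, which is at least \<open>Suc d\<close>, and the coefficients
      \<open>m i x\<close> are merely bounded.\<close>
    also have "\<dots> \<le> B * ((2 * pi) ^ (?L - 1) * (C2 * norm x ^ Suc d))"
    proof (intro mult_mono)
      show "(\<Sum>i\<in>UNIV. \<bar>m i x\<bar>) \<le> B" using B(4)[OF x(3)] by (simp add: sum_nonneg)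
      show "norm x ^ (Suc K + 2) \<le> norm x ^ Suc d" using d x by (intro power_decreasing) auto
    qed (use B C2 in \<open>auto simp: sum_nonneg\<close>)
    finally show "norm (avs l (\<lambda>\<theta>. Q (orbit x \<theta>)) 0)
        \<le> ((2 * pi) ^ ?L * C1 + B * (2 * pi) ^ (?L - 1) * C2) * norm x ^ Suc d"
      unfolding eq using 1 by (simp add: algebra_simps)
  qed
  moreover have "avs l (\<lambda>\<theta>. Q (orbit (t *\<^sub>R x) \<theta>)) 0 = t ^ d *\<^sub>R avs l (\<lambda>\<theta>. Q (orbit x \<theta>)) 0" for t x
  proof -
    have "orbit (t *\<^sub>R x) \<theta> = t *\<^sub>R orbit x \<theta>" for \<theta> by (simp add: orbit_def vec_eq_iff)
    then show ?thesis by (simp add: Q(2) avs_cmult)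
  qed
  ultimately show ?thesis by (rule vanishes_homogeneous_imp_zero)
qed

section \<open>Determination of the Taylor series\<close>

text \<open>The Landau bound lives on a punctured neighbourhood; \<open>f 0 = 0\<close> and
  \<open>k > 0\<close> supply the origin.\<close>

lemma bigo_imp_vanishes:
  fixes f :: "'a::real_normed_vector \<Rightarrow> real"
  assumes "f \<in> O[at 0](\<lambda>z. norm z ^ k)" "f 0 = 0" "k > 0"
  shows "vanishes k f"
proof -
  obtain C where "\<forall>\<^sub>F z in at 0. norm (f z) \<le> C * norm (norm z ^ k)"
    using landau_o.bigE[OF assms(1)] by blast
  then have "\<forall>\<^sub>F z in nhds 0. z \<noteq> 0 \<longrightarrow> norm (f z) \<le> C * norm z ^ k"
    by (simp add: eventually_at_filter)
  then have "\<forall>\<^sub>F z in nhds 0. norm (f z) \<le> C * norm z ^ k"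
    by eventually_elim (use assms(2,3) in \<open>metis le_numeral_extra(3) mult_zero_right norm_zero zero_power\<close>)
  then show ?thesis unfolding vanishes_def by blast
qed

lemma vanishes_at_0:
  assumes "vanishes a f" "a > 0"
  shows "f 0 = 0"
proof -
  obtain C where "\<forall>\<^sub>F x in nhds 0. norm (f x) \<le> C * norm x ^ a" using assms(1) vanishes_def by blast
  from eventually_nhds_x_imp_x[OF this] assms(2) show ?thesis by (simp add: zero_power)
qed

lemma birkhoff_formE:
  assumes "birkhoff_form H F" "N \<ge> 1" "H (0, 0) = 0"
  obtains U c \<phi> where "open U" "0 \<in> U" "canonical_on U \<phi>" "\<phi> 0 = 0" "(\<phi> has_derivative id) (at 0)"
    "\<And>i. c i \<noteq> 0" "vanishes (2 * N + 2) (\<lambda>z. H (rescaling c (\<phi> z)) - (\<Sum>i=1..N. F i (actions z)))"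
proof -
  obtain U \<kappa> c \<phi> where *: "open U" "(0, 0) \<in> U" "\<kappa> (0, 0) = (0, 0)" "\<forall>i. c i \<noteq> 0"
      "canonical_on U \<phi>" "\<phi> (0, 0) = (0, 0)" "(\<phi> has_derivative id) (at (0, 0))"
      "\<forall>z\<in>U. \<kappa> z = rescaling c (\<phi> z)"
    and O: "(\<lambda>z. H (\<kappa> z) - (\<Sum>i=1..N. F i (actions z))) \<in> O[at (0, 0)](\<lambda>z. norm z ^ (2 * N + 2))"
    using assms(1,2) unfolding birkhoff_form_def by blast
  have F: "F i (actions (0 :: 'a phase)) = 0" if "i \<ge> 1" for i
  proof -
    have "homogeneous_polynomial i (F i)" using assms(1) that unfolding birkhoff_form_def by blast
    from homogeneous_polynomial_scale[OF this, of 0 0] that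
    show ?thesis by (simp add: actions_def zero_prod_def zero_vec_def[symmetric] power_0_left)
  qed
  have "vanishes (2 * N + 2) (\<lambda>z. H (\<kappa> z) - (\<Sum>i=1..N. F i (actions z)))"
    by (rule bigo_imp_vanishes) (use O F *(3) assms(3) in \<open>simp_all add: zero_prod_def\<close>)
  moreover have "\<forall>\<^sub>F z in nhds 0. H (\<kappa> z) - (\<Sum>i=1..N. F i (actions z)) = H (rescaling c (\<phi> z)) - (\<Sum>i=1..N. F i (actions z))"
    unfolding eventually_nhds using * by (intro exI[of _ U]) (simp add: zero_prod_def)
  ultimately have "vanishes (2 * N + 2) (\<lambda>z. H (rescaling c (\<phi> z)) - (\<Sum>i=1..N. F i (actions z)))"
    by (rule vanishes_cong[rotated])
  then show thesis using that[of U \<phi> c] * by (simp add: zero_prod_def)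
qed

definition scale_coords :: "('n::finite \<Rightarrow> real) \<Rightarrow> real^'n \<Rightarrow> real^'n" where
  "scale_coords c x = (\<chi> i. c i * x $ i)"

lemma bounded_linear_scale_coords: "bounded_linear (scale_coords c)"
  unfolding linear_conv_bounded_linear[symmetric]
  by (rule linearI) (simp_all add: scale_coords_def vec_eq_iff algebra_simps)

lemma bounded_linear_scale_coords_fst: "bounded_linear (\<lambda>z :: 'n::finite phase. scale_coords c (fst z))"
  by (rule bounded_linear_compose[OF bounded_linear_scale_coords bounded_linear_fst])

lemma vanishes_1_bounded_linear: "bounded_linear f \<Longrightarrow> vanishes 1 f"
  for f :: "'a::euclidean_space \<Rightarrow> 'b::euclidean_space"
  by (rule vanishes_1_smooth) (auto intro: smooth_germ_bounded_linear linear_0 bounded_linear.linear)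

lemma hamiltonian_rescaling:
  "hamiltonian V (rescaling c z) = (\<Sum>i\<in>UNIV. (inverse (c i) * snd z $ i) ^ 2) + V (scale_coords c (fst z))"
  by (simp add: hamiltonian_def rescaling_def scale_coords_def case_prod_beta)

text \<open>As \<open>\<phi>\<close> is tangent to the identity, it does not change the quadratic
  part \<open>q\<close> of the rescaled Hamiltonian. Comparing terms of order 2 gives
  \<open>q z = F 1 (actions z)\<close> exactly, and evaluation on coordinate vectors in position and
  momentum gives the two equations. The form thus determines the rescaling up to signs.\<close>

lemma birkhoff_quadratic_part:
  fixes V :: "real^'n::finite \<Rightarrow> real" and \<phi> :: "'n phase \<Rightarrow> 'n phase"
  assumes V: "quadratic_expansion V u" "V 0 = 0" and N: "N \<ge> 1"
    and F: "\<And>i. i \<ge> 1 \<Longrightarrow> homogeneous_polynomial i (F i)"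
    and \<phi>: "vanishes 2 (\<lambda>z. \<phi> z - z)"
    and norm_form: "vanishes (2 * N + 2) (\<lambda>z. hamiltonian V (rescaling c (\<phi> z)) - (\<Sum>i=1..N. F i (actions z)))"
  shows "u i * (c i) ^ 2 = F 1 (axis i 1)" "inverse (c i) ^ 2 = F 1 (axis i 1)"
proof -
  define q where "q z = (\<Sum>i\<in>UNIV. (inverse (c i) * snd z $ i) ^ 2) + (\<Sum>i\<in>UNIV. u i * (c i * fst z $ i) ^ 2)" for z :: "'n phase"
  have \<phi>1: "vanishes 1 \<phi>"
    using vanishes_add[OF vanishes_mono[OF \<phi>, of 1] vanishes_ident] by simp
  have q_scale: "q (t *\<^sub>R z) = t ^ 2 *\<^sub>R q z" for t z
    by (simp add: q_def power_mult_distrib sum_distrib_left distrib_left mult_ac)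
  have sm_coord: "smooth_germ (\<lambda>z :: 'n phase. fst z $ i)" "smooth_germ (\<lambda>z :: 'n phase. snd z $ i)" for i
    by (intro smooth_germ_vec_nth smooth_germ_bounded_linear bounded_linear_fst bounded_linear_snd)+
  have van_coord: "vanishes 1 (\<lambda>z :: 'n phase. a * fst z $ i)" "vanishes 1 (\<lambda>z :: 'n phase. a * snd z $ i)" for a i
    by (intro vanishes_cmult vanishes_1_smooth sm_coord; simp)+
  have sm_q: "smooth_germ q" unfolding q_def [abs_def]
    by (intro smooth_germ_add smooth_germ_sum smooth_germ_mult smooth_germ_power smooth_germ_const sm_coord)
  have van_q: "vanishes 2 q"
  proof -
    have sq: "vanishes 2 (\<lambda>z. f z ^ 2)" if "vanishes 1 f" for f :: "'n phase \<Rightarrow> real"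
      using vanishes_bilinear[OF bounded_bilinear_mult that that] by (simp add: power2_eq_square numeral_2_eq_2)
    show ?thesis unfolding q_def [abs_def] by (intro vanishes_add vanishes_sum vanishes_cmult sq van_coord)
  qed
  have "vanishes 4 (\<lambda>x. V x - (\<Sum>i\<in>UNIV. u i * (x $ i) ^ 2))"
    by (rule bigo_imp_vanishes) (use V in \<open>auto simp: quadratic_expansion_def\<close>)
  from vanishes_compose[OF vanishes_compose[OF this vanishes_1_bounded_linear[OF bounded_linear_scale_coords_fst]] \<phi>1, of c]
  have 1: "vanishes 4 (\<lambda>z. hamiltonian V (rescaling c (\<phi> z)) - q (\<phi> z))"
    by (simp add: hamiltonian_rescaling q_def scale_coords_def)
  have 2: "vanishes 3 (\<lambda>z. q (\<phi> z) - q z)"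
    using vanishes_compose_diff[OF sm_q van_q \<phi>] by (simp add: numeral_3_eq_3)
  have act: "vanishes 2 (actions :: 'n phase \<Rightarrow> _)"
  proof (rule vanishes_Suc_of_fderiv[OF smooth_germ_actions, of 1, unfolded Suc_1])
    show "actions (0 :: 'n phase) = 0" by (simp add: actions_def zero_prod_def vec_eq_iff)
    show "vanishes 1 (\<lambda>z :: 'n phase. fderiv actions z v)" for v
    proof (rule vanishes_1_smooth[OF smooth_germ_fderiv[OF smooth_germ_actions]])
      show "fderiv actions 0 v = 0"
        unfolding frechet_derivative_at[OF actions_has_derivative[of "0 :: 'n phase"], symmetric]
        by (simp add: orbit_tangent_def symplectic_form_alt)
    qed
  qed
  \<comment> \<open>\<open>vanishes_compose\<close> uses only that the inner function has order 1
    and would give order \<open>i\<close>; the doubled order needs that \<open>actions\<close> is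
    quadratic.\<close>
  have van_F: "vanishes (2 * i) (\<lambda>z :: 'n phase. F i (actions z))" if "i \<ge> 1" for i
  proof -
    note hom = F[OF that]
    obtain C e where C: "C \<ge> 0" "e > 0" "e \<le> 1" "\<And>s. norm s < e \<Longrightarrow> norm (F i s) \<le> C * norm s ^ i"
      using vanishesE[OF homogeneous_polynomial_vanishes[OF hom]] by blast
    obtain D d where D: "D \<ge> 0" "d > 0" "d \<le> 1" "\<And>z :: 'n phase. norm z < d \<Longrightarrow> norm (actions z) \<le> D * norm z ^ 2"
      using vanishesE[OF act] by blast
    have "filterlim actions (nhds 0) (nhds (0 :: 'n phase))"
      by (rule smooth_germ_tendsto_0[OF smooth_germ_actions]) (simp add: actions_def zero_prod_def vec_eq_iff)
    then have "\<forall>\<^sub>F z in nhds (0 :: 'n phase). actions z \<in> ball 0 e"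
      using C(2) by (metis topological_tendstoD open_ball centre_in_ball)
    moreover have "\<forall>\<^sub>F z in nhds (0 :: 'n phase). norm z < d"
      unfolding eventually_nhds_metric using D(2) by auto
    ultimately have "\<forall>\<^sub>F z in nhds (0 :: 'n phase). norm (F i (actions z)) \<le> (C * D ^ i) * norm z ^ (2 * i)"
    proof eventually_elim
      case (elim z)
      have "norm (F i (actions z)) \<le> C * norm (actions z) ^ i" using C(4) elim by simp
      also have "\<dots> \<le> C * (D * norm z ^ 2) ^ i" using C(1) D(4)[OF elim(2)] by (intro mult_left_mono power_mono) auto
      finally show ?case by (simp add: power_mult_distrib power_mult)
    qed
    then show ?thesis unfolding vanishes_def by blast
  qed
  have 3: "vanishes 4 (\<lambda>z :: 'n phase. \<Sum>i=2..N. F i (actions z))"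
    by (intro vanishes_sum vanishes_mono[OF van_F]) auto
  \<comment> \<open>The combination collapses to \<open>q z - F 1 (actions z)\<close>: the
    Hamiltonian and \<open>q (\<phi> z)\<close> cancel, and the last sum restores the terms of index
    at least 2.\<close>
  have "vanishes 3 (\<lambda>z. (hamiltonian V (rescaling c (\<phi> z)) - (\<Sum>i=1..N. F i (actions z)))
      - (hamiltonian V (rescaling c (\<phi> z)) - q (\<phi> z)) - (q (\<phi> z) - q z) + (\<Sum>i=2..N. F i (actions z)))"
    by (rule vanishes_add[OF vanishes_diff[OF vanishes_diff[OF vanishes_mono[OF norm_form] vanishes_mono[OF 1]] 2] vanishes_mono[OF 3]])
      (use N in auto)
  moreover have "(\<Sum>i=1..N. F i (actions z)) = F 1 (actions z) + (\<Sum>i=2..N. F i (actions z))" for z :: "'n phase"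
    using N sum.atLeast_Suc_atMost[of 1 N "\<lambda>i. F i (actions z)"] by (simp add: numeral_2_eq_2)
  ultimately have van: "vanishes (Suc 2) (\<lambda>z. q z - F 1 (actions z))" by simp
  have act_scale: "actions (t *\<^sub>R z) = t ^ 2 *\<^sub>R actions z" for t and z :: "'n phase"
    by (simp add: actions_def case_prod_beta vec_eq_iff power_mult_distrib distrib_left)
  have F1_scale: "F (Suc 0) (r *\<^sub>R s) = r * F (Suc 0) s" for r s
    using homogeneous_polynomial_scale[OF F[of 1], of r s] by simp
  have eq: "q z - F 1 (actions z) = 0" for z
    by (rule vanishes_homogeneous_imp_zero[OF van])
      (simp add: q_scale act_scale F1_scale algebra_simps)
  have "actions (axis i 1 :: real^'n, 0) = axis i 1" "actions (0, axis i 1 :: real^'n) = axis i 1"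
    by (auto simp: actions_def vec_eq_iff axis_def)
  moreover have "q (axis i 1, 0) = u i * (c i) ^ 2"
    by (simp add: q_def axis_def if_distrib[of "\<lambda>x. _ * x"] if_distrib[of "\<lambda>x. x ^ 2"] cong: if_cong)
  moreover have "q (0, axis i 1) = inverse (c i) ^ 2"
    by (simp add: q_def axis_def if_distrib[of "\<lambda>x. _ * x"] if_distrib[of "\<lambda>x. x ^ 2"] cong: if_cong)
  ultimately show "u i * (c i) ^ 2 = F 1 (axis i 1)" "inverse (c i) ^ 2 = F 1 (axis i 1)"
    using eq[of "(axis i 1, 0)"] eq[of "(0, axis i 1)"] by simp_all
qed

lemma actions_poly_fun:
  fixes y :: "nat \<Rightarrow> 'n::finite phase"
  shows "poly_fun (2 * K) (\<lambda>t. actions (\<Sum>k\<le>K. (t gchoose k) *\<^sub>R y k) $ j)"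
proof -
  have "poly_fun K (\<lambda>t. \<Sum>k\<le>K. (t gchoose k) * a k)" for a :: "nat \<Rightarrow> real"
    using poly_fun_sum[of "{..K}" K "\<lambda>k t. a k * (t gchoose k)"] poly_fun_mono[OF poly_fun_cmult[OF poly_fun_gchoose]]
    by (simp add: mult.commute)
  then show ?thesis
    by (simp add: actions_def case_prod_beta fst_sum snd_sum poly_fun_add poly_fun_power)
qed

text \<open>Both normal forms are taken with \<open>N = d\<close>, whose remainders of order
  \<open>2 * d + 2\<close> lie beyond the order \<open>Suc d\<close> that is examined.\<close>

lemma birkhoff_determines_next_order:
  fixes V W :: "real^'n::finite \<Rightarrow> real"
  assumes V: "smooth_germ V" "V 0 = 0" "sign_symmetric V" "quadratic_expansion V u" "birkhoff_form (hamiltonian V) F"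
    and W: "smooth_germ W" "W 0 = 0" "sign_symmetric W" "quadratic_expansion W w" "birkhoff_form (hamiltonian W) F"
    and VW: "vanishes d (\<lambda>x. V x - W x)" and d: "d \<ge> 1"
  shows "vanishes (Suc d) (\<lambda>x. V x - W x)"
proof -
  have F: "homogeneous_polynomial i (F i)" if "i \<ge> 1" for i
    using V(5) that unfolding birkhoff_form_def by blast
  have H0: "hamiltonian V (0, 0) = 0" "hamiltonian W (0, 0) = 0"
    using V(2) W(2) by (simp_all add: hamiltonian_def)
  obtain U1 c \<phi> where U1: "open U1" "0 \<in> U1" "canonical_on U1 \<phi>" "\<phi> 0 = 0" "(\<phi> has_derivative id) (at 0)"
    and c: "\<And>i. c i \<noteq> 0"
    and v1: "vanishes (2 * d + 2) (\<lambda>z. hamiltonian V (rescaling c (\<phi> z)) - (\<Sum>i=1..d. F i (actions z)))"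
    by (rule birkhoff_formE[OF V(5) d H0(1)], rule that)
  obtain U2 c' \<phi>' where U2: "open U2" "0 \<in> U2" "canonical_on U2 \<phi>'" "\<phi>' 0 = 0" "(\<phi>' has_derivative id) (at 0)"
    and c': "\<And>i. c' i \<noteq> 0"
    and v2: "vanishes (2 * d + 2) (\<lambda>z. hamiltonian W (rescaling c' (\<phi>' z)) - (\<Sum>i=1..d. F i (actions z)))"
    by (rule birkhoff_formE[OF W(5) d H0(2)], rule that)
  have sm\<phi>: "smooth_germ \<phi>" "smooth_germ \<phi>'"
    using U1 U2 unfolding smooth_germ_def canonical_on_def by blast+
  have \<phi>2: "vanishes 2 (\<lambda>z. \<phi> z - z)" "vanishes 2 (\<lambda>z. \<phi>' z - z)"
    by (intro vanishes_2_tangent_id sm\<phi> U1 U2)+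
  have c2: "inverse (c i) ^ 2 = inverse (c' i) ^ 2" for i
    using birkhoff_quadratic_part(2)[OF V(4,2) d F \<phi>2(1) v1, of i]
      birkhoff_quadratic_part(2)[OF W(4,2) d F \<phi>2(2) v2, of i] by simp
  \<comment> \<open>The squares of \<open>c i\<close> and \<open>c' i\<close> agree, so the
    rescalings differ by signs. Signs disappear in the kinetic energy and, by sign symmetry, in
    \<open>W\<close>.\<close>
  have resc: "hamiltonian W (rescaling c' z) = hamiltonian W (rescaling c z)" for z
  proof -
    define \<sigma> where "\<sigma> i = c' i / c i" for i
    have \<sigma>: "\<sigma> i \<in> {-1, 1}" for i
    proof -
      have "(c i)\<^sup>2 = (c' i)\<^sup>2" using c2[of i] by (simp add: power_inverse)
      then have "c' i = c i \<or> c' i = - c i" by (metis power2_eq_iff)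
      then show ?thesis using c[of i] by (auto simp: \<sigma>_def)
    qed
    have "scale_coords c' x = (\<chi> i. \<sigma> i * scale_coords c x $ i)" for x
      using c by (simp add: scale_coords_def \<sigma>_def vec_eq_iff)
    then have "W (scale_coords c' x) = W (scale_coords c x)" for x
      using W(3) \<sigma> unfolding sign_symmetric_def by metis
    then show ?thesis using c2 by (simp add: hamiltonian_rescaling power_mult_distrib)
  qed
  have smVW: "smooth_germ (\<lambda>x. V x - W x)" using V W by auto
  obtain P where P: "homogeneous_polynomial d P" and VWP: "vanishes (Suc d) (\<lambda>x. V x - W x - P x)"
    using taylor_leading_term[OF smVW VW] by blast
  \<comment> \<open>The leading part inherits the symmetry: the difference of the two sides is
    homogeneous of degree \<open>d\<close> but has order \<open>Suc d\<close>.\<close>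
  have P_even: "P (\<chi> i. \<sigma> i * x $ i) = P x" if \<sigma>: "\<And>i. \<sigma> i \<in> {-1, 1}" for \<sigma> x
  proof -
    have lin: "vanishes 1 (scale_coords \<sigma>)"
      by (rule vanishes_1_bounded_linear[OF bounded_linear_scale_coords])
    have sym: "V (scale_coords \<sigma> x) = V x" "W (scale_coords \<sigma> x) = W x" for x
      using V(3) W(3) \<sigma> unfolding sign_symmetric_def scale_coords_def by blast+
    have "vanishes (Suc d) (\<lambda>x. P (scale_coords \<sigma> x) - P x)"
      using vanishes_diff[OF VWP vanishes_compose[OF VWP lin]] by (simp add: sym)
    moreover have "P (scale_coords \<sigma> (t *\<^sub>R x)) - P (t *\<^sub>R x) = t ^ d *\<^sub>R (P (scale_coords \<sigma> x) - P x)" for t x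
      using linear_scale[OF bounded_linear.linear[OF bounded_linear_scale_coords[of \<sigma>]], of t x]
      by (simp add: homogeneous_polynomial_scale[OF P] right_diff_distrib)
    ultimately have "P (scale_coords \<sigma> x) - P x = 0"
      by (rule vanishes_homogeneous_imp_zero)
    then show ?thesis by (simp add: scale_coords_def)
  qed
  define Q where "Q z = P (scale_coords c (fst z))" for z :: "'n phase"
  have smQ: "smooth_germ Q" unfolding Q_def [abs_def]
    by (rule smooth_germ_compose[OF homogeneous_polynomial_smooth_germ[OF P]
          smooth_germ_bounded_linear[OF bounded_linear_scale_coords_fst]])
      (simp add: scale_coords_def vec_eq_iff)
  have vanQ: "vanishes d Q" unfolding Q_def [abs_def]
    by (rule vanishes_compose[OF homogeneous_polynomial_vanishes[OF P]
          vanishes_1_bounded_linear[OF bounded_linear_scale_coords_fst]])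
  define f where "f z = (\<Sum>i=1..d. F i (actions z))" for z :: "'n phase"
  have smF: "smooth_germ (\<lambda>s. \<Sum>i=1..d. F i s)"
    by (intro smooth_germ_sum, rule homogeneous_polynomial_smooth_germ[OF F]) auto
  have act0: "actions (0 :: 'n phase) = 0" by (simp add: actions_def zero_prod_def vec_eq_iff)
  have smf: "smooth_germ f" unfolding f_def [abs_def]
    by (rule smooth_germ_compose[OF smF smooth_germ_actions act0])
  obtain \<rho> where \<rho>: "smooth_germ \<rho>" "\<rho> 0 = 0" "(\<rho> has_derivative id) (at 0)"
      "\<forall>\<^sub>F y in nhds 0. symplectic_map (fderiv \<rho> y)" "\<forall>\<^sub>F y in nhds 0. \<phi>' (\<rho> y) = y"
    using canonical_local_inverse[OF U2] by blast
  \<comment> \<open>Since \<open>\<rho>\<close> inverts \<open>\<phi>'\<close>, near the origin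
    \<open>\<phi>' (\<psi> z) = \<phi> z\<close>: the normal form of \<open>W\<close> at
    \<open>\<psi> z\<close> involves its Hamiltonian at the same point as the normal form of
    \<open>V\<close> at \<open>z\<close>.\<close>
  define \<psi> where "\<psi> z = \<rho> (\<phi> z)" for z
  have lim\<phi>: "filterlim \<phi> (nhds 0) (nhds 0)" by (rule smooth_germ_tendsto_0[OF sm\<phi>(1) U1(4)])
  have sm\<psi>: "smooth_germ \<psi>" unfolding \<psi>_def [abs_def] by (rule smooth_germ_compose[OF \<rho>(1) sm\<phi>(1) U1(4)])
  have \<psi>0: "\<psi> 0 = 0" by (simp add: \<psi>_def U1(4) \<rho>(2))
  have \<psi>2: "vanishes 2 (\<lambda>z. \<psi> z - z)"
  proof (rule vanishes_2_tangent_id[OF sm\<psi> \<psi>0])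
    show "(\<psi> has_derivative id) (at 0)"
      using has_derivative_compose[OF U1(5), of \<rho> id] \<rho>(3) U1(4) by (simp add: \<psi>_def [abs_def] id_def)
  qed
  have \<psi>symp: "\<forall>\<^sub>F z in nhds 0. symplectic_map (fderiv \<psi> z)"
  proof -
    have "\<forall>\<^sub>F z in nhds 0. symplectic_map (fderiv \<phi> z)"
      using U1 unfolding eventually_nhds canonical_on_def symplectic_map_def by blast
    moreover have "\<forall>\<^sub>F z in nhds 0. symplectic_map (fderiv \<rho> (\<phi> z))"
      using \<rho>(4) lim\<phi> by (rule eventually_compose_filterlim)
    moreover have "\<forall>\<^sub>F z in nhds 0. (\<rho> has_derivative fderiv \<rho> (\<phi> z)) (at (\<phi> z))"
      using smooth_germ_derivative[OF \<rho>(1)] lim\<phi> by (rule eventually_compose_filterlim)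
    ultimately show ?thesis using smooth_germ_derivative[OF sm\<phi>(1)]
    proof eventually_elim
      case (elim z)
      have "fderiv \<psi> z = (\<lambda>v. fderiv \<rho> (\<phi> z) (fderiv \<phi> z v))"
        unfolding \<psi>_def [abs_def] by (rule frechet_derivative_at[symmetric], rule has_derivative_compose[OF elim(4,3)])
      then show ?case using symplectic_map_compose[OF elim(2,1)] by simp
    qed
  qed
  have energy: "vanishes (Suc d) (\<lambda>z. f (\<psi> z) - f z + Q z)"
  proof -
    let ?A = "\<lambda>z. hamiltonian V (rescaling c (\<phi> z)) - f z"
    let ?B = "\<lambda>z. hamiltonian W (rescaling c (\<phi>' z)) - f z"
    let ?R = "\<lambda>x. V x - W x - P x"
    have \<phi>1: "vanishes 1 \<phi>" by (rule vanishes_1_smooth[OF sm\<phi>(1) U1(4)])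
    have A: "vanishes (Suc d) ?A" using v1 unfolding f_def by (rule vanishes_mono) simp
    have B: "vanishes (Suc d) (\<lambda>z. ?B (\<psi> z))"
      by (rule vanishes_compose[OF vanishes_mono[OF v2[unfolded resc, folded f_def]] vanishes_1_smooth[OF sm\<psi> \<psi>0]]) simp
    have R: "vanishes (Suc d) (\<lambda>z. ?R (scale_coords c (fst (\<phi> z))))"
      by (rule vanishes_compose[OF vanishes_compose[OF VWP vanishes_1_bounded_linear[OF bounded_linear_scale_coords_fst]] \<phi>1])
    \<comment> \<open>When the normal forms are subtracted, the kinetic energies cancel and
      \<open>V - W\<close> remains at the rescaled \<open>\<phi> z\<close>. Its leading part there
      is \<open>Q (\<phi> z)\<close>, which equals \<open>Q z\<close> up to order
      \<open>Suc d\<close>.\<close>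
    have "vanishes (Suc d) (\<lambda>z. ?A z - ?B (\<psi> z) - ?R (scale_coords c (fst (\<phi> z))) - (Q (\<phi> z) - Q z))"
      by (intro vanishes_diff[OF vanishes_diff[OF vanishes_diff[OF A B] R]] vanishes_compose_diff smQ vanQ \<phi>2)
    moreover have "\<forall>\<^sub>F z in nhds 0. ?A z - ?B (\<psi> z) - ?R (scale_coords c (fst (\<phi> z))) - (Q (\<phi> z) - Q z) = f (\<psi> z) - f z + Q z"
      using eventually_compose_filterlim[OF \<rho>(5) lim\<phi>]
      by eventually_elim (simp add: \<psi>_def hamiltonian_rescaling Q_def)
    ultimately show ?thesis by (rule vanishes_cong[rotated])
  qed
  let ?X = "generator \<psi> d"
  have "vanishes (Suc d) (\<lambda>z. fderiv f z (?X z) + Q z)"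
  proof (rule generator_energy[OF sm\<psi> \<psi>0 \<psi>2 smf _ smQ vanQ energy order_refl])
    show "poly_fun (d * (2 * d)) (\<lambda>t. f (\<Sum>k\<le>d. (t gchoose k) *\<^sub>R y k))" for y
      unfolding f_def
      by (intro poly_fun_sum poly_fun_mono[OF homogeneous_polynomial_poly_fun[OF F actions_poly_fun]]) auto
  qed
  then have gen: "vanishes (Suc d) (\<lambda>z. fderiv (\<lambda>z. \<Sum>i=1..d. F i (actions z)) z (?X z) + Q z)"
    by (simp add: f_def [abs_def])
  obtain l :: "'n list" where l: "set l = UNIV" "distinct l"
    using finite_distinct_list[of "UNIV :: 'n set"] by auto
  have avQ: "avs l (\<lambda>\<theta>. Q (orbit x \<theta>)) 0 = 0" for x
  proof (rule torus_average_eq_zero[OF smF smooth_germ_generator[OF sm\<psi> \<psi>0 \<psi>2] _ gen order_refl _ _ l(1)])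
    show "vanishes (Suc d) (\<lambda>z. symplectic_form (fderiv ?X z v) w + symplectic_form v (fderiv ?X z w))" for v w
      by (rule generator_infinitesimally_symplectic[OF sm\<psi> \<psi>0 \<psi>2 \<psi>symp])
    show "continuous_on UNIV Q" unfolding Q_def [abs_def]
      by (rule continuous_on_compose2[OF homogeneous_polynomial_continuous[OF P]
            linear_continuous_on[OF bounded_linear_scale_coords_fst]]) auto
    show "Q (t *\<^sub>R z) = t ^ d * Q z" for t z
      using linear_scale[OF bounded_linear.linear[OF bounded_linear_scale_coords[of c]], of t "fst z"]
      by (simp add: Q_def homogeneous_polynomial_scale[OF P])
  qed
  have "P x = 0" for x
  proof (rule even_polynomial_average_eq_zero[OF P P_even l(2,1)])
    fix x :: "real^'n"
    \<comment> \<open>Dividing the amplitudes by \<open>c j\<close> undoes the rescaling inside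
      \<open>Q\<close>.\<close>
    have "Q (orbit (\<chi> j. x $ j / c j) \<theta>) = P (\<chi> j. x $ j * cos (\<theta> $ j))" for \<theta>
      using c by (simp add: Q_def orbit_def scale_coords_def)
    then show "avs l (\<lambda>\<theta>. P (\<chi> j. x $ j * cos (\<theta> $ j))) 0 = 0"
      using avQ[of "\<chi> j. x $ j / c j"] by simp
  qed
  then show ?thesis using VWP by simp
qed

text \<open>Each partial derivative costs one order, so vanishing to all orders is preserved; this
  is why the induction over the list carries all orders at once.\<close>

lemma same_Taylor_series_of_vanishes:
  fixes V W :: "real^'n::finite \<Rightarrow> real"
  assumes "smooth_on V UNIV" "smooth_on W UNIV" "\<And>a. vanishes a (\<lambda>x. V x - W x)"
  shows "same_Taylor_series_at V W 0"
proof -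
  have "smooth_on (partial_derivs is V) UNIV \<and> smooth_on (partial_derivs is W) UNIV \<and>
      (\<forall>a. vanishes a (\<lambda>x. partial_derivs is V x - partial_derivs is W x))" for "is"
  proof (induction "is")
    case Nil
    then show ?case using assms by (simp add: partial_derivs_def)
  next
    case (Cons i "is")
    let ?f = "partial_derivs is V" and ?g = "partial_derivs is W"
    have sm: "smooth_on ?f UNIV" "smooth_on ?g UNIV" using Cons by auto
    have germ: "smooth_germ ?f" "smooth_germ ?g" using sm unfolding smooth_germ_def by blast+
    have eq: "partial_derivs (i # is) f = (\<lambda>x. fderiv (partial_derivs is f) x (axis i 1))" for f :: "real^'n \<Rightarrow> real"
      by (simp add: partial_derivs_def partial_deriv_def)
    have "vanishes a (\<lambda>x. fderiv ?f x (axis i 1) - fderiv ?g x (axis i 1))" for a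
    proof -
      have "vanishes (Suc a) (\<lambda>x. ?f x - ?g x)" using Cons by blast
      from vanishes_fderiv[OF smooth_germ_diff[OF germ] this]
      have "vanishes a (\<lambda>x. fderiv (\<lambda>x. ?f x - ?g x) x (axis i 1))" by simp
      moreover have "fderiv (\<lambda>x. ?f x - ?g x) x = (\<lambda>v. fderiv ?f x v - fderiv ?g x v)" for x
        by (rule frechet_derivative_at[symmetric], intro has_derivative_diff)
          (use smooth_on_derivative[OF open_UNIV sm(1)] smooth_on_derivative[OF open_UNIV sm(2)] in auto)
      ultimately show ?thesis by simp
    qed
    then show ?case unfolding eq using smooth_on_fderiv[OF sm(1)] smooth_on_fderiv[OF sm(2)] by blast
  qed
  then have van: "vanishes 1 (\<lambda>x. partial_derivs is V x - partial_derivs is W x)" for "is" by blast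
  have "partial_derivs is V 0 - partial_derivs is W 0 = 0" for "is"
    by (rule vanishes_at_0[OF van]) simp
  then show ?thesis unfolding same_Taylor_series_at_def by simp
qed

theorem theorem1p2:
  fixes V W :: "real^'n::finite \<Rightarrow> real"
    and u w :: "'n \<Rightarrow> real"
    and F :: "nat \<Rightarrow> real^'n \<Rightarrow> real"
  assumes "is_potential V" and "is_potential W"
    and "sign_symmetric V" and "sign_symmetric W"
    and "quadratic_expansion V u" and "rationally_independent u"
    and "quadratic_expansion W w" and "rationally_independent w"
    and "birkhoff_form (hamiltonian V) F" and "birkhoff_form (hamiltonian W) F"
  shows "same_Taylor_series_at V W 0"
proof -
  have V: "smooth_on V UNIV" "V 0 = 0" and W: "smooth_on W UNIV" "W 0 = 0"
    using assms(1,2) unfolding is_potential_def by blast+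
  have germ: "smooth_germ V" "smooth_germ W" using V(1) W(1) unfolding smooth_germ_def by blast+
  have F: "homogeneous_polynomial i (F i)" if "i \<ge> 1" for i
    using assms(9) that unfolding birkhoff_form_def by blast
  \<comment> \<open>The two equations of \<open>birkhoff_quadratic_part\<close> are multiplied,
    which eliminates the unknown rescaling constant.\<close>
  have quad: "u i = F 1 (axis i 1) ^ 2" if H: "quadratic_expansion V u" "V 0 = 0" "birkhoff_form (hamiltonian V) F"
    for V :: "real^'n \<Rightarrow> real" and u i
  proof -
    have "hamiltonian V (0, 0) = 0" using H(2) by (simp add: hamiltonian_def)
    note H0 = this
    obtain U c \<phi> where U: "open U" "0 \<in> U" "canonical_on U \<phi>" "\<phi> 0 = 0" "(\<phi> has_derivative id) (at 0)"
      and c: "\<And>i. c i \<noteq> 0"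
      and nf: "vanishes (2 * 1 + 2) (\<lambda>z. hamiltonian V (rescaling c (\<phi> z)) - (\<Sum>i=1..1. F i (actions z)))"
      by (rule birkhoff_formE[OF H(3) order_refl H0], rule that)
    have "smooth_germ \<phi>" using U unfolding smooth_germ_def canonical_on_def by blast
    then have "vanishes 2 (\<lambda>z. \<phi> z - z)" using U(4,5) by (rule vanishes_2_tangent_id)
    from birkhoff_quadratic_part[OF H(1,2) order_refl F this nf, of i]
    have 1: "u i * (c i)\<^sup>2 = F 1 (axis i 1)" "inverse (c i) ^ 2 = F 1 (axis i 1)" by blast+
    have "u i = (u i * (c i)\<^sup>2) * inverse (c i) ^ 2" using c[of i] by (simp add: power_inverse)
    then show ?thesis unfolding 1 by (simp add: power2_eq_square)
  qed
  have "u = w" using quad[OF assms(5) V(2) assms(9)] quad[OF assms(7) W(2) assms(10)] by auto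
  have "vanishes 4 (\<lambda>x. (V x - (\<Sum>i\<in>UNIV. u i * (x $ i)^2)) - (W x - (\<Sum>i\<in>UNIV. w i * (x $ i)^2)))"
    by (intro vanishes_diff bigo_imp_vanishes)
      (use assms(5,7) V(2) W(2) in \<open>simp_all add: quadratic_expansion_def\<close>)
  \<comment> \<open>The quadratic parts cancel because \<open>u = w\<close>, and only the two
    quartic remainders are left.\<close>
  then have base: "vanishes 4 (\<lambda>x. V x - W x)" by (simp add: \<open>u = w\<close>)
  have step: "vanishes (4 + a) (\<lambda>x. V x - W x)" for a
  proof (induction a)
    case (Suc a)
    from birkhoff_determines_next_order[OF germ(1) V(2) assms(3,5,9) germ(2) W(2) assms(4,7,10) Suc]
    show ?case by simp
  qed (simp add: base)
  have "vanishes a (\<lambda>x. V x - W x)" for a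
    using step[of a] by (rule vanishes_mono) simp
  then show ?thesis by (rule same_Taylor_series_of_vanishes[OF V(1) W(1)])
qed

end
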